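(* Let $N \geq 2$ and $1 \leq k \leq N$. Then for any constant $C > 0$ there exists a harmonic function $h \in \mathcal{H}(\mathbb{R}^N)$ that is frequently hypercyclic for the partial differentiation operator $\partial/\partial x_k \colon \mathcal{H}(\mathbb{R}^N) \to \mathcal{H}(\mathbb{R}^N)$ and such that $$M_2(h,r) \leq C \frac{e^r}{r^{N/2 - 3/4}}$$ for all $r > 0$.
   Context: $\mathcal{H}(\mathbb{R}^N)$ denotes the space of (real-valued) harmonic functions on $\mathbb{R}^N$, which is a separable Fréchet space under the topology of local uniform convergence on $\mathbb{R}^N$. For a separable Fréchet space $X$ and a continuous linear operator $T \colon X \to X$, a vector $x \in X$ is called a frequently hypercyclic vector for $T$ (or frequently hypercyclic for $T$) if for every nonempty open set $U \subset X$ $$\liminf_{m\to\infty} \frac{\# \{ n : T^n x \in U,\; 0 \leq n \leq m\}}{m} > 0 .$$ For $r>0$, $S(r)$ is the Euclidean sphere of radius $r$ centred at the origin of $\mathbb{R}^N$, $\sigma_r$ is the $(N-1)$-dimensional (surface) measure on $S(r)$ normalised so that $\sigma_r(S(r)) = 1$, and $$M_2(h,r) = \left( \int_{S(r)} |h|^2 \, d\sigma_r \right)^{1/2}.$$ *)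

theory Defs
  imports "HOL-Analysis.Analysis"
begin

text \<open>\<open>\<real>\<^sup>N\<close> is \<open>real ^ 'n\<close> with \<open>N = CARD('n)\<close>, and the coordinate indices
  \<open>1 \<le> k \<le> N\<close> are the elements \<open>k :: 'n\<close>. The value of \<^const>\<open>deriv\<close> is meaningful only
  where the partial derivative exists.\<close>

definition partial :: "'n \<Rightarrow> (real ^ 'n \<Rightarrow> real) \<Rightarrow> (real ^ 'n \<Rightarrow> real)" where
  "partial k h = (\<lambda>x. deriv (\<lambda>t. h (x + t *\<^sub>R axis k 1)) 0)"

definition C1 :: "(real ^ 'n \<Rightarrow> real) \<Rightarrow> bool" where
  "C1 h \<longleftrightarrow> (\<forall>i. (\<forall>x. (\<lambda>t. h (x + t *\<^sub>R axis i 1)) differentiable (at 0)) \<and>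
                 continuous_on UNIV (partial i h))"

definition C2 :: "(real ^ 'n \<Rightarrow> real) \<Rightarrow> bool" where
  "C2 h \<longleftrightarrow> C1 h \<and> (\<forall>i. C1 (partial i h))"

definition laplacian :: "(real ^ 'n \<Rightarrow> real) \<Rightarrow> (real ^ 'n \<Rightarrow> real)" where
  "laplacian h = (\<lambda>x. \<Sum>i\<in>UNIV. partial i (partial i h) x)"

definition harmonic_functions :: "(real ^ 'n \<Rightarrow> real) set" where
  "harmonic_functions = {h. C2 h \<and> (\<forall>x. laplacian h x = 0)}"

text \<open>On \<open>\<real>\<^sup>N\<close> local uniform convergence is uniform convergence on compact sets. The neighbourhoods
  of \<open>f\<close> are the sets of harmonic functions that contain some
  \<open>{g. \<forall>x\<in>K. \<bar>g x - f x\<bar> < \<epsilon>}\<close> with \<open>K\<close> compact and \<open>\<epsilon> > 0\<close>.\<close>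

definition locally_uniform_open :: "(real ^ 'n \<Rightarrow> real) set \<Rightarrow> bool" where
  "locally_uniform_open U \<longleftrightarrow> U \<subseteq> harmonic_functions \<and>
     (\<forall>f\<in>U. \<exists>K \<epsilon>. compact K \<and> \<epsilon> > 0 \<and>
        {g \<in> harmonic_functions. \<forall>x\<in>K. \<bar>g x - f x\<bar> < \<epsilon>} \<subseteq> U)"

definition harmonic_topology :: "(real ^ 'n \<Rightarrow> real) topology" where
  "harmonic_topology = topology locally_uniform_open"

lemma istopology_locally_uniform_open: "istopology locally_uniform_open"
  unfolding istopology_def
proof (intro conjI allI impI)
  fix S T :: "(real ^ 'n \<Rightarrow> real) set"
  assume S: "locally_uniform_open S" and T: "locally_uniform_open T"
  show "locally_uniform_open (S \<inter> T)"
    unfolding locally_uniform_open_def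
  proof (intro conjI ballI)
    show "S \<inter> T \<subseteq> harmonic_functions"
      using S by (auto simp: locally_uniform_open_def)
    fix f assume f: "f \<in> S \<inter> T"
    obtain K d where K: "compact K" "d > 0"
        "{g \<in> harmonic_functions. \<forall>x\<in>K. \<bar>g x - f x\<bar> < d} \<subseteq> S"
      using S f unfolding locally_uniform_open_def by (meson IntD1)
    obtain L e where L: "compact L" "e > 0"
        "{g \<in> harmonic_functions. \<forall>x\<in>L. \<bar>g x - f x\<bar> < e} \<subseteq> T"
      using T f unfolding locally_uniform_open_def by (meson IntD2)
    have "{g \<in> harmonic_functions. \<forall>x\<in>K \<union> L. \<bar>g x - f x\<bar> < min d e} \<subseteq> S \<inter> T"
      using K(3) L(3) by auto
    then show "\<exists>K \<epsilon>. compact K \<and> \<epsilon> > 0 \<and>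
        {g \<in> harmonic_functions. \<forall>x\<in>K. \<bar>g x - f x\<bar> < \<epsilon>} \<subseteq> S \<inter> T"
      using K(1,2) L(1,2) by (intro exI[of _ "K \<union> L"] exI[of _ "min d e"] conjI) (simp_all add: compact_Un)
  qed
next
  fix \<U> :: "(real ^ 'n \<Rightarrow> real) set set"
  assume U: "\<forall>U\<in>\<U>. locally_uniform_open U"
  show "locally_uniform_open (\<Union>\<U>)"
    unfolding locally_uniform_open_def
  proof (intro conjI ballI)
    show "\<Union>\<U> \<subseteq> harmonic_functions"
      using U by (auto simp: locally_uniform_open_def)
    fix f assume "f \<in> \<Union>\<U>"
    then obtain V where V: "V \<in> \<U>" "f \<in> V" by blast
    have "locally_uniform_open V" using U V(1) by (rule bspec)
    then obtain K e where K: "compact K" "e > 0"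
        "{g \<in> harmonic_functions. \<forall>x\<in>K. \<bar>g x - f x\<bar> < e} \<subseteq> V"
      using V(2) unfolding locally_uniform_open_def by meson
    have "{g \<in> harmonic_functions. \<forall>x\<in>K. \<bar>g x - f x\<bar> < e} \<subseteq> \<Union>\<U>"
      using K(3) V(1) by (rule subset_trans[OF _ Union_upper])
    with K(1,2) show "\<exists>K \<epsilon>. compact K \<and> \<epsilon> > 0 \<and>
        {g \<in> harmonic_functions. \<forall>x\<in>K. \<bar>g x - f x\<bar> < \<epsilon>} \<subseteq> \<Union>\<U>"
      by (intro exI[of _ K] exI[of _ e]) (intro conjI)
  qed
qed

lemma openin_harmonic_topology: "openin harmonic_topology U \<longleftrightarrow> locally_uniform_open U"
  unfolding harmonic_topology_def
  by (simp add: topology_inverse' istopology_locally_uniform_open)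

lemma topspace_harmonic_topology: "topspace harmonic_topology = harmonic_functions"
proof -
  have "locally_uniform_open harmonic_functions"
    unfolding locally_uniform_open_def
    by (intro conjI ballI exI[of _ "{}"] exI[of _ 1]) simp_all
  then show ?thesis
    unfolding topspace_def openin_harmonic_topology
    by (auto simp: locally_uniform_open_def)
qed

definition frequently_hypercyclic :: "'a topology \<Rightarrow> ('a \<Rightarrow> 'a) \<Rightarrow> 'a \<Rightarrow> bool" where
  "frequently_hypercyclic X T x \<longleftrightarrow> x \<in> topspace X \<and>
     (\<forall>U. openin X U \<and> U \<noteq> {} \<longrightarrow>
        liminf (\<lambda>m. ereal (real (card {n. n \<le> m \<and> (T ^^ n) x \<in> U}) / real m)) > 0)"

text \<open>The surface measure of \<open>E \<subseteq> S(r)\<close> is, up to the factor \<open>N / r\<close>, the Lebesgue measure of the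
  solid cone \<open>{t *\<^sub>R x | 0 < t \<le> 1, x \<in> E}\<close> over \<open>E\<close>; this is the measure in the polar coordinate
  formula. The cone is the preimage of \<open>E\<close> in the closed ball under the radial projection
  \<open>x \<mapsto> r *\<^sub>R sgn x\<close>; the origin, where \<open>sgn 0 = 0\<close>, is a null set.\<close>

definition surface_measure :: "real \<Rightarrow> (real ^ 'n) measure" where
  "surface_measure r = scale_measure (ennreal (real CARD('n) / r))
     (distr (restrict_space lborel (cball 0 r)) borel (\<lambda>x. r *\<^sub>R sgn x))"

definition normalised_surface_measure :: "real \<Rightarrow> (real ^ 'n) measure" where
  "normalised_surface_measure r = uniform_measure (surface_measure r) (sphere 0 r)"

definition M2 :: "(real ^ 'n \<Rightarrow> real) \<Rightarrow> real \<Rightarrow> real" where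
  "M2 h r = sqrt (LINT x:sphere 0 r|normalised_surface_measure r. \<bar>h x\<bar>\<^sup>2)"

lemma emeasure_surface_measure:
  fixes E :: "(real ^ 'n) set"
  assumes "r > 0" "E \<in> sets borel" "E \<subseteq> sphere 0 r"
  shows "emeasure (surface_measure r) E =
    ennreal (real CARD('n) / r) * emeasure lborel {t *\<^sub>R x | t x. 0 < t \<and> t \<le> 1 \<and> x \<in> E}"
proof -
  let ?f = "\<lambda>x::real ^ 'n. r *\<^sub>R sgn x"
  have eq: "?f -` E \<inter> cball 0 r = {t *\<^sub>R x | t x. 0 < t \<and> t \<le> 1 \<and> x \<in> E}"
  proof (intro set_eqI iffI)
    fix y assume y: "y \<in> ?f -` E \<inter> cball 0 r"
    then have "y \<noteq> 0" using assms by auto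
    moreover have "y = (norm y / r) *\<^sub>R ?f y"
      using \<open>y \<noteq> 0\<close> assms by (simp add: sgn_div_norm)
    ultimately show "y \<in> {t *\<^sub>R x | t x. 0 < t \<and> t \<le> 1 \<and> x \<in> E}"
      using y assms(1) by (intro CollectI exI[of _ "norm y / r"] exI[of _ "?f y"]) auto
  next
    fix y assume "y \<in> {t *\<^sub>R x | t x. 0 < t \<and> t \<le> 1 \<and> x \<in> E}"
    then obtain t x where tx: "y = t *\<^sub>R x" "0 < t" "t \<le> 1" "x \<in> E" by blast
    then have nx: "norm x = r" using assms by auto
    then have "?f y = x" using tx nx assms(1) by (simp add: sgn_div_norm field_simps)
    moreover have "norm y \<le> r" using tx nx assms(1) by (simp add: mult_left_le_one_le)
    ultimately show "y \<in> ?f -` E \<inter> cball 0 r" using tx by simp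
  qed
  have f: "?f \<in> borel_measurable lborel"
    by (simp add: sgn_div_norm)
  have "emeasure (distr (restrict_space lborel (cball 0 r)) borel ?f) E =
      emeasure (restrict_space lborel (cball 0 r)) (?f -` E \<inter> cball 0 r)"
    using assms f by (subst emeasure_distr) (auto intro!: measurable_restrict_space1 simp: space_restrict_space)
  also have "\<dots> = emeasure lborel (?f -` E \<inter> cball 0 r)"
    by (rule emeasure_restrict_space) auto
  finally show ?thesis
    by (simp add: surface_measure_def eq)
qed

lemma normalised_surface_measure_sphere:
  assumes "r > 0"
  shows "emeasure (normalised_surface_measure r) (sphere 0 r :: (real ^ 'n) set) = 1"
proof -
  let ?A = "{t *\<^sub>R x | t x. 0 < t \<and> t \<le> 1 \<and> x \<in> (sphere 0 r :: (real ^ 'n) set)}"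
  have A: "?A = cball 0 r - {0}"
  proof (intro set_eqI iffI)
    fix y assume "y \<in> ?A"
    then show "y \<in> cball 0 r - {0}" using assms by (auto simp: mult_left_le_one_le)
  next
    fix y :: "real ^ 'n" assume y: "y \<in> cball 0 r - {0}"
    then show "y \<in> ?A" using assms
      by (intro CollectI exI[of _ "norm y / r"] exI[of _ "r *\<^sub>R sgn y"])
         (auto simp: sgn_div_norm)
  qed
  have "emeasure lborel ?A = emeasure lborel (cball 0 r :: (real ^ 'n) set)"
    unfolding A using assms by (subst emeasure_Diff) auto
  moreover have "emeasure lborel (cball 0 r :: (real ^ 'n) set) > 0"
    unfolding emeasure_cball[OF less_imp_le[OF assms]]
    using assms by (simp add: unit_ball_vol_pos)
  moreover have "emeasure lborel (cball 0 r :: (real ^ 'n) set) < \<infinity>"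
    using emeasure_lborel_cball_finite by (simp add: less_top)
  moreover have "ennreal (real CARD('n) / r) > 0" using assms by simp
  ultimately have
    "emeasure (surface_measure r) (sphere 0 r :: (real ^ 'n) set) \<noteq> 0"
    "emeasure (surface_measure r) (sphere 0 r :: (real ^ 'n) set) \<noteq> \<infinity>"
    using assms by (auto simp: emeasure_surface_measure ennreal_mult_eq_top_iff)
  moreover have "sphere 0 r \<in> sets (surface_measure r :: (real ^ 'n) measure)"
    by (simp add: surface_measure_def)
  ultimately show ?thesis
    unfolding normalised_surface_measure_def
    by (subst emeasure_uniform_measure) (auto simp: ennreal_divide_self less_top)
qed

end

theory Submission
  imports Defs
begin

text \<open>Write \<open>N = CARD('n)\<close> and \<open>J\<close> for the mean over the unit sphere. As for entire functions and \<open>d/dz\<close>, the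
function is a lacunary sum \<open>h = \<Sum>l. \<Sum>n\<in>A l. Q l n\<close>: the polynomials \<open>Q l 0\<close> run through a countable dense
family of harmonic polynomials, \<open>Q l n\<close> is an \<open>n\<close>-fold antiderivative of \<open>Q l 0\<close> with respect to the
\<open>k\<close>-th variable, and the sets \<open>A l\<close> are disjoint, have positive lower density and large gaps
(\<open>separated_sets_exist\<close>). For \<open>n \<in> A l\<close> the \<open>n\<close>-th derivative of \<open>h\<close> is \<open>Q l 0\<close> up to a small error:
earlier terms are polynomials that have been differentiated away, and later terms have become
antiderivatives of high order, which decay like inverse factorials on each ball (\<open>hit\<close>). As the
error is at most \<open>2^-l\<close> on the ball of radius \<open>l\<close> and every target recurs for arbitrarily large \<open>l\<close>, each nonempty open
set is visited along some \<open>A l\<close>.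

The growth depends on antiderivatives whose mean squares are small. Homogeneous harmonic polynomials of
different degrees are orthogonal for \<open>J\<close>, and multiplication by the \<open>k\<close>-th coordinate followed by harmonic
projection (\<open>raise k\<close>) is adjoint to \<open>\<partial>_k\<close> up to a constant (\<open>raise_adjoint\<close>). Both follow from the rotation
invariance of \<open>J\<close>, which gives \<open>J (x_i \<partial>_j F - x_j \<partial>_i F) = 0\<close>. If \<open>U\<close> is harmonic of degree \<open>s\<close> with
\<open>\<partial>_k U = 0\<close>, the commutator of \<open>\<partial>_k\<close> and \<open>raise\<close> (\<open>partial_raise\<close>) shows that \<open>\<partial>_k\<close> maps each iterate
\<open>raise^(n+1) U\<close> to an explicit multiple of \<open>raise^n U\<close>. Normalising gives antiderivatives \<open>Q n\<close> of \<open>U\<close>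
with \<open>J ((Q n)\<^sup>2) \<le> K / ((n+s)! (n+s+N-2)!)\<close> (\<open>Q_mean_square\<close>). A general homogeneous harmonic polynomial is
reduced to this case by induction on its degree (\<open>admissible_exists\<close>).

With the Poisson weights \<open>p_n(r) = exp (-r) r^n / n!\<close> one has
\<open>r^(2n) / (n! (n+N-2)!) = exp (2r) r^(2-N) p_n(r) p_(n+N-2)(r)\<close>. The second weight is at most \<open>r^(-1/2)\<close>, which
yields the order \<open>exp (2r) / r^(N-3/2)\<close> for the mean square. The first weights, summed over a set with
gaps at least \<open>G\<close> and no element below \<open>G\<close>, give at most \<open>4 / sqrt G\<close> (\<open>sum_poisson_separated\<close>), so large gaps
make the constant in front of each block as small as required.

Density uses the sphere of radius \<open>R\<close>: on it the restrictions of the harmonic polynomials \<open>raise i1 (raise i2 ... 1)\<close>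
span a space that is closed under multiplication by coordinates, again by the commutator, hence
contains all polynomials. The theorem of Stone and Weierstrass approximates a harmonic function on the
sphere by such a combination, and the maximum principle carries the approximation into the ball
(\<open>harmonic_approximation\<close>).\<close>

section \<open>Partial derivatives of polynomials\<close>

abbreviation poly_fun :: "(real ^ 'n \<Rightarrow> real) \<Rightarrow> bool" where
  "poly_fun \<equiv> real_polynomial_function"

lemmas poly_fun_linear = real_polynomial_function.intros(1)
  and poly_fun_const = real_polynomial_function.intros(2)
  and poly_fun_add = real_polynomial_function.intros(3)
  and poly_fun_mult = real_polynomial_function.intros(4)

lemma partial_eqI:
  assumes "((\<lambda>t. F (x + t *\<^sub>R axis i 1)) has_real_derivative D) (at 0)"
  shows "partial i F x = D"
  using assms unfolding partial_def by (rule DERIV_imp_deriv)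

lemma poly_fun_coord [intro]: "poly_fun (\<lambda>x. x $ i)"
  by (rule poly_fun_linear) (rule bounded_linear_vec_nth)

lemma poly_fun_cmult [intro]: "poly_fun F \<Longrightarrow> poly_fun (\<lambda>x. c * F x)"
  using poly_fun_mult[OF poly_fun_const] by blast

lemma norm_sq_eq_sum: "(norm (x :: real ^ 'n))\<^sup>2 = (\<Sum>i\<in>UNIV. x $ i * x $ i)"
  by (simp add: power2_norm_eq_inner inner_vec_def)

lemma poly_fun_norm_sq [intro]: "poly_fun (\<lambda>x :: real ^ 'n. (norm x)\<^sup>2)"
  unfolding norm_sq_eq_sum by (intro real_polynomial_function_sum poly_fun_mult poly_fun_coord) auto

lemma poly_fun_partial_aux:
  assumes "poly_fun F"
  shows "(\<forall>x. ((\<lambda>t. F (x + t *\<^sub>R axis i 1)) has_real_derivative partial i F x) (at 0)) \<and> poly_fun (partial i F)"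
  using assms
proof (induction F rule: real_polynomial_function.induct)
  case (linear f)
  interpret bounded_linear f by fact
  have d: "((\<lambda>t. f (x + t *\<^sub>R axis i 1)) has_real_derivative f (axis i 1)) (at 0)" for x
    unfolding add scaleR by (auto intro!: derivative_eq_intros)
  then have "partial i f = (\<lambda>x. f (axis i 1))"
    by (auto intro: partial_eqI)
  with d show ?case by auto
next
  case (const c)
  have d: "((\<lambda>t. c) has_real_derivative 0) (at 0)" for x by auto
  then have "partial i (\<lambda>x. c) = (\<lambda>x. 0)"
    by (intro ext partial_eqI)
  with d show ?case by auto
next
  case (add f g)
  have d: "((\<lambda>t. f (x + t *\<^sub>R axis i 1) + g (x + t *\<^sub>R axis i 1)) has_real_derivative
      partial i f x + partial i g x) (at 0)" for x
    using add.IH by (auto intro!: derivative_intros)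
  then have "partial i (\<lambda>x. f x + g x) = (\<lambda>x. partial i f x + partial i g x)"
    by (auto intro: partial_eqI)
  with d add.IH show ?case by auto
next
  case (mult f g)
  have d: "((\<lambda>t. f (x + t *\<^sub>R axis i 1) * g (x + t *\<^sub>R axis i 1)) has_real_derivative
      f x * partial i g x + partial i f x * g x) (at 0)" for x
    using mult.IH by (auto intro!: derivative_eq_intros)
  then have "partial i (\<lambda>x. f x * g x) = (\<lambda>x. f x * partial i g x + partial i f x * g x)"
    by (auto intro: partial_eqI)
  with d mult show ?case by auto
qed

lemma poly_fun_deriv_0:
  "poly_fun F \<Longrightarrow> ((\<lambda>t. F (x + t *\<^sub>R axis i 1)) has_real_derivative partial i F x) (at 0)"
  using poly_fun_partial_aux by blast

lemma poly_fun_partial [intro]: "poly_fun F \<Longrightarrow> poly_fun (partial i F)"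
  using poly_fun_partial_aux by blast

lemma partial_linear:
  assumes "bounded_linear f" shows "partial i f = (\<lambda>x. f (axis i 1))"
proof
  fix x
  interpret bounded_linear f by fact
  show "partial i f x = f (axis i 1)"
    by (rule partial_eqI) (auto simp: add scaleR intro!: derivative_eq_intros)
qed

lemma partial_const [simp]: "partial i (\<lambda>x. c) = (\<lambda>x. 0)"
  by (rule ext, rule partial_eqI) auto

lemma partial_coord: "partial i (\<lambda>x. x $ j) = (\<lambda>x. if i = j then 1 else 0)"
  by (subst partial_linear) (auto simp: bounded_linear_vec_nth axis_def)

lemma partial_add:
  assumes "poly_fun F" "poly_fun G"
  shows "partial i (\<lambda>x. F x + G x) = (\<lambda>x. partial i F x + partial i G x)"
  using assms[THEN poly_fun_deriv_0]
  by (intro ext partial_eqI) (auto intro!: derivative_eq_intros)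

lemma partial_mult:
  assumes "poly_fun F" "poly_fun G"
  shows "partial i (\<lambda>x. F x * G x) = (\<lambda>x. F x * partial i G x + partial i F x * G x)"
  using assms[THEN poly_fun_deriv_0]
  by (intro ext partial_eqI) (auto intro!: derivative_eq_intros)

lemma partial_cmult:
  assumes "poly_fun F"
  shows "partial i (\<lambda>x. c * F x) = (\<lambda>x. c * partial i F x)"
  using partial_mult[OF poly_fun_const assms, of i c] by simp

lemma partial_diff:
  assumes "poly_fun F" "poly_fun G"
  shows "partial i (\<lambda>x. F x - G x) = (\<lambda>x. partial i F x - partial i G x)"
  using partial_add[OF assms(1) poly_fun_cmult[OF assms(2), of "-1"], of i]
    partial_cmult[OF assms(2), of i "-1"] by simp

lemma partial_divide:
  assumes "poly_fun F"
  shows "partial i (\<lambda>x. F x / c) = (\<lambda>x. partial i F x / c)"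
  using partial_cmult[OF assms, of i "1 / c"] by simp

lemma partial_sum:
  assumes "finite S" "\<And>s. s \<in> S \<Longrightarrow> poly_fun (F s)"
  shows "partial i (\<lambda>x. \<Sum>s\<in>S. F s x) = (\<lambda>x. \<Sum>s\<in>S. partial i (F s) x)"
  using assms
proof (induction S rule: finite_induct)
  case (insert a S)
  then show ?case
    by (simp add: partial_add real_polynomial_function_sum)
qed simp

lemma partial_norm_sq: "partial i (\<lambda>x :: real ^ 'n. (norm x)\<^sup>2) = (\<lambda>x. 2 * x $ i)"
proof -
  have "partial i (\<lambda>x :: real ^ 'n. (norm x)\<^sup>2) = (\<lambda>x. \<Sum>j\<in>UNIV. partial i (\<lambda>x. x $ j * x $ j) x)"
    unfolding norm_sq_eq_sum by (rule partial_sum) auto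
  also have "\<dots> = (\<lambda>x. \<Sum>j\<in>UNIV. if i = j then 2 * x $ i else 0)"
    by (intro ext sum.cong) (auto simp: partial_mult[OF poly_fun_coord poly_fun_coord] partial_coord)
  finally show ?thesis by simp
qed

lemma poly_fun_continuous [intro]: "poly_fun F \<Longrightarrow> continuous_on S F"
  by (simp add: continuous_on_polymonial_function real_polynomial_function_eq)

lemma sum_axis: "(\<Sum>i\<in>UNIV. v $ i *\<^sub>R axis i 1) = (v :: real ^ 'n)"
  by (simp add: vec_eq_iff axis_def if_distrib cong: if_cong)

lemma poly_fun_has_derivative:
  assumes "poly_fun F"
  shows "(F has_derivative (\<lambda>v. \<Sum>i\<in>UNIV. v $ i * partial i F x)) (at x)"
  using assms
proof (induction F rule: real_polynomial_function.induct)
  case (linear f)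
  note bl = linear
  interpret bounded_linear f by fact
  have "f v = (\<Sum>i\<in>UNIV. v $ i * f (axis i 1))" for v
    by (subst sum_axis[symmetric]) (simp add: sum scaleR del: sum_axis)
  then have "f = (\<lambda>v. \<Sum>i\<in>UNIV. v $ i * f (axis i 1))" by blast
  with bl show ?case
    unfolding partial_linear[OF bl] using bounded_linear_imp_has_derivative by metis
next
  case (const c)
  then show ?case by simp
next
  case (add f g)
  then show ?case
    by (auto simp: partial_add ring_distribs sum.distrib intro!: derivative_eq_intros)
next
  case (mult f g)
  have "((\<lambda>x. f x * g x) has_derivative
     (\<lambda>v. f x * (\<Sum>i\<in>UNIV. v $ i * partial i g x) + (\<Sum>i\<in>UNIV. v $ i * partial i f x) * g x)) (at x)"
    using mult by (intro has_derivative_mult)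
  then show ?case
    by (simp add: partial_mult mult algebra_simps sum.distrib sum_distrib_left sum_distrib_right)
qed

lemma partial_commute:
  assumes "poly_fun F"
  shows "partial i (partial j F) = partial j (partial i F)"
  using assms
proof (induction F rule: real_polynomial_function.induct)
  case (linear f) then show ?case by (simp add: partial_linear)
next
  case (const c) then show ?case by simp
next
  case (add f g) then show ?case by (simp add: partial_add poly_fun_partial)
next
  case (mult f g) then show ?case
    by (simp add: partial_mult partial_add poly_fun_partial poly_fun_mult add_ac)
qed

lemma poly_fun_C1: "poly_fun F \<Longrightarrow> C1 F"
  unfolding C1_def using poly_fun_deriv_0 real_differentiable_def by blast

lemma poly_fun_C2: "poly_fun F \<Longrightarrow> C2 F"
  unfolding C2_def by (auto intro: poly_fun_C1)

lemma laplacian_const [simp]: "laplacian (\<lambda>x. c) = (\<lambda>x. 0)"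
  by (simp add: laplacian_def)

lemma laplacian_add:
  assumes "poly_fun F" "poly_fun G"
  shows "laplacian (\<lambda>x. F x + G x) = (\<lambda>x. laplacian F x + laplacian G x)"
  using assms by (simp add: laplacian_def partial_add poly_fun_partial sum.distrib)

lemma laplacian_cmult:
  assumes "poly_fun F"
  shows "laplacian (\<lambda>x. c * F x) = (\<lambda>x. c * laplacian F x)"
  using assms by (simp add: laplacian_def partial_cmult poly_fun_partial sum_distrib_left)

lemma laplacian_diff:
  assumes "poly_fun F" "poly_fun G"
  shows "laplacian (\<lambda>x. F x - G x) = (\<lambda>x. laplacian F x - laplacian G x)"
  using assms by (simp add: laplacian_def partial_diff poly_fun_partial sum_subtractf)

lemma laplacian_mult:
  assumes "poly_fun F" "poly_fun G"
  shows "laplacian (\<lambda>x. F x * G x) =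
    (\<lambda>x. F x * laplacian G x + 2 * (\<Sum>i\<in>UNIV. partial i F x * partial i G x) + laplacian F x * G x)"
proof
  fix x
  have "laplacian (\<lambda>x. F x * G x) x = (\<Sum>i\<in>UNIV. F x * partial i (partial i G) x
     + 2 * (partial i F x * partial i G x) + partial i (partial i F) x * G x)"
    unfolding laplacian_def using assms
    by (intro sum.cong) (simp_all add: partial_mult partial_add poly_fun_partial poly_fun_mult)
  then show "laplacian (\<lambda>x. F x * G x) x = F x * laplacian G x + 2 * (\<Sum>i\<in>UNIV. partial i F x * partial i G x) + laplacian F x * G x"
    by (simp add: sum.distrib laplacian_def sum_distrib_left sum_distrib_right)
qed

lemma laplacian_partial:
  assumes "poly_fun F"
  shows "laplacian (partial i F) = partial i (laplacian F)"
proof -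
  have "partial j (partial j (partial i F)) = partial i (partial j (partial j F))" for j
    using assms by (metis partial_commute poly_fun_partial)
  then show ?thesis
    using assms unfolding laplacian_def by (subst partial_sum) (auto intro: poly_fun_partial)
qed

lemma laplacian_coord_mult:
  assumes "poly_fun F"
  shows "laplacian (\<lambda>x. x $ k * F x) = (\<lambda>x. x $ k * laplacian F x + 2 * partial k F x)"
proof -
  have "laplacian (\<lambda>x :: real ^ 'a. x $ k) = (\<lambda>x. 0)"
    by (simp add: laplacian_def partial_coord)
  moreover have "(\<Sum>i\<in>UNIV. partial i (\<lambda>x. x $ k) x * partial i F x) = partial k F x" for x
    by (simp add: partial_coord if_distrib[of "\<lambda>u. u * _"] cong: if_cong)
  ultimately show ?thesis using assms by (simp add: laplacian_mult poly_fun_coord)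
qed

text \<open>\<open>\<Delta> |x|\<^sup>2 = 2N\<close> and \<open>\<nabla> |x|\<^sup>2 = 2x\<close>; the sum on the right is the Euler operator, known on homogeneous \<open>F\<close>.\<close>

lemma laplacian_norm_sq_mult:
  assumes "poly_fun (F :: real ^ 'n \<Rightarrow> real)"
  shows "laplacian (\<lambda>x. (norm x)\<^sup>2 * F x) =
    (\<lambda>x. (norm x)\<^sup>2 * laplacian F x + 4 * (\<Sum>i\<in>UNIV. x $ i * partial i F x) + 2 * real CARD('n) * F x)"
proof -
  have "laplacian (\<lambda>x :: real ^ 'n. (norm x)\<^sup>2) = (\<lambda>x. 2 * real CARD('n))"
    by (simp add: laplacian_def partial_norm_sq partial_cmult poly_fun_coord partial_coord mult.commute[of "_ $ _"] mult.commute[of "real _"])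
  moreover have "2 * (\<Sum>i\<in>UNIV. partial i (\<lambda>x. (norm x)\<^sup>2) x * partial i F x) =
      4 * (\<Sum>i\<in>UNIV. x $ i * partial i F x)" for x
    by (simp add: partial_norm_sq sum_distrib_left mult.assoc)
  ultimately show ?thesis using assms by (simp add: laplacian_mult poly_fun_norm_sq mult_ac add_ac)
qed

section \<open>Homogeneous harmonic polynomials and the raising operator\<close>

text \<open>Positive factors suffice and keep \<open>0 ^ 0\<close> out of the arguments.\<close>

definition homogeneous :: "nat \<Rightarrow> (real ^ 'n \<Rightarrow> real) \<Rightarrow> bool" where
  "homogeneous d F \<longleftrightarrow> (\<forall>t>0. \<forall>x. F (t *\<^sub>R x) = t ^ d * F x)"

text \<open>Differentiate \<open>F (t x) = t^d F x\<close> at \<open>t = 1\<close>.\<close>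

lemma euler:
  assumes "poly_fun F" "homogeneous d F"
  shows "(\<Sum>i\<in>UNIV. x $ i * partial i F x) = real d * F x"
proof -
  have "((\<lambda>t. F (t *\<^sub>R x)) has_derivative (\<lambda>s. \<Sum>i\<in>UNIV. (s *\<^sub>R x) $ i * partial i F (1 *\<^sub>R x))) (at 1)"
    by (rule has_derivative_compose[of "\<lambda>t. t *\<^sub>R x" _ 1 UNIV F, OF _ poly_fun_has_derivative[OF assms(1)]])
       (auto intro!: derivative_eq_intros)
  then have "((\<lambda>t. F (t *\<^sub>R x)) has_real_derivative (\<Sum>i\<in>UNIV. x $ i * partial i F x)) (at 1)"
    unfolding has_field_derivative_def
    by (simp add: sum_distrib_left[symmetric] mult.assoc) (metis (lifting) ext mult.commute)
  moreover have "((\<lambda>t. t ^ d * F x) has_real_derivative real d * F x) (at 1)"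
    by (auto intro!: derivative_eq_intros)
  then have "((\<lambda>t. F (t *\<^sub>R x)) has_real_derivative real d * F x) (at 1)"
    by (rule has_field_derivative_transform_within[where d = 1])
       (use assms(2) in \<open>auto simp: homogeneous_def dist_real_def\<close>)
  ultimately show ?thesis by (rule DERIV_unique)
qed

lemma homogeneous_0_const:
  assumes "poly_fun F" "homogeneous 0 F"
  shows "F = (\<lambda>x. F 0)"
proof
  fix x
  have "((\<lambda>t. F (t *\<^sub>R x)) \<longlongrightarrow> F (0 *\<^sub>R x)) (at_right 0)"
    by (rule continuous_on_tendsto_compose[of UNIV F])
       (auto intro!: poly_fun_continuous assms tendsto_eq_intros filterlim_ident[THEN filterlim_mono[OF _ _ order_refl]] simp: at_within_le_nhds)
  moreover have "((\<lambda>t. F (t *\<^sub>R x)) \<longlongrightarrow> F x) (at_right 0)"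
    by (rule tendsto_eventually)
       (use assms(2) in \<open>auto simp: homogeneous_def eventually_at_right[OF zero_less_one] intro!: exI[of _ 1]\<close>)
  ultimately show "F x = F 0"
    using tendsto_unique[OF trivial_limit_at_right_real] by force
qed

text \<open>In degree 0 the truncated difference \<open>d - 1\<close> does no harm: then \<open>F\<close> is constant and its derivative vanishes.\<close>

lemma homogeneous_partial:
  assumes "poly_fun F" "homogeneous d F"
  shows "homogeneous (d - 1) (partial i F)"
proof (cases d)
  case 0
  then have "partial i F = (\<lambda>x. 0)"
    using homogeneous_0_const[of F] assms partial_const[of i "F 0"] by simp
  then show ?thesis by (simp add: homogeneous_def)
next
  case (Suc e)
  show ?thesis unfolding homogeneous_def
  proof (intro allI impI)
    fix t :: real and x :: "real ^ 'a" assume t: "t > 0"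
    have "((\<lambda>s. F (t *\<^sub>R x + s *\<^sub>R axis i 1)) has_real_derivative partial i F (t *\<^sub>R x)) (at (t * 0))"
      using poly_fun_deriv_0[OF assms(1)] by simp
    then have "((\<lambda>s. F (t *\<^sub>R x + (t * s) *\<^sub>R axis i 1)) has_real_derivative partial i F (t *\<^sub>R x) * t) (at 0)"
      by (rule DERIV_chain2) (auto intro!: derivative_eq_intros)
    moreover have "(\<lambda>s. F (t *\<^sub>R x + (t * s) *\<^sub>R axis i 1)) = (\<lambda>s. t ^ d * F (x + s *\<^sub>R axis i 1))"
      using assms(2) t unfolding homogeneous_def by (metis scaleR_add_right scaleR_scaleR)
    moreover have "((\<lambda>s. t ^ d * F (x + s *\<^sub>R axis i 1)) has_real_derivative t ^ d * partial i F x) (at 0)"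
      by (intro DERIV_cmult poly_fun_deriv_0 assms)
    ultimately have "partial i F (t *\<^sub>R x) * t = t ^ d * partial i F x"
      by (metis DERIV_unique)
    then show "partial i F (t *\<^sub>R x) = t ^ (d - 1) * partial i F x"
      using t Suc by simp
  qed
qed

lemma homogeneous_mult:
  "homogeneous d F \<Longrightarrow> homogeneous e G \<Longrightarrow> homogeneous (d + e) (\<lambda>x. F x * G x)"
  by (simp add: homogeneous_def power_add)

definition solid_harmonic :: "nat \<Rightarrow> (real ^ 'n \<Rightarrow> real) \<Rightarrow> bool" where
  "solid_harmonic d F \<longleftrightarrow> poly_fun F \<and> homogeneous d F \<and> laplacian F = (\<lambda>x. 0)"

lemma solid_harmonicD:
  assumes "solid_harmonic d F"
  shows "poly_fun F" "homogeneous d F" "laplacian F = (\<lambda>x. 0)"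
  using assms by (auto simp: solid_harmonic_def)

lemma solid_harmonic_partial:
  assumes "solid_harmonic d F" shows "solid_harmonic (d - 1) (partial i F)"
  using solid_harmonicD[OF assms]
  using homogeneous_partial[of F d i] by (auto simp: solid_harmonic_def laplacian_partial)

lemma solid_harmonic_partial_0:
  assumes "solid_harmonic 0 F" shows "partial i F = (\<lambda>x. 0)"
  using homogeneous_0_const[OF solid_harmonicD(1,2)[OF assms]] partial_const by metis

lemma solid_harmonic_cmult:
  "solid_harmonic d F \<Longrightarrow> solid_harmonic d (\<lambda>x. c * F x)"
  by (auto simp: solid_harmonic_def homogeneous_def laplacian_cmult)

lemma solid_harmonic_diff:
  "solid_harmonic d F \<Longrightarrow> solid_harmonic d G \<Longrightarrow> solid_harmonic d (\<lambda>x. F x - G x)"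
  by (auto simp: solid_harmonic_def homogeneous_def laplacian_diff right_diff_distrib)

lemma solid_harmonic_add:
  "solid_harmonic d F \<Longrightarrow> solid_harmonic d G \<Longrightarrow> solid_harmonic d (\<lambda>x. F x + G x)"
  by (auto simp: solid_harmonic_def homogeneous_def laplacian_add distrib_left)

text \<open>For \<open>F\<close> harmonic and homogeneous of degree \<open>d\<close> this is the harmonic projection of \<open>x_k F\<close>, the component of
\<open>x_k F\<close> in the decomposition of polynomials into harmonic ones and multiples of \<open>|x|\<^sup>2\<close>. The denominator vanishes only if
\<open>N + 2d = 2\<close>; for \<open>N = 2\<close> and \<open>d = 0\<close> the function \<open>F\<close> is constant, so that the quotient 0 is the right value.\<close>

definition raise :: "'n \<Rightarrow> nat \<Rightarrow> (real ^ 'n \<Rightarrow> real) \<Rightarrow> (real ^ 'n \<Rightarrow> real)" where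
  "raise k d F = (\<lambda>x. x $ k * F x - (norm x)\<^sup>2 * partial k F x / (real CARD('n) + 2 * real d - 2))"

lemma poly_fun_raise [intro]: "poly_fun F \<Longrightarrow> poly_fun (raise k d F)"
  unfolding raise_def by (intro real_polynomial_function_diff real_polynomial_function_divide
      poly_fun_mult) auto

text \<open>\<open>\<Delta> (x_k F) = 2 \<partial>_k F\<close>, while \<open>\<Delta> (|x|\<^sup>2 \<partial>_k F) = 2 (N + 2d - 2) \<partial>_k F\<close> by Euler's identity in degree \<open>d - 1\<close>.\<close>

lemma solid_harmonic_raise:
  fixes F :: "real ^ 'n \<Rightarrow> real"
  assumes "solid_harmonic d F" shows "solid_harmonic (Suc d) (raise k d F)"
proof -
  note F = solid_harmonicD[OF assms]
  let ?D = "real CARD('n) + 2 * real d - 2"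
  have hk: "(t * norm x)\<^sup>2 * partial k F (t *\<^sub>R x) = t ^ Suc d * ((norm x)\<^sup>2 * partial k F x)" if "t > 0" for t x
    using solid_harmonic_partial_0[of F k] assms homogeneous_partial[OF F(1,2), of k] that
    by (cases d) (auto simp: power2_eq_square homogeneous_def)
  have "homogeneous (Suc d) (raise k d F)"
    using F(2) hk unfolding homogeneous_def raise_def
    by (auto simp: right_diff_distrib)
  moreover have "laplacian (raise k d F) x = 0" for x
  proof -
    have "laplacian (raise k d F) x = laplacian (\<lambda>x. x $ k * F x) x -
        laplacian (\<lambda>x. (1 / ?D) * ((norm x)\<^sup>2 * partial k F x)) x"
      unfolding raise_def using F(1)
      by (subst fun_cong[OF laplacian_diff, symmetric]) (auto intro!: poly_fun_mult)
    also have "\<dots> = 2 * partial k F x - (1 / ?D) * (4 * (\<Sum>i\<in>UNIV. x $ i * partial i (partial k F) x)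
        + 2 * real CARD('n) * partial k F x)"
      using F(1,3) by (subst laplacian_cmult)
        (auto simp: laplacian_coord_mult laplacian_norm_sq_mult laplacian_partial poly_fun_partial
           intro!: poly_fun_mult)
    also have "(\<Sum>i\<in>UNIV. x $ i * partial i (partial k F) x) = real (d - 1) * partial k F x"
      by (intro euler homogeneous_partial F poly_fun_partial)
    also have "2 * partial k F x - (1 / ?D) * (4 * (real (d - 1) * partial k F x) + 2 * real CARD('n) * partial k F x) = 0"
    proof (cases d)
      case 0
      then show ?thesis using solid_harmonic_partial_0[of F k] assms by simp
    next
      case (Suc e)
      have "?D > 0" using Suc by (simp add: add_pos_nonneg)
      then show ?thesis using Suc by (simp add: field_simps)
    qed
    finally show ?thesis .
  qed
  ultimately show ?thesis using F(1) by (auto simp: solid_harmonic_def)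
qed

text \<open>Computing the left side gives terms \<open>x_i \<partial>_k F\<close> and \<open>x_k \<partial>_i F\<close>; each is rewritten by \<open>raise\<close> in degree \<open>d - 1\<close>.
The multiples of \<open>|x|\<^sup>2 \<partial>_k \<partial>_i F\<close> then cancel since \<open>1/D = 1/(D-2) - 2/(D (D-2))\<close> for \<open>D = N + 2d - 2\<close>. For \<open>i = k\<close>
this is the relation \<open>\<partial>_k raise = 1 + (1 - 2/D) raise \<partial>_k\<close> that makes antiderivatives explicit.\<close>

lemma partial_raise:
  fixes F :: "real ^ 'n \<Rightarrow> real"
  assumes "solid_harmonic d F"
  shows "partial k (raise i d F) = (\<lambda>x. (if k = i then F x else 0) + raise i (d - 1) (partial k F) x
     - 2 / (real CARD('n) + 2 * real d - 2) * raise k (d - 1) (partial i F) x)"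
proof
  fix x
  note F = solid_harmonicD[OF assms]
  let ?D = "real CARD('n) + 2 * real d - 2"
  have 1: "partial k (raise i d F) x = (if k = i then F x else 0) + x $ i * partial k F x
     - (2 * x $ k * partial i F x + (norm x)\<^sup>2 * partial k (partial i F) x) / ?D"
    unfolding raise_def using F(1)
    by (simp add: partial_diff partial_divide partial_mult partial_coord partial_norm_sq poly_fun_coord
        poly_fun_partial poly_fun_norm_sq poly_fun_mult real_polynomial_function_divide add_ac)
  show "partial k (raise i d F) x = (if k = i then F x else 0) + raise i (d - 1) (partial k F) x
     - 2 / ?D * raise k (d - 1) (partial i F) x"
  proof (cases d)
    case 0
    then have "partial j F = (\<lambda>x. 0)" for j using solid_harmonic_partial_0 assms by blast
    then show ?thesis unfolding 1 by (simp add: raise_def)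
  next
    case (Suc e)
    have 2: "partial i (partial k F) = partial k (partial i F)"
      using F(1) by (rule partial_commute)
    have Dpos: "?D > 0" using Suc by (simp add: add_pos_nonneg)
    show ?thesis
    \<comment> \<open>\<open>D = 2\<close> with \<open>d \<ge> 1\<close> means \<open>N = 2\<close>, \<open>d = 1\<close>; the second derivatives vanish there\<close>
    proof (cases "?D = 2")
      case True
      then have e: "e = 0" using Suc zero_less_card_finite[where 'a = 'n] by (auto simp del: zero_less_card_finite)
      have "partial k (partial i F) = (\<lambda>x. 0)"
        using solid_harmonic_partial[OF assms, of i] e Suc by (auto intro: solid_harmonic_partial_0)
      then show ?thesis unfolding 1 using 2 by (simp add: raise_def)
    next
      case False
      have D': "real CARD('n) + 2 * real (d - 1) - 2 = ?D - 2" using Suc by simp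
      have alg: "f + a * p - (2 * b * q + c * m) / D = f + (a * p - c * m / (D - 2)) - 2 / D * (b * q - c * m / (D - 2))"
        if "D > 0" "D \<noteq> 2" for f a b c p q m D :: real
      proof -
        have "c * m / D = c * m / (D - 2) - 2 / D * (c * m / (D - 2))"
          using that by (simp add: divide_simps) (simp add: algebra_simps)
        then show ?thesis by (simp add: algebra_simps add_divide_distrib)
      qed
      show ?thesis unfolding 1 unfolding raise_def D' 2 using Dpos False by (rule alg)
    qed
  qed
qed

section \<open>Rotations in coordinate planes\<close>

definition rot :: "'n \<Rightarrow> 'n \<Rightarrow> real \<Rightarrow> real ^ 'n \<Rightarrow> real ^ 'n" where
  "rot i j \<theta> x = (\<chi> m. if m = i then cos \<theta> * x $ i - sin \<theta> * x $ j
      else if m = j then sin \<theta> * x $ i + cos \<theta> * x $ j else x $ m)"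

lemma rot_0 [simp]: "rot i j 0 x = x"
  by (simp add: rot_def vec_eq_iff)

lemma sum_pair:
  fixes f :: "'n::finite \<Rightarrow> 'b::comm_monoid_add"
  assumes "i \<noteq> j" shows "sum f UNIV = f i + (f j + sum f (UNIV - {i, j}))"
  using assms by (simp add: sum.remove[of UNIV i] sum.remove[of "UNIV - {i}" j] Diff_insert[symmetric] insert_commute)

lemma orthogonal_rot:
  assumes "i \<noteq> j" shows "orthogonal_transformation (rot i j \<theta>)"
  unfolding orthogonal_transformation
proof
  show "linear (rot i j \<theta>)"
    by (rule linearI) (auto simp: rot_def vec_eq_iff algebra_simps)
  have alg: "(c * a - s * b)\<^sup>2 + ((s * a + c * b)\<^sup>2 + u) = (s\<^sup>2 + c\<^sup>2) * a\<^sup>2 + ((s\<^sup>2 + c\<^sup>2) * b\<^sup>2 + u)"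
    for a b c s u :: real by (simp add: power2_eq_square algebra_simps)
  have "(norm (rot i j \<theta> v))\<^sup>2 = (norm v)\<^sup>2" for v
  proof -
    have "(norm (rot i j \<theta> v))\<^sup>2 = (cos \<theta> * v $ i - sin \<theta> * v $ j)\<^sup>2 + ((sin \<theta> * v $ i + cos \<theta> * v $ j)\<^sup>2 +
       (\<Sum>m\<in>UNIV - {i, j}. v $ m * v $ m))"
      using assms unfolding norm_sq_eq_sum sum_pair[OF assms]
      by (simp add: rot_def power2_eq_square) 
    also have "\<dots> = ((sin \<theta>)\<^sup>2 + (cos \<theta>)\<^sup>2) * (v $ i)\<^sup>2 + (((sin \<theta>)\<^sup>2 + (cos \<theta>)\<^sup>2) * (v $ j)\<^sup>2 +
       (\<Sum>m\<in>UNIV - {i, j}. v $ m * v $ m))"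
      by (rule alg)
    finally show ?thesis
      unfolding norm_sq_eq_sum sum_pair[OF assms] sin_cos_squared_add by (simp add: power2_eq_square)
  qed
  then show "\<forall>v. norm (rot i j \<theta> v) = norm v" by simp
qed

lemma orthogonal_imp_continuous:
  fixes R :: "real ^ 'n \<Rightarrow> real ^ 'n"
  assumes "orthogonal_transformation R" shows "continuous_on UNIV R"
  using assms by (intro linear_continuous_on)
    (simp add: orthogonal_transformation_linear linear_conv_bounded_linear[symmetric])

text \<open>Lebesgue measure on \<open>real ^ 'n\<close> is invariant under rotations of coordinate planes because it is invariant under
shears and such a rotation is a product of three shears.\<close>

definition shear :: "'n \<Rightarrow> 'n \<Rightarrow> real \<Rightarrow> real ^ 'n \<Rightarrow> real ^ 'n" where
  "shear m n t x = (\<chi> i. if i = m then x $ m + t * x $ n else x $ i)"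

lemma linear_shear: "linear (shear m n t)"
  by (rule linearI) (auto simp: shear_def vec_eq_iff algebra_simps)

text \<open>For boxes this is \<open>measure_shear_interval\<close> after a translation that makes the \<open>n\<close>-th lower bound vanish.\<close>

lemma measure_shear_1:
  fixes S :: "(real ^ 'n) set"
  assumes mn: "m \<noteq> n" and S: "S \<in> lmeasurable"
  shows "shear m n 1 ` S \<in> lmeasurable" "measure lebesgue (shear m n 1 ` S) = measure lebesgue S"
proof -
  have "measure lebesgue (shear m n 1 ` cbox a b) = 1 * measure lebesgue (cbox a b)" for a b :: "real ^ 'n"
  proof (cases "cbox a b = {}")
    case False
    define w :: "real ^ 'n" where "w = axis n (a $ n)"
    have tr: "cbox a b = (+) w ` cbox (a - w) (b - w)"
      by (simp add: cbox_translation[symmetric])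
    have "shear m n 1 ` cbox a b = (+) (shear m n 1 w) ` (shear m n 1 ` cbox (a - w) (b - w))"
      unfolding tr image_image by (simp add: linear_add[OF linear_shear])
    then have "measure lebesgue (shear m n 1 ` cbox a b) = measure lebesgue (shear m n 1 ` cbox (a - w) (b - w))"
      by (simp only: measure_translation)
    also have "\<dots> = measure lebesgue ((\<lambda>x. \<chi> i. if i = m then x$m + x$n else x$i) ` cbox (a - w) (b - w))"
      unfolding shear_def by (simp only: mult_1_left)
    also have "\<dots> = measure lebesgue (cbox (a - w) (b - w))"
    proof (rule measure_shear_interval[OF mn])
      show "cbox (a - w) (b - w) \<noteq> {}" using False unfolding tr by auto
    qed (simp add: w_def)
    also have "\<dots> = measure lebesgue (cbox a b)" unfolding tr by (simp only: measure_translation)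
    finally show ?thesis by (simp only: mult_1_left)
  qed simp
  then show "shear m n 1 ` S \<in> lmeasurable" "measure lebesgue (shear m n 1 ` S) = measure lebesgue S"
    using measure_linear_sufficient[OF linear_shear S, of m n 1 1] by simp_all
qed

lemma measure_shear:
  fixes S :: "(real ^ 'n) set"
  assumes mn: "m \<noteq> n" and S: "S \<in> lmeasurable"
  shows "shear m n t ` S \<in> lmeasurable" "measure lebesgue (shear m n t ` S) = measure lebesgue S"
proof -
  have "shear m n t ` S \<in> lmeasurable \<and> measure lebesgue (shear m n t ` S) = measure lebesgue S"
  proof (cases "t = 0")
    case True
    then have "shear m n t = (\<lambda>x. x)" by (auto simp: shear_def vec_eq_iff)
    then show ?thesis using S by simp
  next
    case False
    \<comment> \<open>conjugate the unit shear with a stretch of the \<open>n\<close>-th coordinate\<close>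
    define st where "st c = (\<lambda>x :: real ^ 'n. \<chi> k. (if k = n then c else 1) * x $ k)" for c :: real
    have prodst: "prod (\<lambda>k. if k = n then c else 1) UNIV = c" for c :: real
      by (simp add: prod.delta)
    have m1: "st c ` S' \<in> lmeasurable" "measure lebesgue (st c ` S') = \<bar>c\<bar> * measure lebesgue S'"
      if "S' \<in> lmeasurable" for S' c
      unfolding st_def using measurable_stretch[OF that] measure_stretch[OF that] prodst by simp_all
    have "shear m n t x = st (1 / t) (shear m n 1 (st t x))" for x
      using mn False by (auto simp: shear_def st_def vec_eq_iff)
    then have "shear m n t ` S = st (1 / t) ` (shear m n 1 ` (st t ` S))"
      by (simp add: image_image)
    then show ?thesis
      using m1 measure_shear_1[OF mn] S False by (simp add: abs_mult[symmetric])
  qed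
  then show "shear m n t ` S \<in> lmeasurable" "measure lebesgue (shear m n t ` S) = measure lebesgue S"
    by auto
qed

text \<open>The coefficient \<open>- sin \<theta> / (1 + cos \<theta>)\<close> is \<open>- tan (\<theta>/2)\<close>; a positive cosine keeps its denominator away
from 0 and still covers all small angles.\<close>

lemma rot_eq_shears:
  assumes "i \<noteq> j" "cos \<theta> > 0"
  shows "rot i j \<theta> x = shear i j (- sin \<theta> / (1 + cos \<theta>)) (shear j i (sin \<theta>) (shear i j (- sin \<theta> / (1 + cos \<theta>)) x))"
proof -
  define \<tau> where "\<tau> = sin \<theta> / (1 + cos \<theta>)"
  have 1: "\<tau> * (1 + cos \<theta>) = sin \<theta>" using assms by (simp add: \<tau>_def)
  have "(sin \<theta>)\<^sup>2 = (1 - cos \<theta>) * (1 + cos \<theta>)" by (simp add: sin_squared_eq power2_eq_square algebra_simps)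
  then have 2: "\<tau> * sin \<theta> = 1 - cos \<theta>" using assms by (simp add: \<tau>_def power2_eq_square)
  have 3: "\<tau> + \<tau> * cos \<theta> = sin \<theta>" using 1 by (simp add: algebra_simps)
  have "\<tau> * (\<tau> * sin \<theta>) = \<tau> - \<tau> * cos \<theta>" unfolding 2 by (simp add: algebra_simps)
  with 3 have 4: "2 * \<tau> - \<tau> * (\<tau> * sin \<theta>) = sin \<theta>" by simp
  have "shear i j (- \<tau>) (shear j i (sin \<theta>) (shear i j (- \<tau>) x)) $ m = rot i j \<theta> x $ m" for m
  proof -
    have A: "shear i j (- \<tau>) x $ i = x $ i - \<tau> * x $ j" "shear i j (- \<tau>) x $ j = x $ j"
      using assms by (auto simp: shear_def)
    have j: "x $ j + sin \<theta> * (x $ i - \<tau> * x $ j) = sin \<theta> * x $ i + cos \<theta> * x $ j"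
      using arg_cong[OF 2, of "\<lambda>u. u * x $ j"] by (simp add: algebra_simps)
    have i: "x $ i - \<tau> * x $ j - \<tau> * (sin \<theta> * x $ i + cos \<theta> * x $ j) = cos \<theta> * x $ i - sin \<theta> * x $ j"
      using arg_cong[OF 2, of "\<lambda>u. u * x $ i"] arg_cong[OF 3, of "\<lambda>u. u * x $ j"] by (simp add: algebra_simps)
    show ?thesis
      using assms i j by (auto simp: shear_def rot_def)
  qed
  then show ?thesis by (simp add: vec_eq_iff \<tau>_def)
qed

lemma rot_inverse:
  assumes "i \<noteq> j" shows "rot i j (- \<theta>) (rot i j \<theta> x) = x"
proof -
  have "cos \<theta> * (cos \<theta> * u) + sin \<theta> * (sin \<theta> * u) = u" for u
    using arg_cong[OF sin_cos_squared_add2[of \<theta>], of "\<lambda>v. v * u"]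
    by (simp only: power2_eq_square distrib_right mult.assoc mult_1_left)
  moreover from this have "sin \<theta> * (sin \<theta> * u) + cos \<theta> * (cos \<theta> * u) = u" for u by (simp add: add.commute)
  ultimately show ?thesis using assms
    by (simp add: rot_def vec_eq_iff right_diff_distrib distrib_left mult.left_commute[of "sin \<theta>" "cos \<theta>"])
qed

section \<open>Invariant measures on the unit sphere\<close>

text \<open>The properties of the normalised surface measures, transported to the unit sphere, that the estimates of
mean squares use. Rotations by acute angles are enough to differentiate at the angle 0.\<close>

definition sphere_invariant :: "(real ^ 'n) measure \<Rightarrow> bool" where
  "sphere_invariant \<sigma> \<longleftrightarrow> finite_measure \<sigma> \<and> sets \<sigma> = sets borel \<and> (AE x in \<sigma>. norm x = 1) \<and>
     (\<forall>i j \<theta>. i \<noteq> j \<longrightarrow> cos \<theta> > 0 \<longrightarrow> distr \<sigma> borel (rot i j \<theta>) = \<sigma>)"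

lemma sphere_invariantD:
  assumes "sphere_invariant \<sigma>"
  shows "finite_measure \<sigma>" "sets \<sigma> = sets borel" "AE x in \<sigma>. norm x = 1"
    "i \<noteq> j \<Longrightarrow> cos \<theta> > 0 \<Longrightarrow> distr \<sigma> borel (rot i j \<theta>) = \<sigma>"
  using assms by (auto simp: sphere_invariant_def)

lemma continuous_measurable_sphere:
  assumes "sphere_invariant \<sigma>" "continuous_on UNIV f"
  shows "f \<in> borel_measurable \<sigma>"
  using borel_measurable_continuous_onI[OF assms(2)] sphere_invariantD(2)[OF assms(1)]
  by (simp cong: measurable_cong_sets)

lemma integrable_sphere:
  fixes f :: "real ^ 'n \<Rightarrow> real"
  assumes "sphere_invariant \<sigma>" "continuous_on UNIV f"
  shows "integrable \<sigma> f"
proof -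
  interpret finite_measure \<sigma> using sphere_invariantD assms by blast
  have "compact (f ` sphere 0 1)"
    by (intro compact_continuous_image continuous_on_subset[OF assms(2)]) auto
  then obtain B where B: "\<And>x. norm x = 1 \<Longrightarrow> norm (f x) \<le> B"
    unfolding compact_eq_bounded_closed bounded_iff by (metis imageI mem_sphere_0)
  show ?thesis
    by (rule integrable_const_bound[of _ B])
       (use sphere_invariantD(3)[OF assms(1)] B continuous_measurable_sphere assms in auto)
qed

lemma emeasure_lborel_rot_vimage:
  fixes B :: "(real ^ 'n) set"
  assumes ij: "i \<noteq> j" and \<theta>: "cos \<theta> > 0" and B: "B \<in> sets borel" "bounded B"
  shows "emeasure lborel (rot i j \<theta> -` B) = emeasure lborel B"
proof -
  have lm: "B \<in> lmeasurable" using B by (simp add: bounded_set_imp_lmeasurable)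
  have inv: "rot i j \<theta> (rot i j (- \<theta>) x) = x" for x using rot_inverse[OF ij, of "- \<theta>"] by simp
  have vim: "rot i j \<theta> -` B = rot i j (- \<theta>) ` B"
    by (auto simp: image_iff inv) (metis rot_inverse[OF ij])
  let ?s = "- sin (- \<theta>) / (1 + cos (- \<theta>))"
  have "rot i j (- \<theta>) ` B = shear i j ?s ` (shear j i (sin (- \<theta>)) ` (shear i j ?s ` B))"
    using rot_eq_shears[OF ij, of "- \<theta>"] \<theta> by (simp add: image_image)
  then have r: "rot i j (- \<theta>) ` B \<in> lmeasurable" "measure lebesgue (rot i j (- \<theta>) ` B) = measure lebesgue B"
    using measure_shear[OF ij] measure_shear[OF ij[symmetric]] lm by simp_all
  then have "emeasure lebesgue (rot i j (- \<theta>) ` B) = emeasure lebesgue B"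
    using lm by (simp add: emeasure_eq_measure2 fmeasurableD2)
  moreover have "rot i j \<theta> -` B \<in> sets borel"
    using measurable_sets_borel[OF borel_measurable_continuous_onI[OF orthogonal_imp_continuous[OF orthogonal_rot[OF ij]]] B(1)] .
  ultimately show ?thesis using B(1) by (simp add: vim)
qed

lemma orthogonal_sgn:
  assumes "orthogonal_transformation R" shows "sgn (R x) = R (sgn x)"
  using assms by (simp add: sgn_div_norm orthogonal_transformation_norm orthogonal_transformation_linear linear_scale)

text \<open>The cone description of the surface measure for arbitrary Borel sets, in the form that commutes with rotations.\<close>

lemma emeasure_surface_measure_vimage:
  fixes A :: "(real ^ 'n) set"
  assumes "A \<in> sets borel"
  shows "emeasure (surface_measure r) A =
    ennreal (real CARD('n) / r) * emeasure lborel {x \<in> cball 0 r. r *\<^sub>R sgn x \<in> A}"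
proof -
  let ?f = "\<lambda>x::real ^ 'n. r *\<^sub>R sgn x"
  have f: "?f \<in> borel_measurable lborel" by (simp add: sgn_div_norm)
  have "emeasure (distr (restrict_space lborel (cball 0 r)) borel ?f) A =
      emeasure (restrict_space lborel (cball 0 r)) (?f -` A \<inter> cball 0 r)"
    using assms f by (subst emeasure_distr) (auto intro!: measurable_restrict_space1 simp: space_restrict_space)
  also have "\<dots> = emeasure lborel (?f -` A \<inter> cball 0 r)"
    by (rule emeasure_restrict_space) auto
  also have "?f -` A \<inter> cball 0 r = {x \<in> cball 0 r. r *\<^sub>R sgn x \<in> A}" by auto
  finally show ?thesis by (simp add: surface_measure_def)
qed

lemma emeasure_surface_measure_rot:
  fixes A :: "(real ^ 'n) set"
  assumes ij: "i \<noteq> j" and \<theta>: "cos \<theta> > 0" and A: "A \<in> sets borel"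
  shows "emeasure (surface_measure r) (rot i j \<theta> -` A) = emeasure (surface_measure r) A"
proof -
  let ?B = "{x \<in> cball 0 r. r *\<^sub>R sgn x \<in> A}" and ?R = "rot i j \<theta>"
  note R = orthogonal_rot[OF ij, of \<theta>]
  have f: "(\<lambda>x::real ^ 'n. r *\<^sub>R sgn x) \<in> borel_measurable borel" by (simp add: sgn_div_norm)
  have "?B = (\<lambda>x. r *\<^sub>R sgn x) -` A \<inter> cball 0 r" by auto
  also have "\<dots> \<in> sets borel" by (intro sets.Int measurable_sets_borel[OF f A]) auto
  finally have B: "?B \<in> sets borel" .
  have Rm: "?R \<in> borel_measurable borel"
    using R by (intro borel_measurable_continuous_onI orthogonal_imp_continuous)
  have "emeasure lborel {x \<in> cball 0 r. r *\<^sub>R sgn x \<in> ?R -` A} = emeasure lborel (?R -` ?B)"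
    using R by (intro arg_cong[where f = "emeasure lborel"])
      (auto simp: orthogonal_transformation_norm orthogonal_sgn orthogonal_transformation_linear linear_scale)
  also have "\<dots> = emeasure lborel ?B"
    by (rule emeasure_lborel_rot_vimage[OF ij \<theta> B], rule bounded_subset[OF bounded_cball, of _ 0 r]) auto
  finally show ?thesis
    using A measurable_sets_borel[OF Rm A] by (simp only: emeasure_surface_measure_vimage)
qed

text \<open>Scaling by \<open>1/r\<close> turns the mean squares at every radius into integrals over the unit sphere, where
homogeneity can be used.\<close>

lemma ex_sphere_invariant:
  assumes "r > 0"
  shows "\<exists>\<sigma> :: (real ^ 'n) measure. sphere_invariant \<sigma> \<and> measure \<sigma> UNIV = 1 \<and>
    (\<forall>h. continuous_on UNIV h \<longrightarrow> M2 h r = sqrt (\<integral>x. (h (r *\<^sub>R x))\<^sup>2 \<partial>\<sigma>))"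
proof -
  let ?\<nu> = "normalised_surface_measure r :: (real ^ 'n) measure"
  let ?d = "\<lambda>x::real ^ 'n. (1 / r) *\<^sub>R x"
  define \<sigma> where "\<sigma> = distr ?\<nu> borel ?d"
  have sets_s: "sets (surface_measure r :: (real ^ 'n) measure) = sets borel"
    by (simp add: surface_measure_def)
  have sets_n: "sets ?\<nu> = sets borel"
    by (simp add: normalised_surface_measure_def sets_s)
  have dm: "?d \<in> measurable ?\<nu> borel"
    by (simp add: measurable_cong_sets[OF sets_n refl])
  have AEn: "AE x in ?\<nu>. x \<in> sphere 0 r"
    unfolding normalised_surface_measure_def
    by (rule AE_uniform_measureI) (auto simp: sets_s)
  have one: "emeasure ?\<nu> UNIV = 1"
  proof -
    have "emeasure ?\<nu> UNIV = emeasure ?\<nu> (sphere 0 r)"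
      by (rule emeasure_eq_AE) (use AEn in \<open>auto simp: sets_n\<close>)
    then show ?thesis using normalised_surface_measure_sphere[OF assms] by metis
  qed
  have sp: "space ?\<nu> = UNIV" using sets_eq_imp_space_eq[OF sets_n] by simp
  have fin: "finite_measure ?\<nu>" by (rule finite_measureI) (simp add: sp one)
  have "sphere_invariant \<sigma>"
    unfolding sphere_invariant_def
  proof (intro conjI allI impI)
    show "finite_measure \<sigma>" unfolding \<sigma>_def by (rule finite_measure.finite_measure_distr[OF fin dm])
    show "sets \<sigma> = sets borel" by (simp add: \<sigma>_def)
    show "AE x in \<sigma>. norm x = 1"
      unfolding \<sigma>_def using dm by (subst AE_distr_iff) (use AEn assms in auto)
    fix i j :: 'n and \<theta> :: real assume ij: "i \<noteq> j" and \<theta>: "cos \<theta> > 0"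
    let ?R = "rot i j \<theta> :: real ^ 'n \<Rightarrow> _"
    note R = orthogonal_rot[OF ij, of \<theta>]
    have Rm: "?R \<in> borel_measurable borel"
      using R by (intro borel_measurable_continuous_onI orthogonal_imp_continuous)
    have Rn: "?R \<in> measurable ?\<nu> borel" using Rm by (simp add: measurable_cong_sets[OF sets_n refl])
    have inv: "distr ?\<nu> borel ?R = ?\<nu>"
    proof (rule measure_eqI)
      fix A assume "A \<in> sets (distr ?\<nu> borel ?R)"
      then have A: "A \<in> sets borel" by simp
      have "sphere 0 r \<inter> ?R -` A = ?R -` (sphere 0 r \<inter> A)"
        using R by (auto simp: orthogonal_transformation_norm)
      then have e: "emeasure (surface_measure r) (sphere 0 r \<inter> ?R -` A) = emeasure (surface_measure r) (sphere 0 r \<inter> A)"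
        using emeasure_surface_measure_rot[OF ij \<theta>, of "sphere 0 r \<inter> A" r] A by simp
      show "emeasure (distr ?\<nu> borel ?R) A = emeasure ?\<nu> A"
        using A Rn measurable_sets_borel[OF Rm A] e
        by (subst emeasure_distr) (simp_all add: sp normalised_surface_measure_def sets_s del: vimage_Int)
    qed (simp add: sets_n)
    have "distr \<sigma> borel ?R = distr ?\<nu> borel (?R \<circ> ?d)"
      unfolding \<sigma>_def using dm Rm by (subst distr_distr) auto
    also have "?R \<circ> ?d = ?d \<circ> ?R" using R by (auto simp: o_def orthogonal_transformation_linear linear_scale)
    also have "distr ?\<nu> borel (?d \<circ> ?R) = distr (distr ?\<nu> borel ?R) borel ?d"
      using Rn by (subst distr_distr) auto
    also have "\<dots> = \<sigma>" by (simp only: inv \<sigma>_def)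
    finally show "distr \<sigma> borel ?R = \<sigma>" .
  qed
  moreover have "measure \<sigma> UNIV = 1"
    unfolding \<sigma>_def using dm one by (subst measure_distr) (auto simp: sp measure_def)
  moreover have "M2 h r = sqrt (\<integral>x. (h (r *\<^sub>R x))\<^sup>2 \<partial>\<sigma>)" if "continuous_on UNIV h" for h
  proof -
    have hm: "h \<in> borel_measurable borel" using that by (rule borel_measurable_continuous_onI)
    then have hn: "h \<in> borel_measurable ?\<nu>" by (simp add: measurable_cong_sets[OF sets_n refl])
    have "(\<integral>x. (h (r *\<^sub>R x))\<^sup>2 \<partial>\<sigma>) = (\<integral>x. (h (r *\<^sub>R ?d x))\<^sup>2 \<partial>?\<nu>)"
      unfolding \<sigma>_def using dm hm by (subst integral_distr) auto
    also have "\<dots> = (\<integral>x. (h x)\<^sup>2 \<partial>?\<nu>)" using assms by simp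
    also have "\<dots> = (LINT x:sphere 0 r|?\<nu>. \<bar>h x\<bar>\<^sup>2)"
      unfolding set_lebesgue_integral_def
    proof (rule integral_cong_AE)
      show "(\<lambda>x. (h x)\<^sup>2) \<in> borel_measurable ?\<nu>" using hn by measurable
      show "(\<lambda>x. indicat_real (sphere 0 r) x *\<^sub>R \<bar>h x\<bar>\<^sup>2) \<in> borel_measurable ?\<nu>"
        using hn by (intro borel_measurable_scaleR borel_measurable_indicator) (auto simp: sets_n)
      show "AE x in ?\<nu>. (h x)\<^sup>2 = indicat_real (sphere 0 r) x *\<^sub>R \<bar>h x\<bar>\<^sup>2"
        using AEn by eventually_elim auto
    qed
    finally show ?thesis by (simp add: M2_def)
  qed
  ultimately show ?thesis by (intro exI[of _ \<sigma>] conjI allI impI)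
qed

text \<open>The derivative of \<open>F\<close> along the rotation flow in the plane of the coordinates \<open>i\<close> and \<open>j\<close>.\<close>

definition angular :: "'n \<Rightarrow> 'n \<Rightarrow> (real ^ 'n \<Rightarrow> real) \<Rightarrow> real ^ 'n \<Rightarrow> real" where
  "angular i j F x = x $ i * partial j F x - x $ j * partial i F x"

lemma poly_fun_angular [intro]: "poly_fun F \<Longrightarrow> poly_fun (angular i j F)"
  unfolding angular_def by (intro real_polynomial_function_diff poly_fun_mult) auto

lemma rot_deriv:
  assumes F: "poly_fun F" and ij: "i \<noteq> j"
  shows "((\<lambda>\<theta>. F (rot i j \<theta> x)) has_real_derivative angular i j F (rot i j \<theta> x)) (at \<theta>)"
proof -
  let ?v = "\<lambda>m. if m = i then - (rot i j \<theta> x $ j) else if m = j then rot i j \<theta> x $ i else 0"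
  have "((\<lambda>\<theta>. rot i j \<theta> x $ m) has_real_derivative ?v m) (at \<theta>)" for m
    using ij by (cases "m = i"; cases "m = j") (auto simp: rot_def intro!: derivative_eq_intros)
  then have "((\<lambda>\<theta>. rot i j \<theta> x) has_vector_derivative (\<chi> m. ?v m)) (at \<theta>)"
  proof -
    assume *: "\<And>m. ((\<lambda>\<theta>. rot i j \<theta> x $ m) has_real_derivative ?v m) (at \<theta>)"
    have "((\<lambda>\<theta>. rot i j \<theta> x \<bullet> b) has_derivative (\<lambda>t. (t *\<^sub>R (\<chi> m. ?v m)) \<bullet> b)) (at \<theta>)" if Bas: "b \<in> Basis" for b
    proof -
      obtain m where b: "b = axis m 1" using Bas unfolding Basis_vec_def by auto
      have "(\<lambda>t. (t *\<^sub>R (\<chi> m. ?v m)) \<bullet> b) = (*) (?v m)"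
        by (auto simp: b inner_axis mult.commute)
      then show ?thesis using *[of m] by (simp add: b inner_axis has_field_derivative_def)
    qed
    then show ?thesis
      unfolding has_vector_derivative_def by (subst has_derivative_componentwise_within) blast
  qed
  then have "((\<lambda>\<theta>. F (rot i j \<theta> x)) has_derivative
     (\<lambda>t. \<Sum>m\<in>UNIV. (t *\<^sub>R (\<chi> m. ?v m)) $ m * partial m F (rot i j \<theta> x))) (at \<theta>)"
    unfolding has_vector_derivative_def
    by (rule has_derivative_compose[OF _ poly_fun_has_derivative[OF F]])
  moreover have "(\<Sum>m\<in>UNIV. (t *\<^sub>R (\<chi> m. ?v m)) $ m * partial m F (rot i j \<theta> x)) = angular i j F (rot i j \<theta> x) * t" for t
    using ij unfolding sum_pair[OF ij] by (simp add: angular_def algebra_simps)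
  ultimately show ?thesis by (simp add: has_field_derivative_def)
qed

text \<open>The integral of \<open>F \<circ> rot i j \<theta>\<close> does not depend on \<open>\<theta>\<close>; differentiate it at \<open>\<theta> = 0\<close>. The mean value theorem along the
rotation bounds the difference quotients, so that dominated convergence applies.\<close>

lemma integral_angular_0:
  assumes \<sigma>: "sphere_invariant \<sigma>" and F: "poly_fun F" and ij: "i \<noteq> j"
  shows "(\<integral>x. angular i j F x \<partial>\<sigma>) = 0"
proof -
  interpret finite_measure \<sigma> using sphere_invariantD \<sigma> by blast
  have cont: "continuous_on UNIV F" "continuous_on UNIV (angular i j F)" using F by auto
  have lin: "continuous_on UNIV (rot i j \<theta>)" for \<theta>
    using orthogonal_rot[OF ij, of \<theta>] by (rule orthogonal_imp_continuous)
  have comp: "continuous_on UNIV (\<lambda>x. F (rot i j \<theta> x))" for \<theta>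
    by (rule continuous_on_compose2[OF cont(1) lin]) auto
  have eq: "(\<integral>x. F (rot i j \<theta> x) \<partial>\<sigma>) = (\<integral>x. F x \<partial>\<sigma>)" if "cos \<theta> > 0" for \<theta>
  proof -
    have "rot i j \<theta> \<in> measurable \<sigma> borel"
      using borel_measurable_continuous_onI[OF lin, of \<theta>] sphere_invariantD(2)[OF \<sigma>]
      by (simp cong: measurable_cong_sets)
    then have "(\<integral>x. F x \<partial>(distr \<sigma> borel (rot i j \<theta>))) = (\<integral>x. F (rot i j \<theta> x) \<partial>\<sigma>)"
      using borel_measurable_continuous_onI[OF cont(1)] by (rule integral_distr)
    then show ?thesis using sphere_invariantD(4)[OF \<sigma> ij that] by simp
  qed
  have "compact (angular i j F ` sphere 0 1)"
    by (intro compact_continuous_image continuous_on_subset[OF cont(2)]) auto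
  then obtain B where B: "\<And>x. norm x = 1 \<Longrightarrow> norm (angular i j F x) \<le> B"
    unfolding compact_eq_bounded_closed bounded_iff by (metis imageI mem_sphere_0)
  define q where "q n x = (F (rot i j (1 / real (Suc n)) x) - F x) * real (Suc n)" for n x
  have "(\<lambda>n. \<integral>x. q n x \<partial>\<sigma>) \<longlonglongrightarrow> (\<integral>x. angular i j F x \<partial>\<sigma>)"
  proof (rule integral_dominated_convergence[where w = "\<lambda>_. B"])
    show "angular i j F \<in> borel_measurable \<sigma>" using continuous_measurable_sphere \<sigma> cont by blast
    show "q n \<in> borel_measurable \<sigma>" for n
      unfolding q_def by (intro continuous_measurable_sphere \<sigma> continuous_intros comp cont)
    show "integrable \<sigma> (\<lambda>_. B)" by simp
    have "(\<lambda>n. q n x) \<longlonglongrightarrow> angular i j F x" for x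
    proof -
      have "((\<lambda>h. (F (rot i j (0 + h) x) - F (rot i j 0 x)) / h) \<longlongrightarrow> angular i j F (rot i j 0 x)) (at 0)"
        using rot_deriv[OF F ij, of x 0] unfolding DERIV_def .
      then have "((\<lambda>h. (F (rot i j h x) - F x) / h) \<longlongrightarrow> angular i j F x) (at 0)" by simp
      moreover have "filterlim (\<lambda>n. 1 / real (Suc n)) (at 0) sequentially"
        unfolding filterlim_at using LIMSEQ_inverse_real_of_nat by (simp add: inverse_eq_divide)
      ultimately have "(\<lambda>n. (F (rot i j (1 / real (Suc n)) x) - F x) / (1 / real (Suc n))) \<longlonglongrightarrow> angular i j F x"
        by (rule filterlim_compose)
      then show ?thesis by (simp add: q_def)
    qed
    then show "AE x in \<sigma>. (\<lambda>n. q n x) \<longlonglongrightarrow> angular i j F x" by simp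
    have qb: "norm (q n x) \<le> B" if x: "norm x = 1" for n x
    proof -
      let ?h = "1 / real (Suc n)"
      have "\<exists>z>0. z < ?h \<and> F (rot i j ?h x) - F (rot i j 0 x) = (?h - 0) * angular i j F (rot i j z x)"
        by (rule MVT2) (use rot_deriv[OF F ij] in auto)
      then obtain z where "F (rot i j ?h x) - F x = ?h * angular i j F (rot i j z x)" by auto
      then have "q n x = angular i j F (rot i j z x)" by (simp add: q_def)
      then show ?thesis using B[of "rot i j z x"] x orthogonal_rot[OF ij, of z]
        by (simp add: orthogonal_transformation_norm)
    qed
    show "AE x in \<sigma>. norm (q n x) \<le> B" for n
      using sphere_invariantD(3)[OF \<sigma>] by eventually_elim (rule qb)
  qed
  moreover have "(\<integral>x. q n x \<partial>\<sigma>) = 0" for n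
  proof -
    have "1 / real (Suc n) \<le> 1" by simp
    then have "1 / real (Suc n) < pi / 2" using pi_gt3 by linarith
    moreover have "0 < 1 / real (Suc n)" by simp
    ultimately have "cos (1 / real (Suc n)) > 0" by (intro cos_gt_zero)
    then show ?thesis
      unfolding q_def using integrable_sphere[OF \<sigma> comp] integrable_sphere[OF \<sigma> cont(1)] eq by simp
  qed
  ultimately show ?thesis using LIMSEQ_unique[OF _ tendsto_const] by fastforce
qed

text \<open>The divergence theorem on the unit ball for homogeneous polynomials. It follows from \<open>integral_angular_0\<close> for \<open>x_j F\<close>,
summed over \<open>j\<close>: by Euler's identity \<open>\<Sum>j. (x_i \<partial>_j - x_j \<partial>_i) (x_j F) = (N + d - 1) x_i F - |x|\<^sup>2 \<partial>_i F\<close>, and \<open>|x| = 1\<close>.\<close>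

lemma integral_partial:
  fixes F :: "real ^ 'n \<Rightarrow> real"
  assumes \<sigma>: "sphere_invariant \<sigma>" and F: "poly_fun F" and hom: "homogeneous d F"
  shows "(\<integral>x. partial i F x \<partial>\<sigma>) = (real CARD('n) + real d - 1) * (\<integral>x. x $ i * F x \<partial>\<sigma>)"
proof -
  have Fp: "poly_fun (\<lambda>x. x $ j * F x)" for j using F by (auto intro: poly_fun_mult)
  have i1: "integrable \<sigma> G" if "poly_fun G" for G using integrable_sphere[OF \<sigma>] that by blast
  have a: "angular i j (\<lambda>x. x $ j * F x) x = (if i = j then 0 else x $ i * F x + x $ i * (x $ j * partial j F x) - (x $ j)\<^sup>2 * partial i F x)" for j x
    using F by (auto simp: angular_def partial_mult poly_fun_coord partial_coord power2_eq_square algebra_simps)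
  have "(\<Sum>j\<in>UNIV. angular i j (\<lambda>x. x $ j * F x) x) = (real CARD('n) + real d - 1) * (x $ i * F x) - (norm x)\<^sup>2 * partial i F x" for x
  proof -
    have "(\<Sum>j\<in>UNIV. angular i j (\<lambda>x. x $ j * F x) x) =
       (\<Sum>j\<in>UNIV. x $ i * F x + x $ i * (x $ j * partial j F x) - (x $ j)\<^sup>2 * partial i F x - (if i = j then x $ i * F x else 0))"
      unfolding a by (intro sum.cong) (auto simp: power2_eq_square)
    also have "\<dots> = real CARD('n) * (x $ i * F x) + x $ i * (\<Sum>j\<in>UNIV. x $ j * partial j F x) - (norm x)\<^sup>2 * partial i F x - x $ i * F x"
      by (simp add: sum.distrib sum_subtractf norm_sq_eq_sum power2_eq_square[of "_ $ _"] sum_distrib_left sum_distrib_right)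
    finally show ?thesis unfolding euler[OF F hom] by (simp add: algebra_simps)
  qed
  then have "(\<integral>x. (real CARD('n) + real d - 1) * (x $ i * F x) - (norm x)\<^sup>2 * partial i F x \<partial>\<sigma>) =
      (\<Sum>j\<in>UNIV. \<integral>x. angular i j (\<lambda>x. x $ j * F x) x \<partial>\<sigma>)"
    by (subst Bochner_Integration.integral_sum[symmetric]) (auto intro!: i1 poly_fun_angular Fp)
  also have "\<dots> = (\<Sum>j\<in>(UNIV :: 'n set). 0)"
  proof (rule sum.cong[OF refl])
    fix j :: 'n
    show "(\<integral>x. angular i j (\<lambda>x. x $ j * F x) x \<partial>\<sigma>) = 0"
    proof (cases "i = j")
      case False then show ?thesis by (rule integral_angular_0[OF \<sigma> Fp])
    qed (simp add: angular_def)
  qed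
  also have "\<dots> = 0" by simp
  also have "(\<integral>x. (real CARD('n) + real d - 1) * (x $ i * F x) - (norm x)\<^sup>2 * partial i F x \<partial>\<sigma>)
     = (real CARD('n) + real d - 1) * (\<integral>x. x $ i * F x \<partial>\<sigma>) - (\<integral>x. (norm x)\<^sup>2 * partial i F x \<partial>\<sigma>)"
    using F Fp by (subst Bochner_Integration.integral_diff) (auto intro!: i1 poly_fun_mult)
  also have "(\<integral>x. (norm x)\<^sup>2 * partial i F x \<partial>\<sigma>) = (\<integral>x. partial i F x \<partial>\<sigma>)"
    by (rule integral_cong_AE)
       (use sphere_invariantD(3)[OF \<sigma>] F in \<open>auto intro!: borel_measurable_integrable i1 poly_fun_mult\<close>)
  finally show ?thesis by simp
qed

text \<open>The Dirichlet form \<open>D P Q = \<integral> \<nabla>P \<cdot> \<nabla>Q\<close> is symmetric and equals \<open>(N+p+q-2) p \<integral> P Q\<close> by \<open>integral_partial\<close> for \<open>\<partial>_i P Q\<close>.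
Exchanging the roles of \<open>P\<close> and \<open>Q\<close> gives \<open>p \<integral> P Q = q \<integral> P Q\<close>, as the common factor is positive.\<close>

lemma solid_harmonic_orthogonal:
  fixes P Q :: "real ^ 'n \<Rightarrow> real"
  assumes \<sigma>: "sphere_invariant \<sigma>" and P: "solid_harmonic p P" and Q: "solid_harmonic q Q" and "p \<noteq> q"
    and N: "CARD('n) \<ge> 2"
  shows "(\<integral>x. P x * Q x \<partial>\<sigma>) = 0"
proof -
  have i1: "integrable \<sigma> G" if "poly_fun G" for G :: "real ^ 'n \<Rightarrow> real" using integrable_sphere[OF \<sigma>] that by blast
  define D where "D P Q = (\<integral>x. (\<Sum>i\<in>UNIV. partial i P x * partial i Q x) \<partial>\<sigma>)" for P Q :: "real ^ 'n \<Rightarrow> real"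
  have main: "D P Q = (real CARD('n) + real p + real q - 2) * (real p * (\<integral>x. P x * Q x \<partial>\<sigma>))"
    if P: "solid_harmonic p P" and Q: "solid_harmonic q Q" for p q and P Q :: "real ^ 'n \<Rightarrow> real"
  proof (cases p)
    case 0
    then have "partial i P = (\<lambda>x. 0)" for i using P solid_harmonic_partial_0 by blast
    then show ?thesis using 0 by (simp add: D_def)
  next
    case (Suc p')
    note PP = solid_harmonicD[OF P] and QQ = solid_harmonicD[OF Q]
    have pf: "poly_fun (\<lambda>x. partial i P x * Q x)" for i using PP QQ by (auto intro: poly_fun_mult)
    have "(\<Sum>i\<in>UNIV. partial i (\<lambda>x. partial i P x * Q x) x) = (\<Sum>i\<in>UNIV. partial i P x * partial i Q x)" for x
    proof -
      have "(\<Sum>i\<in>UNIV. partial i (\<lambda>x. partial i P x * Q x) x) = (\<Sum>i\<in>UNIV. partial i P x * partial i Q x) + laplacian P x * Q x"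
        unfolding laplacian_def using PP QQ by (simp add: partial_mult poly_fun_partial sum.distrib sum_distrib_right)
      then show ?thesis using PP by simp
    qed
    then have "D P Q = (\<Sum>i\<in>UNIV. \<integral>x. partial i (\<lambda>x. partial i P x * Q x) x \<partial>\<sigma>)"
      unfolding D_def by (subst Bochner_Integration.integral_sum[symmetric]) (auto intro!: i1 pf)
    also have "\<dots> = (\<Sum>i\<in>UNIV. (real CARD('n) + real (p' + q) - 1) * (\<integral>x. x $ i * (partial i P x * Q x) \<partial>\<sigma>))"
      by (intro sum.cong refl integral_partial[OF \<sigma> pf])
         (use homogeneous_mult[OF homogeneous_partial[OF PP(1,2)] QQ(2)] Suc in simp)
    also have "\<dots> = (real CARD('n) + real (p' + q) - 1) * (\<integral>x. (\<Sum>i\<in>UNIV. x $ i * (partial i P x * Q x)) \<partial>\<sigma>)"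
      by (subst Bochner_Integration.integral_sum) (auto intro!: i1 poly_fun_mult[OF _ pf] simp: sum_distrib_left)
    also have "(\<lambda>x. \<Sum>i\<in>UNIV. x $ i * (partial i P x * Q x)) = (\<lambda>x. real p * (P x * Q x))"
      using euler[OF PP(1,2)] by (simp add: sum_distrib_right[symmetric] mult.assoc[symmetric])
    also have "(\<integral>x. real p * (P x * Q x) \<partial>\<sigma>) = real p * (\<integral>x. P x * Q x \<partial>\<sigma>)"
      by (rule integral_mult_right_zero)
    finally show ?thesis using Suc by (simp add: algebra_simps)
  qed
  have "D P Q = D Q P" by (simp add: D_def mult.commute)
  then have eq: "(real CARD('n) + real p + real q - 2) * (real p * (\<integral>x. P x * Q x \<partial>\<sigma>)) =
      (real CARD('n) + real p + real q - 2) * (real q * (\<integral>x. P x * Q x \<partial>\<sigma>))"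
    using main[OF P Q] main[OF Q P] by (simp add: mult.commute[of "Q _"] algebra_simps)
  moreover have "real CARD('n) + real p + real q - 2 > 0" using N \<open>p \<noteq> q\<close> by linarith
  ultimately show ?thesis using \<open>p \<noteq> q\<close> by simp
qed

text \<open>\<open>\<integral> \<partial>_k (P Q) = (N + 2j) \<integral> x_k P Q\<close> by \<open>integral_partial\<close>. The integral of \<open>P \<partial>_k Q\<close> vanishes because the degrees are \<open>j + 1\<close>
and \<open>j - 1\<close>; dropping it on the left and subtracting a multiple on the right yields both sides.\<close>

lemma raise_adjoint:
  fixes P Q :: "real ^ 'n \<Rightarrow> real"
  assumes \<sigma>: "sphere_invariant \<sigma>" and P: "solid_harmonic (Suc j) P" and Q: "solid_harmonic j Q"
    and N: "CARD('n) \<ge> 2"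
  shows "(\<integral>x. Q x * partial k P x \<partial>\<sigma>) = (real CARD('n) + 2 * real j) * (\<integral>x. P x * raise k j Q x \<partial>\<sigma>)"
proof -
  note PP = solid_harmonicD[OF P] and QQ = solid_harmonicD[OF Q]
  have i1: "integrable \<sigma> G" if "poly_fun G" for G :: "real ^ 'n \<Rightarrow> real" using integrable_sphere[OF \<sigma>] that by blast
  let ?D = "real CARD('n) + 2 * real j - 2"
  have orth: "(\<integral>x. P x * partial k Q x \<partial>\<sigma>) = 0"
    by (rule solid_harmonic_orthogonal[OF \<sigma> P solid_harmonic_partial[OF Q] _ N]) simp
  have "(\<integral>x. Q x * partial k P x \<partial>\<sigma>) = (\<integral>x. P x * partial k Q x + partial k P x * Q x \<partial>\<sigma>)"
    using PP QQ orth by (subst Bochner_Integration.integral_add) (auto intro!: i1 poly_fun_mult simp: mult.commute)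
  also have "\<dots> = (\<integral>x. partial k (\<lambda>x. P x * Q x) x \<partial>\<sigma>)"
    using PP QQ by (simp add: partial_mult)
  also have "\<dots> = (real CARD('n) + real (Suc j + j) - 1) * (\<integral>x. x $ k * (P x * Q x) \<partial>\<sigma>)"
    using PP QQ by (intro integral_partial \<sigma> poly_fun_mult homogeneous_mult)
  also have "(\<integral>x. x $ k * (P x * Q x) \<partial>\<sigma>) = (\<integral>x. P x * (x $ k * Q x) - (P x * partial k Q x) / ?D \<partial>\<sigma>)"
    using PP QQ orth by (subst Bochner_Integration.integral_diff) (auto intro!: i1 poly_fun_mult simp: mult_ac)
  also have "\<dots> = (\<integral>x. P x * raise k j Q x \<partial>\<sigma>)"
  proof (rule integral_cong_AE)
    show "(\<lambda>x. P x * (x $ k * Q x) - (P x * partial k Q x) / ?D) \<in> borel_measurable \<sigma>"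
      using PP QQ by (intro borel_measurable_integrable i1 real_polynomial_function_diff real_polynomial_function_divide poly_fun_mult) auto
    show "(\<lambda>x. P x * raise k j Q x) \<in> borel_measurable \<sigma>"
      using PP QQ by (intro borel_measurable_integrable i1 poly_fun_mult) auto
    show "AE x in \<sigma>. P x * (x $ k * Q x) - (P x * partial k Q x) / ?D = P x * raise k j Q x"
      using sphere_invariantD(3)[OF \<sigma>] by eventually_elim (simp add: raise_def algebra_simps)
  qed
  finally show ?thesis by simp
qed

section \<open>Bounds for functions and their derivatives on balls\<close>

definition c1_bound :: "real \<Rightarrow> (real ^ 'n \<Rightarrow> real) \<Rightarrow> real \<Rightarrow> bool" where
  "c1_bound \<rho> F M \<longleftrightarrow> (\<forall>x. norm x \<le> \<rho> \<longrightarrow> \<bar>F x\<bar> \<le> M \<and> (\<forall>i. \<bar>partial i F x\<bar> \<le> M))"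

text \<open>A single constant for all derivatives of order at most two makes the bound submultiplicative up to the factor 4,
so that it passes through recursions built from products.\<close>

definition c2_bound :: "real \<Rightarrow> (real ^ 'n \<Rightarrow> real) \<Rightarrow> real \<Rightarrow> bool" where
  "c2_bound \<rho> F M \<longleftrightarrow> c1_bound \<rho> F M \<and> (\<forall>i. c1_bound \<rho> (partial i F) M)"

lemma c2_boundD:
  assumes "c2_bound \<rho> F M" "norm x \<le> \<rho>"
  shows "\<bar>F x\<bar> \<le> M" "\<bar>partial i F x\<bar> \<le> M" "\<bar>partial i (partial j F) x\<bar> \<le> M"
  using assms by (auto simp: c2_bound_def c1_bound_def)

lemma c2_boundI:
  assumes "\<And>x. norm x \<le> \<rho> \<Longrightarrow> \<bar>F x\<bar> \<le> M" "\<And>x i. norm x \<le> \<rho> \<Longrightarrow> \<bar>partial i F x\<bar> \<le> M"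
    "\<And>x i j. norm x \<le> \<rho> \<Longrightarrow> \<bar>partial i (partial j F) x\<bar> \<le> M"
  shows "c2_bound \<rho> F M"
  using assms by (auto simp: c2_bound_def c1_bound_def)

lemma c2_bound_mono:
  assumes "c2_bound \<rho> F M" "\<rho>' \<le> \<rho>" "M \<le> M'"
  shows "c2_bound \<rho>' F M'"
  by (rule c2_boundI) (use c2_boundD[OF assms(1)] assms(2,3) order_trans in blast)+

lemma c2_bound_zero: "M \<ge> 0 \<Longrightarrow> c2_bound \<rho> (\<lambda>x. 0) M"
  by (rule c2_boundI) auto

lemma c2_bound_nonneg: "c2_bound \<rho> F M \<Longrightarrow> \<rho> \<ge> 0 \<Longrightarrow> M \<ge> 0"
  using c2_boundD(1)[of \<rho> F M 0] by force

lemma c2_bound_ex: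
  assumes "poly_fun F" shows "\<exists>M\<ge>0. c2_bound \<rho> F M"
proof -
  have b: "\<exists>M. \<forall>x\<in>cball 0 \<rho>. \<bar>G x\<bar> \<le> M" if "poly_fun G" for G
  proof -
    have "compact (G ` cball 0 \<rho>)" using that by (intro compact_continuous_image) auto
    then show ?thesis
      unfolding compact_eq_bounded_closed bounded_iff by (metis imageI real_norm_def)
  qed
  obtain A where A: "\<forall>x\<in>cball 0 \<rho>. \<bar>F x\<bar> \<le> A" using b assms by blast
  have "\<forall>i. \<exists>M. \<forall>x\<in>cball 0 \<rho>. \<bar>partial i F x\<bar> \<le> M" using b[OF poly_fun_partial[OF assms]] by blast
  then obtain B where B: "\<And>i. \<forall>x\<in>cball 0 \<rho>. \<bar>partial i F x\<bar> \<le> B i" by metis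
  have "\<forall>i j. \<exists>M. \<forall>x\<in>cball 0 \<rho>. \<bar>partial i (partial j F) x\<bar> \<le> M"
    using b[OF poly_fun_partial[OF poly_fun_partial[OF assms]]] by blast
  then obtain C where C: "\<And>i j. \<forall>x\<in>cball 0 \<rho>. \<bar>partial i (partial j F) x\<bar> \<le> C i j" by metis
  define M where "M = \<bar>A\<bar> + (\<Sum>i\<in>UNIV. \<bar>B i\<bar>) + (\<Sum>i\<in>UNIV. \<Sum>j\<in>UNIV. \<bar>C i j\<bar>)"
  have 1: "\<bar>B i\<bar> \<le> (\<Sum>i\<in>UNIV. \<bar>B i\<bar>)" for i by (rule member_le_sum) auto
  have "\<bar>C i j\<bar> \<le> (\<Sum>j\<in>UNIV. \<bar>C i j\<bar>)" for i j by (rule member_le_sum) auto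
  moreover have "(\<Sum>j\<in>UNIV. \<bar>C i j\<bar>) \<le> (\<Sum>i\<in>UNIV. \<Sum>j\<in>UNIV. \<bar>C i j\<bar>)" for i
    by (rule member_le_sum) (auto intro: sum_nonneg)
  ultimately have 2: "\<bar>C i j\<bar> \<le> (\<Sum>i\<in>UNIV. \<Sum>j\<in>UNIV. \<bar>C i j\<bar>)" for i j using order_trans by blast
  have nn: "(\<Sum>i\<in>UNIV. \<bar>B i\<bar>) \<ge> 0" "(\<Sum>i\<in>UNIV. \<Sum>j\<in>UNIV. \<bar>C i j\<bar>) \<ge> 0"
    by (auto intro: sum_nonneg)
  have "c2_bound \<rho> F M"
  proof (rule c2_boundI)
    fix x :: "real ^ 'a" and i j assume "norm x \<le> \<rho>"
    then have x: "x \<in> cball 0 \<rho>" by simp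
    have "\<bar>F x\<bar> \<le> A" using A x by blast
    then show "\<bar>F x\<bar> \<le> M" using nn unfolding M_def by linarith
    have "\<bar>partial i F x\<bar> \<le> B i" using B x by blast
    then show "\<bar>partial i F x\<bar> \<le> M" using nn 1[of i] unfolding M_def by linarith
    have "\<bar>partial i (partial j F) x\<bar> \<le> C i j" using C x by blast
    then show "\<bar>partial i (partial j F) x\<bar> \<le> M" using nn 2[of i j] unfolding M_def by linarith
  qed
  moreover have "M \<ge> 0" using nn unfolding M_def by linarith
  ultimately show ?thesis by blast
qed

lemma c2_bound_add:
  assumes "poly_fun F" "poly_fun G" "c2_bound \<rho> F M" "c2_bound \<rho> G M'"
  shows "c2_bound \<rho> (\<lambda>x. F x + G x) (M + M')"
  by (rule c2_boundI)
     (use c2_boundD[OF assms(3)] c2_boundD[OF assms(4)] assms(1,2) in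
       \<open>auto simp: partial_add poly_fun_partial intro!: order_trans[OF abs_triangle_ineq] add_mono\<close>)

lemma c2_bound_cmult:
  assumes "poly_fun F" "c2_bound \<rho> F M"
  shows "c2_bound \<rho> (\<lambda>x. c * F x) (\<bar>c\<bar> * M)"
  by (rule c2_boundI)
     (use c2_boundD[OF assms(2)] assms(1) in
       \<open>auto simp: partial_cmult poly_fun_partial abs_mult intro!: mult_left_mono\<close>)

lemma c2_bound_mult:
  assumes F: "poly_fun F" and G: "poly_fun G" and "c2_bound \<rho> F M" "c2_bound \<rho> G M'" and \<rho>: "\<rho> \<ge> 0"
  shows "c2_bound \<rho> (\<lambda>x. F x * G x) (4 * (M * M'))"
proof (rule c2_boundI)
  have M: "M \<ge> 0" "M' \<ge> 0" using c2_bound_nonneg assms by blast+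
  have mm: "\<bar>a * b\<bar> \<le> M * M'" if "\<bar>a\<bar> \<le> M" "\<bar>b\<bar> \<le> M'" for a b
    unfolding abs_mult using that M by (intro mult_mono) auto
  have MM: "0 \<le> M * M'" using M by simp
  fix x :: "real ^ 'a" and i j assume x: "norm x \<le> \<rho>"
  note f = c2_boundD[OF assms(3) x] and g = c2_boundD[OF assms(4) x]
  show "\<bar>F x * G x\<bar> \<le> 4 * (M * M')" using mm[OF f(1) g(1)] MM by linarith
  show "\<bar>partial i (\<lambda>x. F x * G x) x\<bar> \<le> 4 * (M * M')"
    using mm[OF f(1) g(2), of i] mm[OF f(2) g(1), of i] MM F G by (simp add: partial_mult)
  have "partial i (partial j (\<lambda>x. F x * G x)) x = F x * partial i (partial j G) x + partial i F x * partial j G x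
     + (partial j F x * partial i G x + partial i (partial j F) x * G x)"
    using F G by (simp add: partial_mult partial_add poly_fun_partial poly_fun_mult)
  then show "\<bar>partial i (partial j (\<lambda>x. F x * G x)) x\<bar> \<le> 4 * (M * M')"
    using mm[OF f(1) g(3), of i j] mm[OF f(2) g(2), of i j] mm[OF f(2) g(2), of j i] mm[OF f(3) g(1), of i j]
    by linarith
qed

lemma c2_bound_coord_mult:
  assumes F: "poly_fun F" "c2_bound \<rho> F M" and \<rho>: "\<rho> \<ge> 0"
  shows "c2_bound \<rho> (\<lambda>x. x $ k * F x) (8 * (\<rho> + 1)\<^sup>2 * M)"
proof -
  have "c2_bound \<rho> (\<lambda>x :: real ^ 'a. x $ k) (\<rho> + 1)"
  proof (rule c2_boundI)
    fix x :: "real ^ 'a" assume "norm x \<le> \<rho>"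
    then show "\<bar>x $ k\<bar> \<le> \<rho> + 1" using component_le_norm_cart[of x k] by linarith
  next
    fix x :: "real ^ 'a" and i j
    show "\<bar>partial i (\<lambda>x :: real ^ 'a. x $ k) x\<bar> \<le> \<rho> + 1" using \<rho> by (simp add: partial_coord)
    have "partial j (\<lambda>x :: real ^ 'a. x $ k) = (\<lambda>x. if j = k then 1 else 0)" by (rule partial_coord)
    then show "\<bar>partial i (partial j (\<lambda>x :: real ^ 'a. x $ k)) x\<bar> \<le> \<rho> + 1" using \<rho> by simp
  qed
  from c2_bound_mult[OF poly_fun_coord F(1) this F(2) \<rho>]
  have "c2_bound \<rho> (\<lambda>x. x $ k * F x) (4 * ((\<rho> + 1) * M))" .
  then show ?thesis
  proof (rule c2_bound_mono)
    have "M \<ge> 0" using F \<rho> c2_bound_nonneg by blast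
    moreover have "4 * (\<rho> + 1) \<le> 8 * (\<rho> + 1)\<^sup>2" using \<rho> by (simp add: power2_eq_square algebra_simps)
    ultimately have "4 * (\<rho> + 1) * M \<le> 8 * (\<rho> + 1)\<^sup>2 * M" by (rule mult_right_mono[rotated])
    then show "4 * ((\<rho> + 1) * M) \<le> 8 * (\<rho> + 1)\<^sup>2 * M" by (simp only: mult.assoc)
  qed simp
qed

lemma c2_bound_norm_sq_mult:
  assumes F: "poly_fun F" "c2_bound \<rho> F M" and \<rho>: "\<rho> \<ge> 0"
  shows "c2_bound \<rho> (\<lambda>x. (norm x)\<^sup>2 * F x) (8 * (\<rho> + 1)\<^sup>2 * M)"
proof -
  have sq: "2 * (\<rho> + 1)\<^sup>2 = 2 * \<rho>\<^sup>2 + 4 * \<rho> + 2" by (simp add: power2_eq_square algebra_simps)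
  have "c2_bound \<rho> (\<lambda>x :: real ^ 'a. (norm x)\<^sup>2) (2 * (\<rho> + 1)\<^sup>2)"
  proof (rule c2_boundI)
    fix x :: "real ^ 'a" and i assume x: "norm x \<le> \<rho>"
    then have n2: "(norm x)\<^sup>2 \<le> \<rho>\<^sup>2" by (intro power_mono) auto
    have "\<bar>(norm x)\<^sup>2\<bar> = (norm x)\<^sup>2" by simp
    also have "\<dots> \<le> 2 * \<rho>\<^sup>2 + 4 * \<rho> + 2" using \<rho> n2 zero_le_power2[of \<rho>] by linarith
    finally show "\<bar>(norm x)\<^sup>2\<bar> \<le> 2 * (\<rho> + 1)\<^sup>2" unfolding sq .
    have "2 * \<bar>x $ i\<bar> \<le> 2 * \<rho>\<^sup>2 + 4 * \<rho> + 2"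
      using component_le_norm_cart[of x i] x \<rho> zero_le_power2[of \<rho>] by linarith
    then show "\<bar>partial i (\<lambda>x :: real ^ 'a. (norm x)\<^sup>2) x\<bar> \<le> 2 * (\<rho> + 1)\<^sup>2"
      unfolding sq partial_norm_sq by (simp add: abs_mult)
  next
    fix x :: "real ^ 'a" and i j
    show "\<bar>partial i (partial j (\<lambda>x :: real ^ 'a. (norm x)\<^sup>2)) x\<bar> \<le> 2 * (\<rho> + 1)\<^sup>2"
      using \<rho> unfolding sq partial_norm_sq partial_cmult[OF poly_fun_coord] partial_coord by auto
  qed
  from c2_bound_mult[OF poly_fun_norm_sq F(1) this F(2) \<rho>]
  show ?thesis by (simp only: mult.assoc[symmetric]) simp
qed

section \<open>Antiderivatives of harmonic polynomials that are independent of one variable\<close>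

text \<open>With \<open>a = N + 2s - 2\<close> the derivative \<open>\<partial>_k\<close> maps \<open>raise^(n+1) U\<close> to \<open>primitive_factor a n\<close> times \<open>raise^n U\<close>. For \<open>n = 0\<close>
the factor is 1; it is a separate case since the formula would read \<open>0/0\<close> for \<open>a = 0\<close>.\<close>

definition primitive_factor :: "real \<Rightarrow> nat \<Rightarrow> real" where
  "primitive_factor a n = (if n = 0 then 1 else (real n + 1) * (a + real n) / (a + 2 * real n))"

primrec primitive :: "'n \<Rightarrow> nat \<Rightarrow> (real ^ 'n \<Rightarrow> real) \<Rightarrow> nat \<Rightarrow> real ^ 'n \<Rightarrow> real" where
  "primitive k s U 0 = U"
| "primitive k s U (Suc n) = (\<lambda>x. raise k (s + n) (primitive k s U n) x / primitive_factor (real CARD('n) + 2 * real s - 2) n)"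

lemma primitive_factor_lower:
  assumes "a \<ge> 0" shows "primitive_factor a n \<ge> (real n + 1) / 2" "primitive_factor a n > 0"
proof -
  show *: "primitive_factor a n \<ge> (real n + 1) / 2"
  proof (cases "n = 0")
    case False
    then have "(a + real n) / (a + 2 * real n) \<ge> 1 / 2" using assms by (simp add: field_simps)
    then have "(real n + 1) * ((a + real n) / (a + 2 * real n)) \<ge> (real n + 1) * (1 / 2)"
      by (intro mult_left_mono) auto
    then show ?thesis using False by (simp add: primitive_factor_def)
  qed (simp add: primitive_factor_def)
  have "(real n + 1) / 2 > 0" by simp
  then show "primitive_factor a n > 0" using * by linarith
qed

text \<open>The recursion that the relation \<open>\<partial>_k raise = 1 + (1 - 2/D) raise \<partial>_k\<close> imposes on the factors.\<close>

lemma primitive_factor_step: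
  assumes "a \<ge> 0"
  shows "1 + (1 - 2 / (a + 2 * real (Suc n))) * primitive_factor a n = primitive_factor a (Suc n)"
proof (cases "n = 0")
  case True
  then show ?thesis using assms by (simp add: primitive_factor_def field_simps)
next
  case False
  then have pos: "a + 2 * real n > 0" using assms by (simp add: add_nonneg_pos)
  define b where "b = a + 2 * real n"
  have "(1 - 2 / (b + 2)) * ((real n + 1) * (a + real n) / b) = (real n + 1) * (a + real n) / (b + 2)"
    using pos unfolding b_def[symmetric] by (simp add: divide_simps)
  moreover have "1 + (real n + 1) * (a + real n) / (b + 2) = (real n + 2) * (a + real n + 1) / (b + 2)"
    using pos unfolding b_def by (simp add: divide_simps) (simp add: algebra_simps)
  ultimately show ?thesis using False by (simp add: primitive_factor_def b_def algebra_simps)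
qed

locale primitives =
  fixes k :: "'n::finite" and s :: nat and U :: "real ^ 'n \<Rightarrow> real"
  assumes N: "CARD('n) \<ge> 2" and U: "solid_harmonic s U" and U0: "partial k U = (\<lambda>x. 0)"
begin

abbreviation "Q \<equiv> primitive k s U"
definition "a = real CARD('n) + 2 * real s - 2"

lemma a_nonneg: "a \<ge> 0" using N by (simp add: a_def)

lemma Q_Suc: "Q (Suc n) = (\<lambda>x. raise k (s + n) (Q n) x / primitive_factor a n)"
  by (simp add: a_def)

lemma Q_solid: "solid_harmonic (s + n) (Q n)"
proof (induction n)
  case 0 then show ?case using U by simp
next
  case (Suc n)
  from solid_harmonic_cmult[OF solid_harmonic_raise[OF this, of k], of "1 / primitive_factor a n"]
  show ?case unfolding Q_Suc by simp
qed

lemma Q_poly: "poly_fun (Q n)"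
  by (rule solid_harmonicD(1)[OF Q_solid])

lemma partial_Q: "partial k (Q (Suc n)) = Q n"
proof (induction n)
  case 0
  have "partial k (raise k s U) = U"
    unfolding partial_raise[OF U] U0 by (simp add: raise_def)
  then show ?case by (simp add: primitive_factor_def)
next
  case (Suc m)
  have D: "real CARD('n) + 2 * real (s + Suc m) - 2 = a + 2 * real (Suc m)" by (simp add: a_def)
  have r: "raise k (s + m) (Q m) x = primitive_factor a m * Q (Suc m) x" for x
    using primitive_factor_lower(2)[OF a_nonneg, of m] by (simp add: Q_Suc del: primitive.simps)
  have "partial k (raise k (s + Suc m) (Q (Suc m))) x =
      Q (Suc m) x + raise k (s + m) (Q m) x - 2 / (a + 2 * real (Suc m)) * raise k (s + m) (Q m) x" for x
    unfolding partial_raise[OF Q_solid[of "Suc m"]] Suc.IH D by simp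
  also have "\<dots> x = (1 + (1 - 2 / (a + 2 * real (Suc m))) * primitive_factor a m) * Q (Suc m) x" for x
    unfolding r by (simp add: algebra_simps del: primitive.simps)
  finally have "partial k (raise k (s + Suc m) (Q (Suc m))) = (\<lambda>x. primitive_factor a (Suc m) * Q (Suc m) x)"
    unfolding primitive_factor_step[OF a_nonneg] by blast
  then show ?case
    unfolding Q_Suc[of "Suc m"] using primitive_factor_lower(2)[OF a_nonneg, of "Suc m"] Q_poly[of "Suc m"]
    by (subst partial_divide) (auto simp del: primitive.simps)
qed

text \<open>As \<open>\<partial>_k (Q n) = Q (n - 1)\<close>, raising \<open>Q n\<close> involves no derivative: \<open>Q (n + 1)\<close> is \<open>x_k Q n\<close> minus a multiple of \<open>|x|\<^sup>2 Q (n - 1)\<close>,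
divided by a factor of order \<open>n\<close>. This three-term recursion produces the factorial.\<close>

lemma Q_c2_bound:
  "\<exists>M B. M \<ge> 0 \<and> B \<ge> 1 \<and> (\<forall>n. c2_bound \<rho> (Q n) (M * B ^ n / fact n))"
proof -
  define \<rho>' where "\<rho>' = max \<rho> 0"
  have \<rho>: "\<rho>' \<ge> 0" "\<rho> \<le> \<rho>'" by (auto simp: \<rho>'_def)
  obtain M where M: "M \<ge> 0" "c2_bound \<rho>' U M"
    using c2_bound_ex[OF solid_harmonicD(1)[OF U], of \<rho>'] by blast
  define L where "L = 8 * (\<rho>' + 1)\<^sup>2"
  \<comment> \<open>multiplying by \<open>x_k\<close> or \<open>|x|\<^sup>2\<close> costs a factor \<open>L\<close>; two such terms and the division by \<open>(n + 2)/2\<close> give \<open>4 L\<close>\<close>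
  define B where "B = 4 * L"
  have "(\<rho>' + 1)\<^sup>2 \<ge> 1" using \<rho> by (simp add: power2_eq_square algebra_simps)
  then have L: "L \<ge> 1" by (simp add: L_def)
  have B: "B \<ge> 1" using L by (simp add: B_def)
  have "c2_bound \<rho>' (Q n) (M * B ^ n / fact n) \<and> c2_bound \<rho>' (Q (Suc n)) (M * B ^ Suc n / fact (Suc n))" for n
  proof (induction n)
    case 0
    have "Q 1 = (\<lambda>x. x $ k * U x)" by (simp add: U0 raise_def primitive_factor_def)
    moreover have "c2_bound \<rho>' (\<lambda>x. x $ k * U x) (L * M)"
      unfolding L_def by (rule c2_bound_coord_mult[OF solid_harmonicD(1)[OF U] M(2) \<rho>(1)])
    then have "c2_bound \<rho>' (\<lambda>x. x $ k * U x) (M * B)"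
      by (rule c2_bound_mono) (use M L in \<open>auto simp: B_def mult_ac intro!: mult_right_mono\<close>)
    ultimately show ?case using M by simp
  next
    case (Suc n)
    define b where "b = M * B ^ n / fact n"
    define c where "c = primitive_factor a (Suc n)"
    define D where "D = a + 2 * real (Suc n)"
    have D: "D \<ge> real (Suc n)" "D > 0" using a_nonneg by (auto simp: D_def)
    have c: "c \<ge> (real (Suc n) + 1) / 2" "c > 0" unfolding c_def by (rule primitive_factor_lower[OF a_nonneg])+
    have b: "b \<ge> 0" using M B by (simp add: b_def)
    have e1: "M * B ^ Suc n / fact (Suc n) = b * B / real (Suc n)" by (simp add: b_def mult_ac)
    have e2: "M * B ^ Suc (Suc n) / fact (Suc (Suc n)) = b * B / real (Suc n) * B / (real (Suc n) + 1)"
      by (simp add: b_def add_ac mult_ac)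
    have "Q (Suc (Suc n)) = (\<lambda>x. (1 / c) * (x $ k * Q (Suc n) x) + (- 1 / (c * D)) * ((norm x)\<^sup>2 * Q n x))"
      unfolding Q_Suc[of "Suc n"] raise_def partial_Q
      by (rule ext) (simp add: c_def D_def a_def diff_divide_distrib add_ac algebra_simps del: primitive.simps)
    moreover have "c2_bound \<rho>' (\<lambda>x. (1 / c) * (x $ k * Q (Suc n) x) + (- 1 / (c * D)) * ((norm x)\<^sup>2 * Q n x))
        (\<bar>1 / c\<bar> * (L * (b * B / real (Suc n))) + \<bar>- 1 / (c * D)\<bar> * (L * b))"
      unfolding L_def
      by (intro c2_bound_add c2_bound_cmult c2_bound_coord_mult c2_bound_norm_sq_mult poly_fun_cmult poly_fun_mult
          poly_fun_coord poly_fun_norm_sq Q_poly \<rho>) (use Suc.IH e1 in \<open>auto simp: b_def simp del: primitive.simps\<close>)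
    moreover have "\<bar>1 / c\<bar> * (L * (b * B / real (Suc n))) + \<bar>- 1 / (c * D)\<bar> * (L * b) \<le>
        b * B / real (Suc n) * B / (real (Suc n) + 1)"
    proof -
      have "1 / D \<le> 1 / real (Suc n)" using D by (intro divide_left_mono) auto
      then have "L * b * (1 / D) \<le> L * b * (B / real (Suc n))"
        using L b B by (intro mult_left_mono) (auto intro: order_trans simp: divide_right_mono)
      then have "L * b / D \<le> L * (b * B / real (Suc n))" by (simp add: mult_ac)
      then have "L * (b * B / real (Suc n)) + L * b / D \<le> 2 * (L * (b * B / real (Suc n)))"
        by (metis add_left_mono mult_2)
      then have "(1 / c) * (L * (b * B / real (Suc n)) + L * b / D) \<le> (2 / (real (Suc n) + 1)) * (2 * (L * (b * B / real (Suc n))))"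
        using c L b B D by (intro mult_mono) (auto simp: field_simps)
      also have "\<dots> = b * B / real (Suc n) * B / (real (Suc n) + 1)"
        by (simp add: B_def mult_ac)
      also have "(1 / c) * (L * (b * B / real (Suc n)) + L * b / D) = \<bar>1 / c\<bar> * (L * (b * B / real (Suc n))) + \<bar>- 1 / (c * D)\<bar> * (L * b)"
        using c D by (simp add: abs_mult distrib_left)
      finally show ?thesis .
    qed
    ultimately have "c2_bound \<rho>' (Q (Suc (Suc n))) (b * B / real (Suc n) * B / (real (Suc n) + 1))"
      using c2_bound_mono by (metis order_refl)
    then show ?case using Suc.IH unfolding e2 by blast
  qed
  then have "c2_bound \<rho> (Q n) (M * B ^ n / fact n)" for n using c2_bound_mono \<rho>(2) by blast
  then show ?thesis using M B by blast
qed

text \<open>\<open>raise_adjoint\<close> for \<open>P = Q (n + 1)\<close>, whose derivative is \<open>Q n\<close> and which is a multiple of \<open>raise k (s + n) (Q n)\<close>.\<close>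

lemma integral_Q_Suc:
  assumes \<sigma>: "sphere_invariant \<sigma>"
  shows "(\<integral>x. (Q (Suc n) x)\<^sup>2 \<partial>\<sigma>) = (\<integral>x. (Q n x)\<^sup>2 \<partial>\<sigma>) / (primitive_factor a n * (a + 2 * real n + 2))"
proof -
  have c: "primitive_factor a n > 0" by (rule primitive_factor_lower[OF a_nonneg])
  have D: "a + 2 * real n + 2 > 0" using a_nonneg by simp
  have "(\<integral>x. (Q n x)\<^sup>2 \<partial>\<sigma>) = (\<integral>x. Q n x * partial k (Q (Suc n)) x \<partial>\<sigma>)"
    unfolding partial_Q by (simp add: power2_eq_square)
  also have "\<dots> = (real CARD('n) + 2 * real (s + n)) * (\<integral>x. Q (Suc n) x * raise k (s + n) (Q n) x \<partial>\<sigma>)"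
    using Q_solid[of "Suc n"] Q_solid[of n] N \<sigma> by (intro raise_adjoint) auto
  also have "(\<lambda>x. Q (Suc n) x * raise k (s + n) (Q n) x) = (\<lambda>x. primitive_factor a n * (Q (Suc n) x)\<^sup>2)"
    using c by (simp add: Q_Suc power2_eq_square del: primitive.simps)
  also have "real CARD('n) + 2 * real (s + n) = a + 2 * real n + 2" by (simp add: a_def)
  finally have "(\<integral>x. (Q n x)\<^sup>2 \<partial>\<sigma>) = (primitive_factor a n * (a + 2 * real n + 2)) * (\<integral>x. (Q (Suc n) x)\<^sup>2 \<partial>\<sigma>)"
    by (simp add: mult_ac del: primitive.simps)
  moreover have "primitive_factor a n * (a + 2 * real n + 2) \<noteq> 0" using c D by auto
  ultimately show ?thesis by (metis nonzero_mult_div_cancel_left)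
qed

end

text \<open>The product of the factors \<open>1 + c / n\<^sup>2\<close> is at most \<open>exp (c \<Sum>n. 1/n\<^sup>2)\<close>.\<close>

lemma bounded_growth:
  fixes b :: "nat \<Rightarrow> real"
  assumes "c \<ge> 0" "\<And>n. b n \<ge> 0" "\<And>n. b (Suc n) \<le> b n * (1 + c / (real (Suc n))\<^sup>2)"
  shows "b n \<le> b 0 * exp (c * (pi\<^sup>2 / 6))"
proof -
  have "b n \<le> b 0 * exp (c * (\<Sum>i<n. 1 / (real (Suc i))\<^sup>2))" for n
  proof (induction n)
    case (Suc n)
    have "b (Suc n) \<le> b n * (1 + c / (real (Suc n))\<^sup>2)" by (rule assms)
    also have "\<dots> \<le> b n * exp (c / (real (Suc n))\<^sup>2)"
      using assms by (intro mult_left_mono exp_ge_add_one_self) auto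
    also have "\<dots> \<le> b 0 * exp (c * (\<Sum>i<n. 1 / (real (Suc i))\<^sup>2)) * exp (c / (real (Suc n))\<^sup>2)"
      using Suc.IH by (intro mult_right_mono) auto
    finally show ?case by (simp add: distrib_left exp_add)
  qed simp
  also have "b 0 * exp (c * (\<Sum>i<n. 1 / (real (Suc i))\<^sup>2)) \<le> b 0 * exp (c * (pi\<^sup>2 / 6))"
  proof -
    have "(\<Sum>i<n. 1 / (real (Suc i))\<^sup>2) \<le> pi\<^sup>2 / 6"
      using inverse_squares_sums sum_le_suminf[of "\<lambda>i. 1 / (real (Suc i))\<^sup>2" "{..<n}"]
      by (auto simp: sums_iff)
    then have "c * (\<Sum>i<n. 1 / (real (Suc i))\<^sup>2) \<le> c * (pi\<^sup>2 / 6)" using assms(1) by (rule mult_left_mono)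
    then show ?thesis using assms(2)[of 0] by (intro mult_left_mono) simp_all
  qed
  finally show ?thesis .
qed

context primitives
begin

text \<open>The left side is the quotient of consecutive terms of \<open>(s+n)! (s+n+N-2)!\<close>, the first two factors on the right form the quotient of
consecutive mean squares by \<open>integral_Q_Suc\<close>. Both equal \<open>n\<^sup>2\<close> up to lower order and agree in the linear term, so they differ by a factor
\<open>1 + O(1/n\<^sup>2)\<close>. With \<open>v = a/2\<close> the left side is at most \<open>(n+v+1)\<^sup>2\<close>.\<close>

lemma Q_growth_ratio:
  assumes "n \<ge> 1"
  shows "(real (s + n) + 1) * (real (s + n) + real CARD('n) - 1) \<le>
     primitive_factor a n * (a + 2 * real n + 2) * (1 + (a / 2)\<^sup>2 / (real n)\<^sup>2)"
proof -
  define v where "v = a / 2"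
  define m where "m = real n"
  have v: "v \<ge> 0" using a_nonneg by (simp add: v_def)
  have m: "m \<ge> 1" using assms by (simp add: m_def)
  have s: "real s = v - (real CARD('n) - 2) / 2" by (simp add: v_def a_def field_simps)
  have "(real (s + n) + 1) * (real (s + n) + real CARD('n) - 1) = (m + v + 1)\<^sup>2 - ((real CARD('n) - 2) / 2)\<^sup>2"
    unfolding of_nat_add s m_def by (simp add: power2_eq_square field_simps)
  also have "\<dots> \<le> (m + v + 1) / (m + v) * ((m + v) * (m + v + 1))"
    using m v by (simp add: power2_eq_square)
  also have "\<dots> \<le> (m + v + 1) / (m + v) * ((m + 1) * (m + 2 * v) * (1 + v\<^sup>2 / m\<^sup>2))"
  proof (rule mult_left_mono)
    have "m\<^sup>2 \<le> (m + 1) * (m + 2 * v)" using m v by (simp add: power2_eq_square algebra_simps)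
    then have "1 \<le> (m + 1) * (m + 2 * v) / m\<^sup>2"
      using m by (simp add: pos_le_divide_eq)
    then have "v\<^sup>2 * 1 \<le> v\<^sup>2 * ((m + 1) * (m + 2 * v) / m\<^sup>2)"
      by (intro mult_left_mono) auto
    then have "(m + 1) * (m + 2 * v) + v\<^sup>2 \<le> (m + 1) * (m + 2 * v) * (1 + v\<^sup>2 / m\<^sup>2)"
      by (simp only: distrib_left[of _ 1] mult_1_right times_divide_eq_right mult.commute[of "v\<^sup>2"] add_le_cancel_left)
    moreover have "(m + v) * (m + v + 1) \<le> (m + 1) * (m + 2 * v) + v\<^sup>2"
      using v by (simp add: power2_eq_square algebra_simps)
    ultimately show "(m + v) * (m + v + 1) \<le> (m + 1) * (m + 2 * v) * (1 + v\<^sup>2 / m\<^sup>2)" by linarith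
  qed (use m v in auto)
  also have "(m + v + 1) / (m + v) * ((m + 1) * (m + 2 * v) * (1 + v\<^sup>2 / m\<^sup>2)) =
      primitive_factor a n * (a + 2 * real n + 2) * (1 + (a / 2)\<^sup>2 / (real n)\<^sup>2)"
  proof -
    have av: "a = 2 * v" by (simp add: v_def)
    have "primitive_factor a n = (m + 1) * (2 * v + m) / (2 * (v + m))"
      using assms by (simp add: primitive_factor_def m_def av algebra_simps)
    moreover have "a + 2 * real n + 2 = 2 * (v + m + 1)" by (simp add: av m_def)
    ultimately have "primitive_factor a n * (a + 2 * real n + 2) = (m + v + 1) / (m + v) * ((m + 1) * (m + 2 * v))"
      using m v by (simp add: field_simps)
    then show ?thesis by (simp add: v_def m_def mult_ac)
  qed
  finally show ?thesis .
qed

text \<open>Multiply the mean squares by the factorials. The resulting sequence is bounded by \<open>Q_growth_ratio\<close> and \<open>bounded_growth\<close> from the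
index 1 on. The constant does not depend on \<open>\<sigma>\<close>, as the first term is at most the maximum of \<open>U\<^sup>2\<close> on the sphere.\<close>

lemma Q_mean_square:
  "\<exists>K\<ge>0. \<forall>\<sigma> n. sphere_invariant \<sigma> \<longrightarrow> measure \<sigma> UNIV = 1 \<longrightarrow>
     (\<integral>x. (Q n x)\<^sup>2 \<partial>\<sigma>) \<le> K / (fact (s + n) * fact (s + n + (CARD('n) - 2)))"
proof -
  let ?p = "CARD('n) - 2"
  obtain B where B: "B \<ge> 0" "c2_bound 1 U B"
    using c2_bound_ex[OF solid_harmonicD(1)[OF U], of 1] by blast
  define c where "c = (a / 2)\<^sup>2"
  define w where "w n = (fact (s + n) * fact (s + n + ?p) :: real)" for n
  define R where "R = w 1 / (w 0 * (primitive_factor a 0 * (a + 2)))"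
  define E where "E = exp (c * (pi\<^sup>2 / 6))"
  define K where "K = B\<^sup>2 * w 0 * (1 + R * E)"
  have w: "w n > 0" for n by (simp add: w_def)
  have pp: "primitive_factor a n > 0" "a + 2 * real n + 2 > 0" for n
    using primitive_factor_lower(2)[OF a_nonneg] a_nonneg by auto
  have R: "R \<ge> 0" using w[of 0] w[of 1] pp[of 0] by (simp add: R_def)
  have E: "E \<ge> 0" by (simp add: E_def)
  have wS: "w (Suc n) = w n * ((real (s + n) + 1) * (real (s + n) + real CARD('n) - 1))" for n
  proof -
    have "real (s + n + ?p) + 1 = real (s + n) + real CARD('n) - 1" using N by simp
    then show ?thesis by (simp add: w_def add_ac)
  qed
  show ?thesis
  proof (intro exI[of _ K] conjI allI impI)
    show "K \<ge> 0" using B w[of 0] R E by (simp add: K_def)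
    fix \<sigma> :: "(real ^ 'n) measure" and n
    assume \<sigma>: "sphere_invariant \<sigma>" and one: "measure \<sigma> UNIV = 1"
    interpret finite_measure \<sigma> using sphere_invariantD \<sigma> by blast
    have sp: "space \<sigma> = UNIV" using sets_eq_imp_space_eq[OF sphere_invariantD(2)[OF \<sigma>]] by simp
    define b where "b n = (\<integral>x. (Q n x)\<^sup>2 \<partial>\<sigma>) * w n" for n
    have b: "b n \<ge> 0" for n unfolding b_def using w[of n] by (intro mult_nonneg_nonneg integral_nonneg_AE) auto
    have bS: "b (Suc n) = b n * (((real (s + n) + 1) * (real (s + n) + real CARD('n) - 1)) / (primitive_factor a n * (a + 2 * real n + 2)))" for n
      unfolding b_def integral_Q_Suc[OF \<sigma>] wS by simp
    have "(\<integral>x. (Q 0 x)\<^sup>2 \<partial>\<sigma>) \<le> (\<integral>x. B\<^sup>2 \<partial>\<sigma>)"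
    proof (rule integral_mono_AE)
      show "integrable \<sigma> (\<lambda>x. (Q 0 x)\<^sup>2)"
        by (intro integrable_sphere[OF \<sigma>] continuous_intros) (auto intro!: poly_fun_continuous solid_harmonicD(1)[OF U])
      show "AE x in \<sigma>. (Q 0 x)\<^sup>2 \<le> B\<^sup>2"
        using sphere_invariantD(3)[OF \<sigma>]
      proof eventually_elim
        case (elim x)
        then have "\<bar>U x\<bar> \<le> B" using c2_boundD(1)[OF B(2)] by simp
        then have "\<bar>U x\<bar>\<^sup>2 \<le> B\<^sup>2" by (intro power_mono) auto
        then show ?case by simp
      qed
    qed simp
    also have "\<dots> = B\<^sup>2" using one by (simp add: sp)
    finally have b0: "b 0 \<le> B\<^sup>2 * w 0" unfolding b_def using w[of 0] by (intro mult_right_mono) auto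
    have b1: "b 1 = b 0 * R"
      using bS[of 0] w[of 0] wS[of 0] by (simp add: R_def)
    have "b (Suc (Suc m)) \<le> b (Suc m) * (1 + c / (real (Suc m))\<^sup>2)" for m
      unfolding bS[of "Suc m"] c_def using Q_growth_ratio[of "Suc m"] pp[of "Suc m"] b[of "Suc m"]
      by (intro mult_left_mono) (auto simp: pos_divide_le_eq mult_ac)
    then have bm: "b (Suc m) \<le> b (Suc 0) * E" for m
      unfolding E_def using bounded_growth[of c "\<lambda>m. b (Suc m)" m] b by (simp add: c_def)
    have "b n \<le> K"
    proof (cases n)
      case 0
      have "B\<^sup>2 * w 0 * 1 \<le> K" unfolding K_def using R E w[of 0] by (intro mult_left_mono) auto
      then show ?thesis using 0 b0 by simp
    next
      case (Suc m)
      have "b n \<le> b 0 * (R * E)" using bm[of m] b1 Suc by (simp add: mult.assoc)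
      also have "\<dots> \<le> B\<^sup>2 * w 0 * (1 + R * E)" using b0 R E B w[of 0] by (intro mult_mono) auto
      finally show ?thesis by (simp add: K_def)
    qed
    then have "(\<integral>x. (Q n x)\<^sup>2 \<partial>\<sigma>) \<le> K / w n" using w[of n] by (simp add: b_def pos_le_divide_eq)
    then show "(\<integral>x. (Q n x)\<^sup>2 \<partial>\<sigma>) \<le> K / (fact (s + n) * fact (s + n + ?p))" by (simp add: w_def)
  qed
qed

end

section \<open>Poisson weights\<close>

definition poisson :: "real \<Rightarrow> nat \<Rightarrow> real" where
  "poisson r n = exp (- r) * r ^ n / fact n"

lemma poisson_nonneg: "r \<ge> 0 \<Longrightarrow> poisson r n \<ge> 0"
  by (simp add: poisson_def)

lemma poisson_sums: "poisson r sums 1"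
proof -
  have "(\<lambda>n. exp (- r) * (r ^ n /\<^sub>R fact n)) sums (exp (- r) * exp r)"
    by (intro sums_mult exp_converges)
  then show ?thesis by (simp add: poisson_def[abs_def] exp_minus divide_inverse mult_ac)
qed

lemma sum_poisson_le:
  assumes "r \<ge> 0" "finite A" shows "sum (poisson r) A \<le> 1"
  using sum_le_suminf[OF sums_summable[OF poisson_sums[of r]] assms(2)] poisson_sums[of r] poisson_nonneg[OF assms(1)]
  by (simp add: sums_iff)

lemma poisson_Suc: "poisson r (Suc n) = poisson r n * (r / real (Suc n))"
  by (simp add: poisson_def field_simps)

text \<open>The integral of the concave function \<open>ln\<close> over an interval of length 1 is at most its value at the midpoint \<open>m\<close>.\<close>

lemma midpoint_ln:
  fixes m :: real
  assumes m: "m \<ge> 1"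
  shows "(m + 1/2) * ln (m + 1/2) - (m - 1/2) * ln (m - 1/2) \<le> 1 + ln m"
proof -
  define \<phi> where "\<phi> t = (m + t) * ln (m + t) - (m - t) * ln (m - t) - 2 * t - 2 * t * ln m" for t
  have "\<phi> (1/2) \<le> \<phi> 0"
  proof (rule DERIV_nonpos_imp_nonincreasing[of 0 "1/2" \<phi>])
    fix t :: real assume t: "0 \<le> t" "t \<le> 1/2"
    have pos: "m + t > 0" "m - t > 0" "m > 0" using m t by linarith+
    have "(\<phi> has_real_derivative ln (m + t) + ln (m - t) - 2 * ln m) (at t)"
      unfolding \<phi>_def using pos by (auto intro!: derivative_eq_intros)
    moreover have "ln (m + t) + ln (m - t) \<le> 2 * ln m"
    proof -
      have "ln (m + t) + ln (m - t) = ln ((m + t) * (m - t))" using pos by (simp add: ln_mult)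
      also have "\<dots> \<le> ln (m * m)" using pos mult_pos_pos[OF pos(1,2)]
        by (subst ln_le_cancel_iff) (auto simp: algebra_simps)
      also have "\<dots> = 2 * ln m" using pos by (simp add: ln_mult)
      finally show ?thesis .
    qed
    ultimately show "\<exists>y. (\<phi> has_real_derivative y) (at t) \<and> y \<le> 0" by force
  qed simp
  then show ?thesis by (simp add: \<phi>_def)
qed

text \<open>The lower half of Stirling's formula, obtained by summing \<open>midpoint_ln\<close>.\<close>

lemma ln_fact_lower:
  "(real n + 1/2) * ln (real n + 1/2) - real n \<le> ln (fact n)"
proof (induction n)
  case 0
  have "ln (1/2 :: real) \<le> 0" by simp
  then show ?case by simp
next
  case (Suc n)
  have "real (Suc n) - 1/2 = real n + 1/2" by simp
  then have "(real (Suc n) + 1/2) * ln (real (Suc n) + 1/2) - (real n + 1/2) * ln (real n + 1/2) \<le> 1 + ln (real (Suc n))"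
    using midpoint_ln[of "real (Suc n)"] by (simp add: add.commute)
  moreover have "ln (fact (Suc n)) = ln (real (Suc n)) + ln (fact n :: real)"
    by (simp add: ln_mult)
  ultimately show ?case using Suc.IH by simp
qed

text \<open>As a function of \<open>r\<close> the left side is largest at \<open>r = n + 1/2\<close>, where \<open>ln_fact_lower\<close> applies.\<close>

lemma poisson_le_sqrt:
  assumes r: "r > 0" shows "poisson r n * sqrt r \<le> 1"
proof -
  define b where "b = real n + 1/2"
  have b: "b > 0" by (simp add: b_def)
  have "ln (r / b) \<le> r / b - 1" using r b by (intro ln_le_minus_one) auto
  then have "b * ln (r / b) \<le> b * (r / b - 1)" using b by (intro mult_left_mono) auto
  then have "b * ln r \<le> b * ln b + r - b" using r b by (simp add: ln_div algebra_simps)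
  moreover have "b * ln b - real n \<le> ln (fact n)" unfolding b_def by (rule ln_fact_lower)
  ultimately have le: "b * ln r - r - ln (fact n) \<le> 0" by (simp add: b_def)
  have "r ^ n * sqrt r = exp (b * ln r)"
  proof -
    have "r ^ n * sqrt r = r powr real n * r powr (1/2)" using r by (simp add: powr_realpow powr_half_sqrt)
    also have "\<dots> = r powr b" by (simp add: powr_add b_def)
    finally show ?thesis using r by (simp add: powr_def)
  qed
  then have "poisson r n * sqrt r = exp (- r) * exp (b * ln r) / fact n"
    by (simp add: poisson_def mult_ac)
  also have "\<dots> = exp (- r) * exp (b * ln r) * exp (- ln (fact n))"
    by (simp add: exp_minus divide_inverse)
  also have "\<dots> = exp (b * ln r - r - ln (fact n))"
    by (simp add: exp_add[symmetric])
  also have "\<dots> \<le> 1" using le by simp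
  finally show ?thesis .
qed

lemma poisson_le_at_mode:
  assumes r: "r > 0" and n: "n \<ge> 1" shows "poisson r n \<le> poisson (real n) n"
proof -
  define m where "m = real n"
  have m: "m > 0" using n by (simp add: m_def)
  have "ln (r / m) \<le> r / m - 1" using r m by (intro ln_le_minus_one) auto
  then have "m * ln (r / m) \<le> m * (r / m - 1)" using m by (intro mult_left_mono) auto
  then have "m * ln r - r \<le> m * ln m - m" using r m by (simp add: ln_div algebra_simps)
  then have "exp (m * ln r - r) \<le> exp (m * ln m - m)" by simp
  moreover have "exp (m * ln x - x) = exp (- x) * x ^ n" if "x > 0" for x
    using that by (simp add: m_def exp_diff exp_minus exp_of_nat_mult divide_inverse)
  ultimately have "exp (- r) * r ^ n \<le> exp (- m) * m ^ n" using r m by simp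
  then show ?thesis unfolding poisson_def m_def by (rule divide_right_mono) simp
qed

lemma poisson_le_sqrt_index:
  assumes r: "r > 0" and n: "n \<ge> 1" shows "poisson r n \<le> 1 / sqrt (real n)"
proof -
  have "poisson (real n) n * sqrt (real n) \<le> 1" using n by (intro poisson_le_sqrt) auto
  then have "poisson (real n) n \<le> 1 / sqrt (real n)" using n by (simp add: field_simps)
  then show ?thesis using poisson_le_at_mode[OF r n] by linarith
qed

lemma poisson_increasing:
  assumes r: "r > 0" and "real (n + i) \<le> r" shows "poisson r n \<le> poisson r (n + i)"
  using assms(2)
proof (induction i)
  case (Suc i)
  then have "r / real (Suc (n + i)) \<ge> 1" by (simp add: le_divide_eq)
  then have "poisson r (n + i) * 1 \<le> poisson r (n + i) * (r / real (Suc (n + i)))"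
    using r by (intro mult_left_mono poisson_nonneg) auto
  then show ?case using Suc by (simp add: poisson_Suc)
qed simp

lemma poisson_decreasing:
  assumes r: "r > 0" and "real n \<ge> r" shows "poisson r (n + i) \<le> poisson r n"
proof (induction i)
  case (Suc i)
  have "r / real (Suc (n + i)) \<le> 1" using assms by (simp add: divide_le_eq)
  then have "poisson r (n + i) * (r / real (Suc (n + i))) \<le> poisson r (n + i) * 1"
    using r by (intro mult_left_mono poisson_nonneg) auto
  then show ?case using Suc by (simp add: poisson_Suc)
qed simp

definition separated :: "nat \<Rightarrow> nat set \<Rightarrow> bool" where
  "separated G S \<longleftrightarrow> (\<forall>m\<in>S. \<forall>n\<in>S. m < n \<longrightarrow> m + G \<le> n)"

lemma separated_shift: "separated G S \<Longrightarrow> separated G ((+) d ` S)"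
  by (auto simp: separated_def)

text \<open>Each weight on \<open>S\<close> is dominated by the weights along a window of length \<open>G\<close> that starts, or ends, at the point. The windows are
disjoint because \<open>S\<close> is separated, and the total mass is 1.\<close>

lemma sum_windows_le:
  assumes G: "G \<ge> 1" and S: "finite S" "separated G S" and r: "r > 0"
    and w: "\<And>n i. n \<in> S \<Longrightarrow> i < G \<Longrightarrow> poisson r n \<le> poisson r (f n i)"
    and f: "\<And>n i. n \<in> S \<Longrightarrow> i < G \<Longrightarrow> f n i = n + i \<or> f n i + i = n"
    and same: "(\<forall>n\<in>S. \<forall>i<G. f n i = n + i) \<or> (\<forall>n\<in>S. \<forall>i<G. f n i + i = n)"
  shows "(\<Sum>n\<in>S. poisson r n) \<le> 1 / real G"
proof -
  have inj: "inj_on (\<lambda>(n, i). f n i) (S \<times> {..<G})"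
  proof (rule inj_onI, clarify)
    fix n i n' i' assume *: "n \<in> S" "i < G" "n' \<in> S" "i' < G" "f n i = f n' i'"
    have "n + G \<le> n' \<or> n' + G \<le> n \<or> n = n'"
      using S(2) *(1,3) unfolding separated_def by (metis linorder_neqE_nat)
    moreover have "n + i = n' + i' \<or> n + i' = n' + i"
      using same * by (metis add.assoc add.commute)
    ultimately show "n = n' \<and> i = i'" using * by auto
  qed
  have "real G * (\<Sum>n\<in>S. poisson r n) = (\<Sum>n\<in>S. \<Sum>i<G. poisson r n)" by (simp add: sum_distrib_left)
  also have "\<dots> \<le> (\<Sum>n\<in>S. \<Sum>i<G. poisson r (f n i))" using w by (intro sum_mono) auto
  also have "\<dots> = (\<Sum>p\<in>S \<times> {..<G}. poisson r ((\<lambda>(n, i). f n i) p))" by (simp add: sum.cartesian_product case_prod_unfold)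
  also have "\<dots> = sum (poisson r) ((\<lambda>(n, i). f n i) ` (S \<times> {..<G}))" by (simp add: sum.reindex[OF inj])
  also have "\<dots> \<le> 1" using S r by (intro sum_poisson_le) auto
  finally show ?thesis using G by (simp add: field_simps)
qed

text \<open>The weights increase up to the index \<open>r\<close> and decrease afterwards. A point at distance at least \<open>G\<close> from \<open>r\<close> is therefore dominated
by the window on the side of \<open>r\<close>. At most two points are closer to \<open>r\<close>, and each weight at an index \<open>n \<ge> G\<close> is at most \<open>1 / sqrt G\<close>.\<close>

lemma sum_poisson_separated:
  assumes G: "G \<ge> 1" and S: "finite S" "separated G S" "\<And>n. n \<in> S \<Longrightarrow> G \<le> n" and r: "r > 0"
  shows "(\<Sum>n\<in>S. poisson r n) \<le> 4 / sqrt (real G)"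
proof -
  \<comment> \<open>far to the left of \<open>r\<close>, far to the right of \<open>r\<close>, near \<open>r\<close>\<close>
  define S1 where "S1 = {n\<in>S. real (n + G) \<le> r}"
  define S2 where "S2 = {n\<in>S. real n \<ge> r + real G}"
  define S3 where "S3 = {n\<in>S. r < real (n + G) \<and> real n < r + real G}"
  have S_eq: "S = S1 \<union> (S2 \<union> S3)" by (auto simp: S1_def S2_def S3_def)
  have dis: "S1 \<inter> (S2 \<union> S3) = {}" "S2 \<inter> S3 = {}" using G by (auto simp: S1_def S2_def S3_def)
  have fin: "finite S1" "finite S2" "finite S3" using S by (auto simp: S1_def S2_def S3_def)
  have sep: "separated G S1" "separated G S2" using S(2) by (auto simp: S1_def S2_def separated_def)
  have g: "1 / real G \<le> 1 / sqrt (real G)"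
  proof -
    have "sqrt (real G) \<le> sqrt (real G * real G)" using G by (intro real_sqrt_le_mono) auto
    also have "\<dots> = real G" by simp
    finally show ?thesis using G by (intro divide_left_mono) auto
  qed
  have 1: "(\<Sum>n\<in>S1. poisson r n) \<le> 1 / real G"
    by (rule sum_windows_le[OF G fin(1) sep(1) r, of "\<lambda>n i. n + i"])
       (auto simp: S1_def intro!: poisson_increasing[OF r])
  have 2: "(\<Sum>n\<in>S2. poisson r n) \<le> 1 / real G"
  proof (rule sum_windows_le[OF G fin(2) sep(2) r, of "\<lambda>n i. n - i"])
    fix n i assume n: "n \<in> S2" "i < G"
    then have "n - i + i = n" "real (n - i) \<ge> r" using S(3)[of n] by (auto simp: S2_def)
    then show "poisson r n \<le> poisson r (n - i)" using poisson_decreasing[OF r, of "n - i" i] by simp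
  qed (use S(3) in \<open>fastforce simp: S2_def\<close>)+
  have 3: "(\<Sum>n\<in>S3. poisson r n) \<le> 2 / sqrt (real G)"
  proof -
    have "card S3 \<le> 2"
    proof (cases "S3 = {}")
      case False
      define a where "a = Min S3"
      define b where "b = Max S3"
      have ab: "a \<in> S3" "b \<in> S3" using False fin by (auto simp: a_def b_def)
      have "S3 \<subseteq> {a, b}"
      proof
        fix c assume c: "c \<in> S3"
        show "c \<in> {a, b}"
        proof (rule ccontr)
          assume "c \<notin> {a, b}"
          then have "a < c" "c < b" using c fin by (auto simp: a_def b_def order_less_le)
          then have "a + G \<le> c" "c + G \<le> b" using S(2) ab c by (auto simp: S3_def separated_def)
          then show False using ab by (auto simp: S3_def)
        qed
      qed
      then have "card S3 \<le> card {a, b}" by (intro card_mono) auto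
      also have "\<dots> \<le> 2" by (simp add: card_insert_if)
      finally show ?thesis .
    qed simp
    moreover have "poisson r n \<le> 1 / sqrt (real G)" if "n \<in> S3" for n
    proof -
      have n: "G \<le> n" using that S(3) by (auto simp: S3_def)
      have "poisson r n \<le> 1 / sqrt (real n)" using n G r by (intro poisson_le_sqrt_index) auto
      also have "\<dots> \<le> 1 / sqrt (real G)" using n G by (intro divide_left_mono) auto
      finally show ?thesis .
    qed
    then have "(\<Sum>n\<in>S3. poisson r n) \<le> real (card S3) * (1 / sqrt (real G))"
      by (rule sum_bounded_above)
    ultimately show ?thesis
      by (elim order_trans) (use G in \<open>auto simp: divide_right_mono\<close>)
  qed
  have "(\<Sum>n\<in>S. poisson r n) = (\<Sum>n\<in>S1. poisson r n) + ((\<Sum>n\<in>S2. poisson r n) + (\<Sum>n\<in>S3. poisson r n))"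
    unfolding S_eq using fin dis by (simp add: sum.union_disjoint)
  moreover have "1 / sqrt (real G) + (1 / sqrt (real G) + 2 / sqrt (real G)) = 4 / sqrt (real G)" by (simp add: add_divide_distrib[symmetric])
  ultimately show ?thesis using 1 2 3 g by linarith
qed

text \<open>The summand is \<open>exp (2r) r^(-p)\<close> times the product of the weights at \<open>n\<close> and at \<open>n + p\<close>, and the latter is at most \<open>r^(-1/2)\<close>.\<close>

lemma sum_weights_separated:
  assumes G: "G \<ge> 1" and S: "finite S" "separated G S" "\<And>n. n \<in> S \<Longrightarrow> G \<le> n" and r: "r > 0"
  shows "(\<Sum>n\<in>S. r ^ (2 * n) / (fact n * fact (n + p))) \<le> 4 / sqrt (real G) * (exp (2 * r) / r powr (real p + 1 / 2))"
proof -
  have "r ^ (2 * n) / (fact n * fact (n + p)) \<le> poisson r n * (exp (2 * r) / r powr (real p + 1 / 2))" for n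
  proof -
    have "r ^ (2 * n) / (fact n * fact (n + p)) = poisson r n * (exp (2 * r) / r ^ p) * poisson r (n + p)"
    proof -
      have "exp (- r) * exp (- r) * exp (2 * r) = 1" by (simp add: exp_add[symmetric])
      moreover have "r ^ p / r ^ p = 1" using r by simp
      moreover have "r ^ (2 * n) = r ^ n * r ^ n" by (simp add: mult_2 power_add)
      moreover have "poisson r n * (exp (2 * r) / r ^ p) * poisson r (n + p) =
          (exp (- r) * exp (- r) * exp (2 * r)) * (r ^ n * r ^ n) * (r ^ p / r ^ p) / (fact n * fact (n + p))"
        unfolding poisson_def power_add by (simp only: times_divide_eq_right times_divide_eq_left divide_divide_eq_left mult_ac)
      ultimately show ?thesis by simp
    qed
    also have "\<dots> \<le> poisson r n * (exp (2 * r) / r ^ p) * (1 / sqrt r)"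
    proof (rule mult_left_mono)
      show "poisson r (n + p) \<le> 1 / sqrt r" using poisson_le_sqrt[OF r, of "n + p"] r by (simp add: pos_le_divide_eq)
    qed (use r poisson_nonneg[of r n] in auto)
    also have "\<dots> = poisson r n * (exp (2 * r) / r powr (real p + 1 / 2))"
      using r by (simp add: powr_add powr_realpow powr_half_sqrt)
    finally show ?thesis .
  qed
  then have "(\<Sum>n\<in>S. r ^ (2 * n) / (fact n * fact (n + p))) \<le> (\<Sum>n\<in>S. poisson r n * (exp (2 * r) / r powr (real p + 1 / 2)))"
    by (rule sum_mono)
  also have "\<dots> = (\<Sum>n\<in>S. poisson r n) * (exp (2 * r) / r powr (real p + 1 / 2))"
    by (rule sum_distrib_right[symmetric])
  also have "\<dots> \<le> 4 / sqrt (real G) * (exp (2 * r) / r powr (real p + 1 / 2))"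
    using sum_poisson_separated[OF G S r] r by (intro mult_right_mono) auto
  finally show ?thesis .
qed

section \<open>Admissible sequences of antiderivatives\<close>

text \<open>The power of \<open>r\<close> is the square of the one aimed at. The decay in \<open>G\<close> lets a block of terms be made small by spreading it out.\<close>

definition mean_square_growth :: "(nat \<Rightarrow> real ^ 'n \<Rightarrow> real) \<Rightarrow> real \<Rightarrow> bool" where
  "mean_square_growth Q K \<longleftrightarrow> (\<forall>\<sigma> r G S. sphere_invariant \<sigma> \<longrightarrow> measure \<sigma> UNIV = 1 \<longrightarrow> r > 0 \<longrightarrow> G \<ge> 1 \<longrightarrow>
     finite S \<longrightarrow> separated G S \<longrightarrow> (\<forall>n\<in>S. G \<le> n) \<longrightarrow>
     (\<integral>x. (\<Sum>n\<in>S. Q n (r *\<^sub>R x))\<^sup>2 \<partial>\<sigma>) \<le> K / sqrt (real G) * (exp (2 * r) / r powr (real CARD('n) - 3 / 2)))"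

lemma mean_square_growthD:
  fixes Q :: "nat \<Rightarrow> real ^ 'n \<Rightarrow> real"
  assumes "mean_square_growth Q K" "sphere_invariant \<sigma>" "measure \<sigma> UNIV = 1" "r > 0" "G \<ge> 1"
    "finite S" "separated G S" "\<And>n. n \<in> S \<Longrightarrow> G \<le> n"
  shows "(\<integral>x. (\<Sum>n\<in>S. Q n (r *\<^sub>R x))\<^sup>2 \<partial>\<sigma>) \<le> K / sqrt (real G) * (exp (2 * r) / r powr (real CARD('n) - 3 / 2))"
  using assms unfolding mean_square_growth_def by simp

definition factorial_decay :: "(nat \<Rightarrow> real ^ 'n \<Rightarrow> real) \<Rightarrow> bool" where
  "factorial_decay Q \<longleftrightarrow> (\<forall>\<rho>. \<exists>M B. M \<ge> 0 \<and> B \<ge> 1 \<and> (\<forall>n. c2_bound \<rho> (Q n) (M * B ^ n / fact n)))"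

text \<open>What the construction requires of the antiderivatives of one target \<open>Q 0\<close>. All conditions are stable under linear combinations
and under passing to the sequence that starts with \<open>Q 1\<close>.\<close>

definition admissible :: "'n \<Rightarrow> (nat \<Rightarrow> real ^ 'n \<Rightarrow> real) \<Rightarrow> bool" where
  "admissible k Q \<longleftrightarrow> (\<forall>n. poly_fun (Q n) \<and> laplacian (Q n) = (\<lambda>x. 0)) \<and> (\<forall>n. partial k (Q (Suc n)) = Q n) \<and>
     (\<exists>m. (partial k ^^ m) (Q 0) = (\<lambda>x. 0)) \<and> factorial_decay Q \<and> (\<exists>K\<ge>0. mean_square_growth Q K)"

lemma admissibleD:
  assumes "admissible k Q"
  shows "poly_fun (Q n)" "laplacian (Q n) = (\<lambda>x. 0)" "partial k (Q (Suc n)) = Q n"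
    "\<exists>m. (partial k ^^ m) (Q 0) = (\<lambda>x. 0)" "factorial_decay Q" "\<exists>K\<ge>0. mean_square_growth Q K"
  using assms by (auto simp: admissible_def)

lemma poly_fun_partial_pow: "poly_fun F \<Longrightarrow> poly_fun ((partial k ^^ m) F)"
  by (induction m) auto

lemma partial_pow_zero: "(partial k ^^ m) (\<lambda>x. 0) = (\<lambda>x. 0)"
  by (induction m) auto

lemma partial_pow_add:
  assumes "poly_fun F" "poly_fun G"
  shows "(partial k ^^ m) (\<lambda>x. F x + G x) = (\<lambda>x. (partial k ^^ m) F x + (partial k ^^ m) G x)"
  by (induction m) (simp_all add: partial_add poly_fun_partial_pow assms)

lemma partial_pow_cmult:
  assumes "poly_fun F"
  shows "(partial k ^^ m) (\<lambda>x. c * F x) = (\<lambda>x. c * (partial k ^^ m) F x)"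
  by (induction m) (simp_all add: partial_cmult poly_fun_partial_pow assms)

lemma continuous_scaled_sum:
  assumes "\<And>n. poly_fun (Q n)"
  shows "continuous_on UNIV (\<lambda>x :: real ^ 'n. (\<Sum>n\<in>S. Q n (r *\<^sub>R x)))"
proof (intro continuous_on_sum)
  fix n
  show "continuous_on UNIV (\<lambda>x :: real ^ 'n. Q n (r *\<^sub>R x))"
    by (rule continuous_on_compose2[of UNIV "Q n"]) (auto intro!: poly_fun_continuous assms continuous_intros)
qed

text \<open>The mean square bound for the sum rests on \<open>(u + v)\<^sup>2 \<le> 2u\<^sup>2 + 2v\<^sup>2\<close>.\<close>

lemma admissible_add:
  fixes Q R :: "nat \<Rightarrow> real ^ 'n \<Rightarrow> real"
  assumes Q: "admissible k Q" and R: "admissible k R"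
  shows "admissible k (\<lambda>n x. Q n x + R n x)"
  unfolding admissible_def
proof (intro conjI allI)
  fix n
  note q = admissibleD[OF Q] and r = admissibleD[OF R]
  show "poly_fun (\<lambda>x. Q n x + R n x)" using q(1) r(1) by (rule poly_fun_add)
  show "laplacian (\<lambda>x. Q n x + R n x) = (\<lambda>x. 0)" using q(1,2)[of n] r(1,2)[of n] by (simp add: laplacian_add)
  show "partial k (\<lambda>x. Q (Suc n) x + R (Suc n) x) = (\<lambda>x. Q n x + R n x)"
    using q(1,3) r(1,3) by (simp add: partial_add)
next
  note q = admissibleD[OF Q] and r = admissibleD[OF R]
  obtain m1 m2 where "(partial k ^^ m1) (Q 0) = (\<lambda>x. 0)" "(partial k ^^ m2) (R 0) = (\<lambda>x. 0)"
    using q(4) r(4) by blast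
  then have "(partial k ^^ (m1 + m2)) (R 0) = (\<lambda>x. 0)" "(partial k ^^ (m1 + m2)) (Q 0) = (\<lambda>x. 0)"
    by (simp add: funpow_add partial_pow_zero) (simp add: add.commute[of m1] funpow_add partial_pow_zero \<open>(partial k ^^ m1) (Q 0) = (\<lambda>x. 0)\<close>)
  then have "(partial k ^^ (m1 + m2)) (\<lambda>x. Q 0 x + R 0 x) = (\<lambda>x. 0)"
    using q(1) r(1) by (simp add: partial_pow_add)
  then show "\<exists>m. (partial k ^^ m) (\<lambda>x. Q 0 x + R 0 x) = (\<lambda>x. 0)" by blast
  show "factorial_decay (\<lambda>n x. Q n x + R n x)" unfolding factorial_decay_def
  proof
    fix \<rho>
    obtain M B where MB: "M \<ge> 0" "B \<ge> 1" "\<And>n. c2_bound \<rho> (Q n) (M * B ^ n / fact n)"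
      using q(5) unfolding factorial_decay_def by blast
    obtain M' B' where MB': "M' \<ge> 0" "B' \<ge> 1" "\<And>n. c2_bound \<rho> (R n) (M' * B' ^ n / fact n)"
      using r(5) unfolding factorial_decay_def by blast
    have "c2_bound \<rho> (\<lambda>x. Q n x + R n x) ((M + M') * max B B' ^ n / fact n)" for n
    proof (rule c2_bound_mono[OF c2_bound_add[OF q(1) r(1) MB(3) MB'(3)] order_refl])
      have "M * B ^ n \<le> M * max B B' ^ n" "M' * B' ^ n \<le> M' * max B B' ^ n"
        using MB MB' by (auto intro!: mult_left_mono power_mono)
      then show "M * B ^ n / fact n + M' * B' ^ n / fact n \<le> (M + M') * max B B' ^ n / fact n"
        unfolding add_divide_distrib[symmetric] distrib_right by (intro divide_right_mono add_mono) auto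
    qed
    then show "\<exists>M B. M \<ge> 0 \<and> B \<ge> 1 \<and> (\<forall>n. c2_bound \<rho> (\<lambda>x. Q n x + R n x) (M * B ^ n / fact n))"
      using MB MB' by (intro exI[of _ "M + M'"] exI[of _ "max B B'"]) auto
  qed
  obtain K where K: "K \<ge> 0" "mean_square_growth Q K" using q(6) by blast
  obtain L where L: "L \<ge> 0" "mean_square_growth R L" using r(6) by blast
  have "mean_square_growth (\<lambda>n x. Q n x + R n x) (2 * K + 2 * L)"
    unfolding mean_square_growth_def
  proof (intro allI impI)
    fix \<sigma> :: "(real ^ 'n) measure" and r :: real and G :: nat and S :: "nat set"
    assume *: "sphere_invariant \<sigma>" "measure \<sigma> UNIV = 1" "r > 0" "G \<ge> 1" "finite S" "separated G S" "\<forall>n\<in>S. G \<le> n"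
    let ?X = "exp (2 * r) / r powr (real CARD('n) - 3 / 2)"
    let ?q = "\<lambda>x. \<Sum>n\<in>S. Q n (r *\<^sub>R x)" and ?r = "\<lambda>x. \<Sum>n\<in>S. R n (r *\<^sub>R x)"
    have iq: "integrable \<sigma> (\<lambda>x. 2 * (?q x)\<^sup>2)" and ir: "integrable \<sigma> (\<lambda>x. 2 * (?r x)\<^sup>2)"
      by (intro integrable_sphere * continuous_intros continuous_scaled_sum q r admissibleD(1)[OF Q] admissibleD(1)[OF R])+
    have "(\<integral>x. (\<Sum>n\<in>S. Q n (r *\<^sub>R x) + R n (r *\<^sub>R x))\<^sup>2 \<partial>\<sigma>) \<le> (\<integral>x. 2 * (?q x)\<^sup>2 + 2 * (?r x)\<^sup>2 \<partial>\<sigma>)"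
    proof (rule integral_mono)
      show "integrable \<sigma> (\<lambda>x. (\<Sum>n\<in>S. Q n (r *\<^sub>R x) + R n (r *\<^sub>R x))\<^sup>2)"
        unfolding sum.distrib
        by (intro integrable_sphere * continuous_intros continuous_scaled_sum admissibleD(1)[OF Q] admissibleD(1)[OF R])
      show "integrable \<sigma> (\<lambda>x. 2 * (?q x)\<^sup>2 + 2 * (?r x)\<^sup>2)" using iq ir by simp
      fix x
      have "(u + v)\<^sup>2 \<le> 2 * u\<^sup>2 + 2 * v\<^sup>2" for u v :: real
        using zero_le_power2[of "u - v"] by (simp add: power2_eq_square algebra_simps)
      then show "(\<Sum>n\<in>S. Q n (r *\<^sub>R x) + R n (r *\<^sub>R x))\<^sup>2 \<le> 2 * (?q x)\<^sup>2 + 2 * (?r x)\<^sup>2"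
        by (simp add: sum.distrib)
    qed
    also have "\<dots> = 2 * (\<integral>x. (?q x)\<^sup>2 \<partial>\<sigma>) + 2 * (\<integral>x. (?r x)\<^sup>2 \<partial>\<sigma>)"
      using iq ir by simp
    also have "\<dots> \<le> 2 * (K / sqrt (real G) * ?X) + 2 * (L / sqrt (real G) * ?X)"
      using * by (intro add_mono mult_left_mono mean_square_growthD K L) auto
    also have "\<dots> = (2 * K + 2 * L) / sqrt (real G) * ?X" by (simp add: add_divide_distrib algebra_simps)
    finally show "(\<integral>x. (\<Sum>n\<in>S. Q n (r *\<^sub>R x) + R n (r *\<^sub>R x))\<^sup>2 \<partial>\<sigma>) \<le> (2 * K + 2 * L) / sqrt (real G) * ?X" .
  qed
  then show "\<exists>K\<ge>0. mean_square_growth (\<lambda>n x. Q n x + R n x) K" using K L by (intro exI[of _ "2 * K + 2 * L"]) auto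
qed

lemma admissible_cmult:
  fixes Q :: "nat \<Rightarrow> real ^ 'n \<Rightarrow> real"
  assumes Q: "admissible k Q"
  shows "admissible k (\<lambda>n x. c * Q n x)"
  unfolding admissible_def
proof (intro conjI allI)
  note q = admissibleD[OF Q]
  fix n
  show "poly_fun (\<lambda>x. c * Q n x)" using q(1) by (rule poly_fun_cmult)
  show "laplacian (\<lambda>x. c * Q n x) = (\<lambda>x. 0)" using q(1,2)[of n] by (simp add: laplacian_cmult)
  show "partial k (\<lambda>x. c * Q (Suc n) x) = (\<lambda>x. c * Q n x)" using q(1,3) by (simp add: partial_cmult)
next
  note q = admissibleD[OF Q]
  obtain m where "(partial k ^^ m) (Q 0) = (\<lambda>x. 0)" using q(4) by blast
  then have "(partial k ^^ m) (\<lambda>x. c * Q 0 x) = (\<lambda>x. 0)" by (simp add: partial_pow_cmult q(1))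
  then show "\<exists>m. (partial k ^^ m) (\<lambda>x. c * Q 0 x) = (\<lambda>x. 0)" by blast
  show "factorial_decay (\<lambda>n x. c * Q n x)" unfolding factorial_decay_def
  proof
    fix \<rho>
    obtain M B where MB: "M \<ge> 0" "B \<ge> 1" "\<And>n. c2_bound \<rho> (Q n) (M * B ^ n / fact n)"
      using q(5) unfolding factorial_decay_def by blast
    have "c2_bound \<rho> (\<lambda>x. c * Q n x) ((\<bar>c\<bar> * M) * B ^ n / fact n)" for n
      using c2_bound_cmult[OF q(1) MB(3), of c n] by (simp add: mult.assoc)
    then show "\<exists>M B. M \<ge> 0 \<and> B \<ge> 1 \<and> (\<forall>n. c2_bound \<rho> (\<lambda>x. c * Q n x) (M * B ^ n / fact n))"
      using MB by (intro exI[of _ "\<bar>c\<bar> * M"] exI[of _ B]) auto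
  qed
  obtain K where K: "K \<ge> 0" "mean_square_growth Q K" using q(6) by blast
  have "mean_square_growth (\<lambda>n x. c * Q n x) (c\<^sup>2 * K)"
    unfolding mean_square_growth_def
  proof (intro allI impI)
    fix \<sigma> :: "(real ^ 'n) measure" and r :: real and G :: nat and S :: "nat set"
    assume *: "sphere_invariant \<sigma>" "measure \<sigma> UNIV = 1" "r > 0" "G \<ge> 1" "finite S" "separated G S" "\<forall>n\<in>S. G \<le> n"
    let ?X = "exp (2 * r) / r powr (real CARD('n) - 3 / 2)"
    have "(\<integral>x. (\<Sum>n\<in>S. c * Q n (r *\<^sub>R x))\<^sup>2 \<partial>\<sigma>) = c\<^sup>2 * (\<integral>x. (\<Sum>n\<in>S. Q n (r *\<^sub>R x))\<^sup>2 \<partial>\<sigma>)"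
      by (simp add: sum_distrib_left[symmetric] power_mult_distrib)
    also have "\<dots> \<le> c\<^sup>2 * (K / sqrt (real G) * ?X)"
      using * by (intro mult_left_mono mean_square_growthD K) auto
    finally show "(\<integral>x. (\<Sum>n\<in>S. c * Q n (r *\<^sub>R x))\<^sup>2 \<partial>\<sigma>) \<le> c\<^sup>2 * K / sqrt (real G) * ?X" by simp
  qed
  then show "\<exists>K\<ge>0. mean_square_growth (\<lambda>n x. c * Q n x) K" using K by (intro exI[of _ "c\<^sup>2 * K"]) auto
qed

text \<open>A separated set stays separated when moved by one, and derivatives of \<open>Q 1\<close> are derivatives of \<open>Q 0\<close> delayed by one step.\<close>

lemma admissible_shift:
  fixes Q :: "nat \<Rightarrow> real ^ 'n \<Rightarrow> real"
  assumes Q: "admissible k Q"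
  shows "admissible k (\<lambda>n. Q (Suc n))"
  unfolding admissible_def
proof (intro conjI allI)
  note q = admissibleD[OF Q]
  show "poly_fun (Q (Suc n))" "laplacian (Q (Suc n)) = (\<lambda>x. 0)" "partial k (Q (Suc (Suc n))) = Q (Suc n)" for n
    using q by auto
  obtain m where m: "(partial k ^^ m) (Q 0) = (\<lambda>x. 0)" using q(4) by blast
  have "(partial k ^^ Suc m) (Q (Suc 0)) = (\<lambda>x. 0)"
    using m by (simp only: funpow_Suc_right o_apply q(3))
  then show "\<exists>m. (partial k ^^ m) (Q (Suc 0)) = (\<lambda>x. 0)" by blast
  show "factorial_decay (\<lambda>n. Q (Suc n))" unfolding factorial_decay_def
  proof
    fix \<rho>
    obtain M B where MB: "M \<ge> 0" "B \<ge> 1" "\<And>n. c2_bound \<rho> (Q n) (M * B ^ n / fact n)"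
      using q(5) unfolding factorial_decay_def by blast
    have "c2_bound \<rho> (Q (Suc n)) ((M * B) * B ^ n / fact n)" for n
    proof (rule c2_bound_mono[OF MB(3) order_refl])
      have "M * B ^ Suc n / fact (Suc n) \<le> M * B ^ Suc n / fact n"
        using MB by (intro divide_left_mono fact_mono) auto
      then show "M * B ^ Suc n / fact (Suc n) \<le> (M * B) * B ^ n / fact n" by (simp add: mult_ac)
    qed
    then show "\<exists>M B. M \<ge> 0 \<and> B \<ge> 1 \<and> (\<forall>n. c2_bound \<rho> (Q (Suc n)) (M * B ^ n / fact n))"
      using MB by (intro exI[of _ "M * B"] exI[of _ B]) auto
  qed
  obtain K where K: "K \<ge> 0" "mean_square_growth Q K" using q(6) by blast
  have "mean_square_growth (\<lambda>n. Q (Suc n)) K"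
    unfolding mean_square_growth_def
  proof (intro allI impI)
    fix \<sigma> :: "(real ^ 'n) measure" and r :: real and G :: nat and S :: "nat set"
    assume *: "sphere_invariant \<sigma>" "measure \<sigma> UNIV = 1" "r > 0" "G \<ge> 1" "finite S" "separated G S" "\<forall>n\<in>S. G \<le> n"
    have "(\<Sum>n\<in>S. Q (Suc n) x) = (\<Sum>n\<in>(+) 1 ` S. Q n x)" for x by (simp add: sum.reindex)
    then show "(\<integral>x. (\<Sum>n\<in>S. Q (Suc n) (r *\<^sub>R x))\<^sup>2 \<partial>\<sigma>) \<le> K / sqrt (real G) * (exp (2 * r) / r powr (real CARD('n) - 3 / 2))"
      using mean_square_growthD[OF K(2) *(1-4), of "(+) 1 ` S"] * separated_shift[of G S 1] by force
  qed
  then show "\<exists>K\<ge>0. mean_square_growth (\<lambda>n. Q (Suc n)) K" using K by blast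
qed

text \<open>By orthogonality the mean square of a block is the sum of the terms \<open>r^(2(s+n)) \<integral> (Q n)\<^sup>2\<close>, which \<open>Q_mean_square\<close> and
\<open>sum_weights_separated\<close> bound, the latter for the block moved by \<open>s\<close>.\<close>

lemma (in primitives) Q_admissible: "admissible k Q"
  unfolding admissible_def
proof (intro conjI allI)
  show "poly_fun (Q n)" "laplacian (Q n) = (\<lambda>x. 0)" for n using solid_harmonicD[OF Q_solid] by auto
  show "partial k (Q (Suc n)) = Q n" for n by (rule partial_Q)
  have "(partial k ^^ 1) (Q 0) = (\<lambda>x. 0)" using U0 by simp
  then show "\<exists>m. (partial k ^^ m) (Q 0) = (\<lambda>x. 0)" by blast
  show "factorial_decay Q" unfolding factorial_decay_def using Q_c2_bound by blast
  let ?p = "CARD('n) - 2"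
  obtain K where K: "K \<ge> 0" "\<And>\<sigma> n. sphere_invariant \<sigma> \<Longrightarrow> measure \<sigma> UNIV = 1 \<Longrightarrow>
     (\<integral>x. (Q n x)\<^sup>2 \<partial>\<sigma>) \<le> K / (fact (s + n) * fact (s + n + ?p))"
    using Q_mean_square by blast
  have "mean_square_growth Q (4 * K)"
    unfolding mean_square_growth_def
  proof (intro allI impI)
    fix \<sigma> :: "(real ^ 'n) measure" and r :: real and G :: nat and S :: "nat set"
    assume *: "sphere_invariant \<sigma>" "measure \<sigma> UNIV = 1" "r > 0" "G \<ge> 1" "finite S" "separated G S" "\<forall>n\<in>S. G \<le> n"
    have i1: "integrable \<sigma> F" if "poly_fun F" for F :: "real ^ 'n \<Rightarrow> real" using integrable_sphere[OF *(1)] that by blast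
    have hom: "Q n (r *\<^sub>R x) = r ^ (s + n) * Q n x" for n x
      using solid_harmonicD(2)[OF Q_solid] * by (auto simp: homogeneous_def)
    let ?c = "\<lambda>n m. r ^ (s + n) * r ^ (s + m)"
    have "(\<integral>x. (\<Sum>n\<in>S. Q n (r *\<^sub>R x))\<^sup>2 \<partial>\<sigma>) = (\<integral>x. (\<Sum>n\<in>S. \<Sum>m\<in>S. ?c n m * (Q n x * Q m x)) \<partial>\<sigma>)"
      unfolding hom power2_eq_square sum_product by (simp add: mult_ac)
    also have "\<dots> = (\<Sum>n\<in>S. \<Sum>m\<in>S. ?c n m * (\<integral>x. Q n x * Q m x \<partial>\<sigma>))"
      using Q_poly by (subst Bochner_Integration.integral_sum, force intro!: i1 real_polynomial_function_sum poly_fun_cmult poly_fun_mult simp: *)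
        (subst Bochner_Integration.integral_sum, auto intro!: i1 poly_fun_cmult poly_fun_mult)
    also have "\<dots> = (\<Sum>n\<in>S. r ^ (2 * (s + n)) * (\<integral>x. (Q n x)\<^sup>2 \<partial>\<sigma>))"
    proof (intro sum.cong refl)
      fix n assume n: "n \<in> S"
      have "(\<Sum>m\<in>S. ?c n m * (\<integral>x. Q n x * Q m x \<partial>\<sigma>)) = (\<Sum>m\<in>S. if m = n then ?c n n * (\<integral>x. Q n x * Q n x \<partial>\<sigma>) else 0)"
      proof (intro sum.cong refl)
        fix m
        show "?c n m * (\<integral>x. Q n x * Q m x \<partial>\<sigma>) = (if m = n then ?c n n * (\<integral>x. Q n x * Q n x \<partial>\<sigma>) else 0)"
        proof (cases "m = n")
          case False
          then have "(\<integral>x. Q n x * Q m x \<partial>\<sigma>) = 0"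
            by (intro solid_harmonic_orthogonal[OF *(1) Q_solid Q_solid _ N]) auto
          with False show ?thesis by simp
        qed simp
      qed
      then show "(\<Sum>m\<in>S. ?c n m * (\<integral>x. Q n x * Q m x \<partial>\<sigma>)) = r ^ (2 * (s + n)) * (\<integral>x. (Q n x)\<^sup>2 \<partial>\<sigma>)"
        using n * by (simp add: power2_eq_square mult_2 power_add)
    qed
    also have "\<dots> \<le> (\<Sum>n\<in>S. r ^ (2 * (s + n)) * (K / (fact (s + n) * fact (s + n + ?p))))"
      using K(2)[OF *(1,2)] * by (intro sum_mono mult_left_mono) auto
    also have "\<dots> = K * (\<Sum>n\<in>(+) s ` S. r ^ (2 * n) / (fact n * fact (n + ?p)))"
      by (simp add: sum.reindex sum_distrib_left mult_ac)
    also have "\<dots> \<le> K * (4 / sqrt (real G) * (exp (2 * r) / r powr (real ?p + 1 / 2)))"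
      using * separated_shift[of G S s] K(1) by (intro mult_left_mono sum_weights_separated) auto
    also have "real ?p + 1 / 2 = real CARD('n) - 3 / 2" using N by simp
    finally show "(\<integral>x. (\<Sum>n\<in>S. Q n (r *\<^sub>R x))\<^sup>2 \<partial>\<sigma>) \<le> 4 * K / sqrt (real G) * (exp (2 * r) / r powr (real CARD('n) - 3 / 2))"
      by (simp add: mult_ac)
  qed
  then show "\<exists>K\<ge>0. mean_square_growth Q K" using K by (intro exI[of _ "4 * K"]) auto
qed

text \<open>If \<open>R\<close> is admissible for \<open>\<partial>_k P\<close>, then \<open>R 1\<close> is an antiderivative of \<open>\<partial>_k P\<close> like \<open>P\<close>, so \<open>U = P - R 1\<close> does not depend on the \<open>k\<close>-th variable.
Adding the antiderivatives of \<open>U\<close> to the shifted sequence \<open>R\<close> produces an admissible sequence for \<open>P\<close>.\<close>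

theorem admissible_exists:
  fixes P :: "real ^ 'n \<Rightarrow> real"
  assumes N: "CARD('n) \<ge> 2" and P: "solid_harmonic d P"
  shows "\<exists>Q. admissible k Q \<and> Q 0 = P \<and> (\<forall>n. solid_harmonic (d + n) (Q n))"
  using P
proof (induction d arbitrary: P)
  case 0
  interpret primitives k 0 P
    using N 0 solid_harmonic_partial_0 by unfold_locales auto
  show ?case using Q_admissible Q_solid by (intro exI[of _ Q]) auto
next
  case (Suc d)
  have "solid_harmonic d (partial k P)" using solid_harmonic_partial[OF Suc.prems] by simp
  then obtain R where R: "admissible k R" "R 0 = partial k P" "\<And>n. solid_harmonic (d + n) (R n)"
    using Suc.IH by blast
  define U where "U = (\<lambda>x. P x - R 1 x)"
  have R1: "solid_harmonic (Suc d) (R 1)" using R(3)[of 1] by simp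
  have "solid_harmonic (Suc d) U" unfolding U_def by (rule solid_harmonic_diff[OF Suc.prems R1])
  moreover have "partial k U = (\<lambda>x. 0)"
    unfolding U_def using admissibleD(3)[OF R(1), of 0] R(2) solid_harmonicD(1)[OF Suc.prems] solid_harmonicD(1)[OF R1]
    by (simp add: partial_diff)
  ultimately interpret primitives k "Suc d" U
    using N by unfold_locales auto
  have "admissible k (\<lambda>n x. Q n x + R (Suc n) x)"
    by (rule admissible_add[OF Q_admissible admissible_shift[OF R(1)]])
  moreover have "(\<lambda>x. Q 0 x + R (Suc 0) x) = P" by (simp add: U_def)
  moreover have "solid_harmonic (Suc d + n) (\<lambda>x. Q n x + R (Suc n) x)" for n
    using solid_harmonic_add[OF Q_solid[of n], of "R (Suc n)"] R(3)[of "Suc n"] by simp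
  ultimately show ?case by (intro exI[of _ "\<lambda>n x. Q n x + R (Suc n) x"]) auto
qed

section \<open>The maximum principle\<close>

lemma C1_deriv:
  assumes "C1 h"
  shows "((\<lambda>t. h (x + t *\<^sub>R axis i 1)) has_real_derivative partial i h (x + s *\<^sub>R axis i 1)) (at s)"
proof -
  let ?y = "x + s *\<^sub>R axis i 1"
  have "(\<lambda>t. h (?y + t *\<^sub>R axis i 1)) differentiable (at 0)"
    using assms by (simp add: C1_def)
  then have "((\<lambda>t. h (?y + t *\<^sub>R axis i 1)) has_real_derivative partial i h ?y) (at 0)"
    unfolding partial_def by (simp add: DERIV_deriv_iff_real_differentiable)
  then have "((\<lambda>t. h (?y + t *\<^sub>R axis i 1)) has_real_derivative partial i h ?y) (at (s - s))" by simp
  then have "((\<lambda>t. h (?y + (t - s) *\<^sub>R axis i 1)) has_real_derivative partial i h ?y * 1) (at s)"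
    by (rule DERIV_chain2) (auto intro!: derivative_eq_intros)
  moreover have "(\<lambda>t. h (?y + (t - s) *\<^sub>R axis i 1)) = (\<lambda>t. h (x + t *\<^sub>R axis i 1))"
    by (simp add: scaleR_left_diff_distrib)
  ultimately show ?thesis by simp
qed

lemma mean_value_from_0:
  fixes \<phi> \<psi> :: "real \<Rightarrow> real"
  assumes d: "\<And>t. (\<phi> has_real_derivative \<psi> t) (at t)"
  shows "\<exists>t. \<bar>t\<bar> \<le> \<bar>s\<bar> \<and> \<phi> s - \<phi> 0 = \<psi> t * s"
proof (cases s "0 :: real" rule: linorder_cases)
  case less
  obtain z where "s < z" "z < 0" "\<phi> 0 - \<phi> s = (0 - s) * \<psi> z" using MVT2[OF less d] by blast
  then show ?thesis using less by (intro exI[of _ z]) (auto simp: algebra_simps)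
next
  case greater
  obtain z where "0 < z" "z < s" "\<phi> s - \<phi> 0 = (s - 0) * \<psi> z" using MVT2[OF greater d] by blast
  then show ?thesis using greater by (intro exI[of _ z]) (auto simp: algebra_simps)
qed auto

text \<open>Moving from \<open>x\<close> to \<open>x + v\<close> one coordinate at a time, the mean value theorem bounds each step by a bound of a partial derivative.\<close>

lemma C1_continuous:
  fixes h :: "real ^ 'n \<Rightarrow> real"
  assumes h: "C1 h" shows "continuous_on UNIV h"
proof -
  have "isCont h x" for x
  proof -
    have "\<exists>B. \<forall>y\<in>cball x (real CARD('n)). \<bar>partial i h y\<bar> \<le> B" for i
    proof -
      have ci: "continuous_on UNIV (partial i h)" using h unfolding C1_def by blast
      have "compact (partial i h ` cball x (real CARD('n)))"
        by (intro compact_continuous_image continuous_on_subset[OF ci] compact_cball subset_UNIV)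
      then obtain B where "\<forall>z\<in>partial i h ` cball x (real CARD('n)). norm z \<le> B"
        unfolding compact_eq_bounded_closed bounded_iff by blast
      then show ?thesis by auto
    qed
    then have "\<forall>i. \<exists>B. \<forall>y\<in>cball x (real CARD('n)). \<bar>partial i h y\<bar> \<le> B" by blast
    then obtain B' where "\<forall>i. \<forall>y\<in>cball x (real CARD('n)). \<bar>partial i h y\<bar> \<le> B' i"
      by (rule choice[THEN exE])
    then obtain B where B: "\<And>i y. y \<in> cball x (real CARD('n)) \<Longrightarrow> \<bar>partial i h y\<bar> \<le> B i" by blast
    have step: "\<bar>h (x + (\<Sum>i\<in>I. v $ i *\<^sub>R axis i 1)) - h x\<bar> \<le> (\<Sum>i\<in>I. B i * \<bar>v $ i\<bar>)"
      if "finite I" "norm v \<le> 1" for I v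
      using that(1)
    proof (induction I rule: finite_induct)
      case (insert i I)
      let ?y = "x + (\<Sum>i\<in>I. v $ i *\<^sub>R axis i 1)"
      obtain t where t: "\<bar>t\<bar> \<le> \<bar>v $ i\<bar>"
        "h (?y + (v $ i) *\<^sub>R axis i 1) - h ?y = partial i h (?y + t *\<^sub>R axis i 1) * (v $ i)"
        using mean_value_from_0[OF C1_deriv[OF h, of ?y i], of "v $ i"] by auto
      have vi: "\<bar>v $ j\<bar> \<le> 1" for j using component_le_norm_cart[of v j] that(2) by linarith
      have "\<bar>t\<bar> \<le> 1" using t(1) vi[of i] by linarith
      have "norm (\<Sum>i\<in>I. v $ i *\<^sub>R axis i (1::real)) \<le> (\<Sum>i\<in>I. norm (v $ i *\<^sub>R axis i (1::real) :: real ^ 'n))" by (rule norm_sum)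
      also have "\<dots> \<le> (\<Sum>i\<in>I. 1)" using vi by (intro sum_mono) (simp add: norm_axis_1)
      finally have n1: "norm (\<Sum>i\<in>I. v $ i *\<^sub>R axis i (1::real)) \<le> real (card I)" by simp
      have "norm ((\<Sum>i\<in>I. v $ i *\<^sub>R axis i 1) + t *\<^sub>R axis i (1::real)) \<le> real (card I) + 1"
        using n1 \<open>\<bar>t\<bar> \<le> 1\<close> by (intro order_trans[OF norm_triangle_ineq] add_mono) (auto simp: norm_axis_1)
      also have "\<dots> = real (card (insert i I))" using insert by simp
      also have "\<dots> \<le> real CARD('n)" by (simp only: of_nat_le_iff) (rule card_mono, auto)
      finally have "?y + t *\<^sub>R axis i 1 \<in> cball x (real CARD('n))"
        by (metis (no_types, lifting) add.assoc add_diff_cancel_left' dist_commute dist_norm mem_cball)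
      then have "\<bar>h (?y + (v $ i) *\<^sub>R axis i 1) - h ?y\<bar> \<le> B i * \<bar>v $ i\<bar>"
        unfolding t(2) abs_mult using B by (intro mult_right_mono) auto
      then show ?case using insert by (simp add: algebra_simps)
    qed simp
    have "((\<lambda>y. \<Sum>i\<in>UNIV. B i * \<bar>(y - x) $ i\<bar>) \<longlongrightarrow> (\<Sum>i\<in>UNIV. B i * \<bar>(x - x) $ i\<bar>)) (at x)"
      by (intro tendsto_intros)
    then have lim: "((\<lambda>y. \<Sum>i\<in>UNIV. B i * \<bar>(y - x) $ i\<bar>) \<longlongrightarrow> 0) (at x)" by simp
    have "\<forall>\<^sub>F y in at x. norm (h y - h x) \<le> (\<Sum>i\<in>UNIV. B i * \<bar>(y - x) $ i\<bar>)"
      unfolding eventually_at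
    proof (intro exI[of _ 1] conjI ballI impI)
      fix y assume "y \<noteq> x \<and> dist y x < 1"
      then have "norm (y - x) \<le> 1" by (simp add: dist_norm)
      then show "norm (h y - h x) \<le> (\<Sum>i\<in>UNIV. B i * \<bar>(y - x) $ i\<bar>)"
        using step[of UNIV "y - x"] by (simp add: sum_axis del: vector_minus_component)
    qed auto
    then have "((\<lambda>y. h y - h x) \<longlongrightarrow> 0) (at x)" using lim by (rule Lim_null_comparison)
    then show ?thesis unfolding isCont_def by (simp add: LIM_zero_iff)
  qed
  then show ?thesis by (simp add: continuous_at_imp_continuous_on)
qed

lemma second_derivative_test:
  fixes \<phi> \<psi> :: "real \<Rightarrow> real"
  assumes d: "\<And>t. (\<phi> has_real_derivative \<psi> t) (at t)" and c: "(\<psi> has_real_derivative c) (at 0)"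
    and max: "e > 0" "\<And>t. \<bar>t\<bar> < e \<Longrightarrow> \<phi> t \<le> \<phi> 0"
  shows "c \<le> 0"
proof (rule ccontr)
  assume "\<not> c \<le> 0"
  then have "c > 0" by simp
  have "\<psi> 0 = 0" using DERIV_local_max[OF d[of 0] max(1)] max(2) by simp
  obtain \<delta> where \<delta>: "\<delta> > 0" "\<And>h. 0 < h \<Longrightarrow> h < \<delta> \<Longrightarrow> \<psi> 0 < \<psi> (0 + h)"
    using DERIV_pos_inc_right[OF c \<open>c > 0\<close>] by blast
  define t where "t = min \<delta> e / 2"
  have t: "0 < t" "t < \<delta>" "t < e" using \<delta> max by (auto simp: t_def)
  obtain z where z: "0 < z" "z < t" "\<phi> t - \<phi> 0 = (t - 0) * \<psi> z" using MVT2[OF t(1) d] by blast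
  have "\<psi> z > 0" using \<delta>(2)[of z] z t \<open>\<psi> 0 = 0\<close> by simp
  then have "\<phi> t > \<phi> 0" using z t by (simp add: algebra_simps)
  then show False using max(2)[of t] t by simp
qed

text \<open>Adding \<open>\<delta> |x|\<^sup>2\<close> makes the Laplacian positive, which excludes an interior maximum by the second derivative test along the axes.
On the sphere the perturbation is \<open>\<delta> R\<^sup>2 = \<epsilon>\<close>.\<close>

lemma maximum_principle:
  fixes u :: "real ^ 'n \<Rightarrow> real"
  assumes R: "R > 0" and cont: "continuous_on (cball 0 R) u"
    and d1: "\<And>i x s. ((\<lambda>t. u (x + t *\<^sub>R axis i 1)) has_real_derivative u1 i (x + s *\<^sub>R axis i 1)) (at s)"
    and d2: "\<And>i x. ((\<lambda>t. u1 i (x + t *\<^sub>R axis i 1)) has_real_derivative u2 i x) (at 0)"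
    and lap: "\<And>x. (\<Sum>i\<in>UNIV. u2 i x) = 0"
    and bd: "\<And>x. norm x = R \<Longrightarrow> u x \<le> c" and x: "norm x \<le> R"
  shows "u x \<le> c"
proof (rule field_le_epsilon)
  fix \<epsilon> :: real assume \<epsilon>: "\<epsilon> > 0"
  define \<delta> where "\<delta> = \<epsilon> / R\<^sup>2"
  have \<delta>: "\<delta> > 0" using \<epsilon> R by (simp add: \<delta>_def)
  define w where "w x = u x + \<delta> * (norm x)\<^sup>2" for x
  have "continuous_on (cball 0 R) w" unfolding w_def by (intro continuous_intros cont)
  then obtain y where y: "y \<in> cball 0 R" "\<And>z. z \<in> cball 0 R \<Longrightarrow> w z \<le> w y"
    using continuous_attains_sup[of "cball 0 R" w] R by auto
  have "norm y = R"
  proof (rule ccontr)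
    assume "norm y \<noteq> R"
    then have ny: "norm y < R" using y by simp
    have "u2 i y + 2 * \<delta> \<le> 0" for i
    proof (rule second_derivative_test)
      have sq: "(norm (y + t *\<^sub>R axis i 1))\<^sup>2 = (norm y)\<^sup>2 + 2 * t * y $ i + t\<^sup>2" for t
        unfolding power2_norm_eq_inner
        by (simp add: inner_add_left inner_add_right inner_axis inner_axis' inner_axis_axis power2_eq_square algebra_simps)
      show "((\<lambda>t. w (y + t *\<^sub>R axis i 1)) has_real_derivative u1 i (y + t *\<^sub>R axis i 1) + \<delta> * (2 * y $ i + 2 * t)) (at t)" for t
        unfolding w_def sq using d1[of y i t] by (auto intro!: derivative_eq_intros)
      show "((\<lambda>t. u1 i (y + t *\<^sub>R axis i 1) + \<delta> * (2 * y $ i + 2 * t)) has_real_derivative u2 i y + 2 * \<delta>) (at 0)"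
        using d2[of i y] by (auto intro!: derivative_eq_intros)
      show "0 < R - norm y" using ny by simp
      fix t assume "\<bar>t\<bar> < R - norm y"
      then have "norm (y + t *\<^sub>R axis i (1::real)) \<le> R"
        using norm_triangle_ineq[of y "t *\<^sub>R axis i 1"] by (simp add: norm_axis_1)
      then show "w (y + t *\<^sub>R axis i 1) \<le> w (y + 0 *\<^sub>R axis i 1)" using y(2) by simp
    qed
    then have "(\<Sum>i\<in>UNIV. u2 i y + 2 * \<delta>) \<le> 0" by (intro sum_nonpos) auto
    then have "real CARD('n) * (2 * \<delta>) \<le> 0" using lap[of y] by (simp add: sum.distrib)
    moreover have "real CARD('n) * (2 * \<delta>) > 0" using \<delta> by simp
    ultimately show False by linarith
  qed
  have "u x \<le> w x" using \<delta> by (simp add: w_def)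
  also have "\<dots> \<le> w y" using y x by simp
  also have "\<dots> \<le> c + \<epsilon>" using bd[OF \<open>norm y = R\<close>] \<open>norm y = R\<close> R by (simp add: w_def \<delta>_def)
  finally show "u x \<le> c + \<epsilon>" .
qed

lemma harmonic_maximum_principle:
  fixes h P :: "real ^ 'n \<Rightarrow> real"
  assumes R: "R > 0" and h: "h \<in> harmonic_functions" and P: "P \<in> harmonic_functions"
    and bd: "\<And>x. norm x = R \<Longrightarrow> h x - P x \<le> c" and x: "norm x \<le> R"
  shows "h x - P x \<le> c"
proof (rule maximum_principle[OF R, of "\<lambda>x. h x - P x" "\<lambda>i x. partial i h x - partial i P x"
    "\<lambda>i x. partial i (partial i h) x - partial i (partial i P) x"])
  have c: "C1 h" "C1 P" "C1 (partial i h)" "C1 (partial i P)" for i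
    using h P by (auto simp: harmonic_functions_def C2_def)
  show "continuous_on (cball 0 R) (\<lambda>x. h x - P x)"
    using C1_continuous c by (intro continuous_intros) (auto intro: continuous_on_subset)
  show "((\<lambda>t. h (x + t *\<^sub>R axis i 1) - P (x + t *\<^sub>R axis i 1)) has_real_derivative
      partial i h (x + s *\<^sub>R axis i 1) - partial i P (x + s *\<^sub>R axis i 1)) (at s)" for i x s
    by (intro DERIV_diff C1_deriv c)
  show "((\<lambda>t. partial i h (x + t *\<^sub>R axis i 1) - partial i P (x + t *\<^sub>R axis i 1)) has_real_derivative
      partial i (partial i h) x - partial i (partial i P) x) (at 0)" for i x
    using DERIV_diff[OF C1_deriv[OF c(3)[of i], where x = x and i = i and s = 0]
      C1_deriv[OF c(4)[of i], where x = x and i = i and s = 0]] by simp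
  show "(\<Sum>i\<in>UNIV. partial i (partial i h) x - partial i (partial i P) x) = 0" for x
    using h P by (simp add: harmonic_functions_def laplacian_def sum_subtractf)
  show "h x - P x \<le> c" if "norm x = R" for x using that by (rule bd)
  show "norm x \<le> R" by (rule x)
qed

section \<open>Density of the harmonic polynomials\<close>

text \<open>The harmonic projections of the monomials.\<close>

primrec word_harmonic :: "'n list \<Rightarrow> real ^ 'n \<Rightarrow> real" where
  "word_harmonic [] = (\<lambda>x. 1)"
| "word_harmonic (k # w) = raise k (length w) (word_harmonic w)"

lemma solid_harmonic_word: "solid_harmonic (length w) (word_harmonic w)"
proof (induction w)
  case Nil
  show ?case by (simp add: solid_harmonic_def homogeneous_def poly_fun_const)
next
  case (Cons k w)
  then show ?case using solid_harmonic_raise by simp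
qed

text \<open>Lists of coefficients and words encode the combinations in a countable type once the coefficients are rational.\<close>

definition comb :: "(real \<times> 'n list) list \<Rightarrow> real ^ 'n \<Rightarrow> real" where
  "comb L x = (\<Sum>p\<leftarrow>L. fst p * word_harmonic (snd p) x)"

lemma comb_Nil: "comb [] = (\<lambda>x. 0)" by (simp add: comb_def fun_eq_iff)
lemma comb_Cons: "comb ((c, w) # L) = (\<lambda>x. c * word_harmonic w x + comb L x)" by (simp add: comb_def fun_eq_iff)
lemma comb_append: "comb (L @ L') x = comb L x + comb L' x" by (simp add: comb_def)
lemma comb_scale: "comb (map (\<lambda>(c, w). (d * c, w)) L) x = d * comb L x"
  by (induction L) (auto simp: comb_def algebra_simps)

lemma poly_fun_word: "poly_fun (word_harmonic w)"
  using solid_harmonic_word solid_harmonicD(1) by blast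

lemma comb_harmonic: "poly_fun (comb L)" "laplacian (comb L) = (\<lambda>x. 0)"
proof -
  have "poly_fun (comb L) \<and> laplacian (comb L) = (\<lambda>x. 0)"
  proof (induction L)
    case Nil then show ?case by (simp add: comb_Nil poly_fun_const)
  next
    case (Cons p L)
    obtain c w where p: "p = (c, w)" by force
    have "laplacian (\<lambda>x. c * word_harmonic w x + comb L x) = (\<lambda>x. 0)"
      using Cons solid_harmonicD(3)[OF solid_harmonic_word[of w]]
      by (simp add: laplacian_add laplacian_cmult poly_fun_cmult poly_fun_word)
    then show ?case using Cons by (simp add: p comb_Cons poly_fun_add poly_fun_cmult poly_fun_word)
  qed
  then show "poly_fun (comb L)" "laplacian (comb L) = (\<lambda>x. 0)" by auto
qed

lemma poly_harmonic: "poly_fun F \<Longrightarrow> laplacian F = (\<lambda>x. 0) \<Longrightarrow> F \<in> harmonic_functions"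
  by (simp add: harmonic_functions_def poly_fun_C2)

lemma raise_comb:
  "raise k d (comb L) x = (\<Sum>p\<leftarrow>L. fst p * raise k d (word_harmonic (snd p)) x)"
proof (induction L)
  case Nil then show ?case by (simp add: comb_Nil raise_def)
next
  case (Cons p L)
  obtain c w where p: "p = (c, w)" by force
  have "raise k d (comb (p # L)) x = c * raise k d (word_harmonic w) x + raise k d (comb L) x"
    by (simp add: p comb_Cons raise_def partial_add partial_cmult poly_fun_cmult poly_fun_word comb_harmonic(1)
      algebra_simps add_divide_distrib)
  then show ?case using Cons by (simp add: p)
qed

lemma raise_comb_words:
  assumes "\<forall>p\<in>set L. length (snd p) = d"
  shows "raise k d (comb L) = comb (map (\<lambda>(c, w). (c, k # w)) L)"
proof
  fix x
  show "raise k d (comb L) x = comb (map (\<lambda>(c, w). (c, k # w)) L) x"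
    using assms unfolding raise_comb comb_def by (induction L) auto
qed

text \<open>By \<open>partial_raise\<close> the derivative of \<open>raise i F\<close> consists of \<open>F\<close> and of raised derivatives of \<open>F\<close>. The length of the words is part of the claim
because \<open>raise\<close> depends on the degree.\<close>

lemma partial_word:
  "\<exists>L. partial k (word_harmonic w) = comb L \<and> (\<forall>p\<in>set L. length (snd p) = length w - 1)"
proof (induction w arbitrary: k)
  case Nil
  then show ?case by (intro exI[of _ "[]"]) (simp add: comb_Nil)
next
  case (Cons i w)
  let ?F = "word_harmonic w" and ?c = "- 2 / (real CARD('a) + 2 * real (length w) - 2)"
  obtain L1 where L1: "partial k ?F = comb L1" "\<forall>p\<in>set L1. length (snd p) = length w - 1" using Cons by blast
  obtain L2 where L2: "partial i ?F = comb L2" "\<forall>p\<in>set L2. length (snd p) = length w - 1" using Cons by blast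
  show ?case
  proof (cases w)
    case Nil
    have z: "raise j d (\<lambda>x. 0) = (\<lambda>x. 0)" for j d by (simp add: raise_def fun_eq_iff)
    have "partial k (raise i (length w) ?F) = comb [(if k = i then 1 else 0, [])]"
      using partial_raise[OF solid_harmonic_word[of w], of k i] Nil by (simp add: comb_Cons comb_Nil z fun_eq_iff)
    then show ?thesis using Nil by (intro exI[of _ "[(if k = i then 1 else 0, [])]"]) simp
  next
    case (Cons j v)
    let ?L = "(if k = i then 1 else 0, w) # map (\<lambda>(c, w). (c, i # w)) L1 @
       map (\<lambda>(c, w). (?c * c, w)) (map (\<lambda>(c, w). (c, k # w)) L2)"
    have "partial k (word_harmonic (i # w)) = comb ?L"
      using partial_raise[OF solid_harmonic_word[of w], of k i]
        raise_comb_words[OF L1(2), of i] raise_comb_words[OF L2(2), of k] comb_scale[of ?c "map (\<lambda>(c, w). (c, k # w)) L2"]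
      unfolding L1(1) L2(1) by (simp add: comb_Cons comb_append fun_eq_iff del: map_map)
    moreover have "\<forall>p\<in>set ?L. length (snd p) = length (i # w) - 1"
      using L1(2) L2(2) Cons by auto
    ultimately show ?thesis by blast
  qed
qed

text \<open>On the sphere \<open>|x|\<^sup>2\<close> is constant, so the definition of \<open>raise\<close> expresses \<open>x_k F\<close> by \<open>raise k d F\<close> and \<open>\<partial>_k F\<close>.\<close>

lemma coord_mult_word_on_sphere:
  "\<exists>L. \<forall>x. norm x = R \<longrightarrow> x $ k * word_harmonic w x = comb L x"
proof -
  obtain L where L: "partial k (word_harmonic w) = comb L" using partial_word by blast
  let ?D = "real CARD('a) + 2 * real (length w) - 2"
  have "x $ k * word_harmonic w x = comb ((1, k # w) # map (\<lambda>(c, w). (R\<^sup>2 / ?D * c, w)) L) x" if "norm x = R" for x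
    unfolding comb_Cons comb_scale using that by (simp add: raise_def L)
  then show ?thesis by blast
qed

lemma coord_mult_comb_on_sphere:
  "\<exists>L'. \<forall>x. norm x = R \<longrightarrow> x $ k * comb L x = comb L' x"
proof (induction L)
  case Nil
  then show ?case by (intro exI[of _ "[]"]) (simp add: comb_Nil)
next
  case (Cons p L)
  obtain c w where p: "p = (c, w)" by force
  obtain L1 where L1: "\<And>x. norm x = R \<Longrightarrow> x $ k * comb L x = comb L1 x" using Cons by blast
  obtain L2 where L2: "\<And>x. norm x = R \<Longrightarrow> x $ k * word_harmonic w x = comb L2 x" using coord_mult_word_on_sphere by blast
  have "x $ k * comb (p # L) x = comb (map (\<lambda>(d, w). (c * d, w)) L2 @ L1) x" if "norm x = R" for x
    unfolding p comb_Cons comb_append comb_scale L1[OF that, symmetric] L2[OF that, symmetric] by (simp add: algebra_simps)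
  then show ?case by blast
qed

lemma poly_mult_comb_on_sphere:
  assumes "poly_fun p"
  shows "\<exists>L'. \<forall>x. norm x = R \<longrightarrow> p x * comb L x = comb L' x"
  using assms
proof (induction p arbitrary: L rule: real_polynomial_function.induct)
  case (linear f)
  note bl = linear
  interpret bounded_linear f by fact
  have "f x = (\<Sum>i\<in>UNIV. x $ i * f (axis i 1))" for x
    by (subst sum_axis[symmetric]) (simp add: sum scaleR del: sum_axis)
  moreover have "\<exists>L'. \<forall>x. norm x = R \<longrightarrow> (\<Sum>i\<in>I. x $ i * f (axis i 1)) * comb L x = comb L' x" if "finite I" for I
    using that
  proof (induction I rule: finite_induct)
    case empty
    then show ?case by (intro exI[of _ "[]"]) (simp add: comb_Nil)
  next
    case (insert i I)
    then obtain L1 where L1: "\<And>x. norm x = R \<Longrightarrow> (\<Sum>i\<in>I. x $ i * f (axis i 1)) * comb L x = comb L1 x" by blast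
    obtain L2 where L2: "\<And>x. norm x = R \<Longrightarrow> x $ i * comb L x = comb L2 x" using coord_mult_comb_on_sphere by blast
    have "(\<Sum>i\<in>insert i I. x $ i * f (axis i 1)) * comb L x = comb (map (\<lambda>(d, w). (f (axis i 1) * d, w)) L2 @ L1) x" if "norm x = R" for x
      unfolding comb_append comb_scale L1[OF that, symmetric] L2[OF that, symmetric] sum.insert[OF insert.hyps]
      by (simp add: algebra_simps)
    then show ?case by blast
  qed
  ultimately show ?case by (metis finite)
next
  case (const c)
  show ?case by (rule exI[of _ "map (\<lambda>(d, w). (c * d, w)) L"]) (simp add: comb_scale)
next
  case (add f g)
  obtain L1 where L1: "\<And>x. norm x = R \<Longrightarrow> f x * comb L x = comb L1 x" using add by blast
  obtain L2 where L2: "\<And>x. norm x = R \<Longrightarrow> g x * comb L x = comb L2 x" using add by blast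
  show ?case by (rule exI[of _ "L1 @ L2"]) (simp add: comb_append L1 L2 distrib_right)
next
  case (mult f g)
  obtain L1 where L1: "\<And>x. norm x = R \<Longrightarrow> g x * comb L x = comb L1 x" using mult.IH(2) by blast
  obtain L2 where L2: "\<And>x. norm x = R \<Longrightarrow> f x * comb L1 x = comb L2 x" using mult.IH(1) by blast
  show ?case by (rule exI[of _ L2]) (simp add: L1 L2 mult.assoc)
qed

text \<open>Stone--Weierstrass on the sphere, then the maximum principle inside.\<close>

theorem harmonic_approximation:
  fixes h :: "real ^ 'n \<Rightarrow> real"
  assumes h: "h \<in> harmonic_functions" and R: "R > 0" and \<epsilon>: "\<epsilon> > 0"
  shows "\<exists>L. \<forall>x. norm x \<le> R \<longrightarrow> \<bar>h x - comb L x\<bar> \<le> \<epsilon>"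
proof -
  have "continuous_on (sphere 0 R) h"
    using h C1_continuous by (auto simp: harmonic_functions_def C2_def intro: continuous_on_subset)
  then obtain p where p: "poly_fun p" "\<And>x. x \<in> sphere 0 R \<Longrightarrow> \<bar>h x - p x\<bar> < \<epsilon>"
    using Stone_Weierstrass_real_polynomial_function[OF compact_sphere _ \<epsilon>, of 0 R h] by auto
  obtain L where L: "\<And>x. norm x = R \<Longrightarrow> p x * comb [(1, [])] x = comb L x"
    using poly_mult_comb_on_sphere[OF p(1)] by blast
  have s: "\<bar>h x - comb L x\<bar> \<le> \<epsilon>" if "norm x = R" for x
    using L[OF that] p(2)[of x] that by (simp add: comb_Cons comb_Nil)
  have hc: "comb L \<in> harmonic_functions" by (intro poly_harmonic comb_harmonic)
  have "h x - comb L x \<le> \<epsilon>" "comb L x - h x \<le> \<epsilon>" if "norm x \<le> R" for x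
    using harmonic_maximum_principle[OF R h hc, of \<epsilon> x] harmonic_maximum_principle[OF R hc h, of \<epsilon> x] s that
    by fastforce+
  then show ?thesis by (intro exI[of _ L]) (auto simp: abs_le_iff)
qed

definition rat_comb :: "(rat \<times> 'n list) list \<Rightarrow> real ^ 'n \<Rightarrow> real" where
  "rat_comb L = comb (map (\<lambda>(c, w). (of_rat c, w)) L)"

lemma rat_comb_dense:
  fixes L :: "(real \<times> 'n::finite list) list"
  assumes \<epsilon>: "\<epsilon> > 0"
  shows "\<exists>L'. \<forall>x. norm x \<le> R \<longrightarrow> \<bar>comb L x - rat_comb L' x\<bar> \<le> \<epsilon>"
  using \<epsilon>
proof (induction L arbitrary: \<epsilon>)
  case Nil
  then show ?case by (intro exI[of _ "[]"]) (simp add: rat_comb_def comb_Nil)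
next
  case (Cons p L)
  obtain c w where p: "p = (c, w)" by force
  obtain M where M: "M \<ge> 0" "c2_bound R (word_harmonic w) M" using c2_bound_ex[OF poly_fun_word] by blast
  obtain L' where L': "\<And>x. norm x \<le> R \<Longrightarrow> \<bar>comb L x - rat_comb L' x\<bar> \<le> \<epsilon> / 2"
    using Cons.IH[of "\<epsilon> / 2"] Cons.prems by auto
  have "c < c + \<epsilon> / (2 * (M + 1))" using Cons.prems M by simp
  then obtain q where q: "c < of_rat q" "of_rat q < c + \<epsilon> / (2 * (M + 1))" using of_rat_dense by blast
  have "\<bar>comb (p # L) x - rat_comb ((q, w) # L') x\<bar> \<le> \<epsilon>" if x: "norm x \<le> R" for x
  proof -
    have "\<bar>(c - of_rat q) * word_harmonic w x\<bar> \<le> \<epsilon> / (2 * (M + 1)) * (M + 1)"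
      unfolding abs_mult using q c2_boundD(1)[OF M(2) x] M Cons.prems by (intro mult_mono) auto
    also have "\<dots> = \<epsilon> / 2" using M by (simp add: field_simps)
    finally have "\<bar>(c - of_rat q) * word_harmonic w x\<bar> + \<bar>comb L x - rat_comb L' x\<bar> \<le> \<epsilon>"
      using L'[OF x] by linarith
    moreover have "comb (p # L) x - rat_comb ((q, w) # L') x =
        (c - of_rat q) * word_harmonic w x + (comb L x - rat_comb L' x)"
      by (simp add: p rat_comb_def comb_Cons algebra_simps)
    ultimately show ?thesis by (metis abs_triangle_ineq order_trans)
  qed
  then show ?case by blast
qed

corollary harmonic_approximation_rat:
  fixes h :: "real ^ 'n \<Rightarrow> real"
  assumes h: "h \<in> harmonic_functions" and \<epsilon>: "\<epsilon> > 0"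
  shows "\<exists>L. \<forall>x. norm x \<le> R \<longrightarrow> \<bar>h x - rat_comb L x\<bar> < \<epsilon>"
proof -
  obtain L where L: "\<And>x. norm x \<le> max R 1 \<Longrightarrow> \<bar>h x - comb L x\<bar> \<le> \<epsilon> / 3"
    using harmonic_approximation[OF h, of "max R 1" "\<epsilon> / 3"] \<epsilon> by (metis divide_pos_pos less_max_iff_disj zero_less_numeral zero_less_one)
  obtain L' where L': "\<And>x. norm x \<le> R \<Longrightarrow> \<bar>comb L x - rat_comb L' x\<bar> \<le> \<epsilon> / 3"
    using rat_comb_dense[of "\<epsilon> / 3" R L] \<epsilon> by auto
  have "\<bar>h x - rat_comb L' x\<bar> < \<epsilon>" if "norm x \<le> R" for x
    using L[of x] L'[OF that] that \<epsilon> by linarith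
  then show ?thesis by blast
qed

section \<open>Separated sets of positive lower density\<close>

lemma card_multiples_le:
  assumes "d > 0" shows "card {i. 1 \<le> i \<and> i \<le> n \<and> d dvd i} = n div d"
proof -
  have "{i. 1 \<le> i \<and> i \<le> n \<and> d dvd i} = (\<lambda>q. d * q) ` {1..n div d}" (is "?A = ?B")
  proof
    show "?A \<subseteq> ?B"
    proof
      fix i assume i: "i \<in> ?A"
      then obtain q where q: "i = d * q" by auto
      then have "q \<le> n div d" using i assms by (metis div_le_mono mem_Collect_eq nonzero_mult_div_cancel_left not_less0)
      moreover have "q \<ge> 1" using i q by (cases q) auto
      ultimately show "i \<in> ?B" using q by auto
    qed
    show "?B \<subseteq> ?A"
    proof
      fix i assume "i \<in> ?B"
      then obtain q where "q \<in> {1..n div d}" and q1: "i = d * q" by blast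
      then have q: "i = d * q" "1 \<le> q" "q \<le> n div d" by simp_all
      have "d * q \<le> d * (n div d)" using q by simp
      also have "\<dots> \<le> n" by simp
      finally show "i \<in> ?A" using q assms by (auto simp: Suc_le_eq)
    qed
  qed
  then show ?thesis using assms by (simp add: card_image inj_on_def)
qed

text \<open>The indices of dyadic valuation \<open>e l\<close>. They have density \<open>2^-(e l + 1)\<close>, so wide gaps can be reserved around them at small
total cost when \<open>e l\<close> is large.\<close>

definition ruler :: "(nat \<Rightarrow> nat) \<Rightarrow> nat \<Rightarrow> nat set" where
  "ruler e l = {j. 1 \<le> j \<and> 2 ^ e l dvd j \<and> \<not> 2 ^ Suc (e l) dvd j}"

lemma ruler_disjoint:
  assumes "strict_mono e" "j \<in> ruler e l" "j \<in> ruler e l'" shows "l = l'"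
proof -
  have *: False if "l < l'" "j \<in> ruler e l" "j \<in> ruler e l'" for l l'
  proof -
    have "Suc (e l) \<le> e l'" using that assms(1) by (simp add: strict_mono_def Suc_le_eq)
    then have "(2 :: nat) ^ Suc (e l) dvd 2 ^ e l'" by (rule le_imp_power_dvd)
    then show False using that dvd_trans unfolding ruler_def by blast
  qed
  show ?thesis using *[of l l'] *[of l' l] assms(2,3) by (meson linorder_neqE_nat)
qed

text \<open>Index the points by \<open>j = 1, 2, ...\<close> and give \<open>j\<close> the label \<open>l\<close> if it lies in \<open>ruler e l\<close>. The point \<open>pos j\<close> is the midpoint of an interval
of length \<open>2 u j\<close> with \<open>u j \<ge> s l\<close>, and these intervals are placed one after the other; so the distance of two points is at least the sum of
their half lengths. Choosing \<open>2^(e l) \<ge> 2^l s l\<close> keeps the average of \<open>u\<close> at most 3, whence \<open>pos j \<le> 6 j\<close> and the density of the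
indices with label \<open>l\<close> passes to the points.\<close>

lemma separated_sets_exist:
  fixes s :: "nat \<Rightarrow> nat"
  assumes s: "\<And>l. s l \<ge> 1"
  shows "\<exists>A :: nat \<Rightarrow> nat set.
    (\<forall>l. \<exists>c>0. \<exists>m0. \<forall>m\<ge>m0. c * real m \<le> real (card (A l \<inter> {..m}))) \<and>
    (\<forall>l l'. \<forall>n\<in>A l. \<forall>n'\<in>A l'. n < n' \<longrightarrow> n + s l \<le> n' \<and> n + s l' \<le> n') \<and>
    (\<forall>l. \<forall>n\<in>A l. s l \<le> n) \<and> (\<forall>l l' n. n \<in> A l \<longrightarrow> n \<in> A l' \<longrightarrow> l = l')"
proof -
  define e where "e l = (\<Sum>i\<le>l. s i + i)" for l
  have e_mono: "strict_mono e"
    unfolding strict_mono_Suc_iff e_def using s by (simp add: add_pos_nonneg)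
  have e_ge: "2 ^ l * s l \<le> 2 ^ e l" for l
  proof -
    have "s l + l \<le> e l" unfolding e_def by (rule member_le_sum) auto
    then have "(2 :: nat) ^ (s l + l) \<le> 2 ^ e l" by (rule power_increasing) simp
    have "s l \<le> 2 ^ s l" by (simp add: less_imp_le)
    then have "2 ^ l * s l \<le> 2 ^ l * 2 ^ s l" by (rule mult_le_mono2)
    also have "\<dots> = 2 ^ (s l + l)" by (simp add: power_add)
    finally show ?thesis using \<open>2 ^ (s l + l) \<le> 2 ^ e l\<close> by (rule le_trans)
  qed
  define R where "R = ruler e"
  \<comment> \<open>the sum has at most one nonzero term, and labels of \<open>j\<close> are less than \<open>j\<close>\<close>
  define u where "u j = 1 + (\<Sum>l<j. if j \<in> R l then s l else 0)" for j
  have lj: "l < j" if "j \<in> R l" for j l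
  proof -
    have "l \<le> e l" using e_mono by (rule strict_mono_imp_increasing)
    also have "e l < 2 ^ e l" by simp
    also have "2 ^ e l \<le> j" using that by (auto simp: R_def ruler_def intro: dvd_imp_le)
    finally show ?thesis .
  qed
  have uS: "u j \<ge> s l" if "j \<in> R l" for j l
  proof -
    have "s l = (if j \<in> R l then s l else 0)" using that by simp
    also have "\<dots> \<le> (\<Sum>l<j. if j \<in> R l then s l else 0)" using lj[OF that] by (intro member_le_sum) auto
    finally show ?thesis by (simp add: u_def)
  qed
  have u1: "u j \<ge> 1" for j by (simp add: u_def)
  define V where "V j = (\<Sum>i\<in>{1..<j}. u i)" for j
  define pos where "pos j = 2 * V j + u j" for j
  have VS: "V j' \<ge> V j + u j" if "1 \<le> j" "j < j'" for j j'
  proof -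
    have "V j + u j = (\<Sum>i\<in>insert j {1..<j}. u i)" by (simp add: V_def)
    also have "\<dots> \<le> V j'" unfolding V_def using that by (intro sum_mono2) auto
    finally show ?thesis .
  qed
  have pos_gap: "pos j + u j + u j' \<le> pos j'" if "1 \<le> j" "j < j'" for j j'
    using VS[OF that] by (simp add: pos_def)
  have pos_inj: "j = j'" if "1 \<le> j" "1 \<le> j'" "pos j = pos j'" for j j'
  proof (rule ccontr)
    assume "j \<noteq> j'"
    then consider "j < j'" | "j' < j" by linarith
    then show False
      using pos_gap[of j j'] pos_gap[of j' j] that u1[of j] by cases auto
  qed
  have V_le: "V (Suc j) \<le> 3 * j" for j
  proof -
    have "{1..<Suc j} = {1..j}" by auto
    then have "V (Suc j) = (\<Sum>i\<in>{1..j}. 1 + (\<Sum>l<i. if i \<in> R l then s l else 0))" by (simp add: V_def u_def)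
    also have "\<dots> \<le> (\<Sum>i\<in>{1..j}. 1 + (\<Sum>l<j. if i \<in> R l then s l else 0))"
      by (intro sum_mono add_left_mono sum_mono2) auto
    also have "\<dots> = j + (\<Sum>l<j. \<Sum>i\<in>{1..j}. if i \<in> R l then s l else 0)"
      by (subst sum.distrib, subst sum.swap) simp
    also have "(\<Sum>l<j. \<Sum>i\<in>{1..j}. if i \<in> R l then s l else 0) = (\<Sum>l<j. s l * card ({1..j} \<inter> R l))"
      by (simp add: sum.If_cases mult.commute Int_def)
    finally have "real (V (Suc j)) \<le> real (j + (\<Sum>l<j. s l * card ({1..j} \<inter> R l)))" by (simp only: of_nat_le_iff)
    also have "real (j + (\<Sum>l<j. s l * card ({1..j} \<inter> R l))) \<le> 3 * real j"
    proof -
      have "real (s l * card ({1..j} \<inter> R l)) \<le> real j * (1/2) ^ l" for l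
      proof -
        have "card ({1..j} \<inter> R l) \<le> card {i. 1 \<le> i \<and> i \<le> j \<and> 2 ^ e l dvd i}"
          by (intro card_mono finite_subset[of "{i. 1 \<le> i \<and> i \<le> j \<and> 2 ^ e l dvd i}" "{1..j}"]) (auto simp: R_def ruler_def)
        also have "\<dots> = j div 2 ^ e l" by (rule card_multiples_le) simp
        finally have "s l * card ({1..j} \<inter> R l) \<le> s l * (j div 2 ^ e l)" by simp
        then have "2 ^ l * (s l * card ({1..j} \<inter> R l)) \<le> (2 ^ l * s l) * (j div 2 ^ e l)" by (simp add: mult.assoc)
        also have "\<dots> \<le> 2 ^ e l * (j div 2 ^ e l)" using e_ge by (rule mult_le_mono1)
        also have "\<dots> \<le> j" by simp
        finally have "real (2 ^ l * (s l * card ({1..j} \<inter> R l))) \<le> real j" by (simp only: of_nat_le_iff)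
        then show ?thesis by (simp add: power_one_over field_simps)
      qed
      then have "(\<Sum>l<j. real (s l * card ({1..j} \<inter> R l))) \<le> (\<Sum>l<j. real j * (1/2) ^ l)" by (rule sum_mono)
      also have "\<dots> = real j * (\<Sum>l<j. (1/2) ^ l)" by (simp add: sum_distrib_left)
      also have "\<dots> \<le> real j * 2"
      proof (rule mult_left_mono)
        have "(\<Sum>l<j. (1/2 :: real) ^ l) \<le> (\<Sum>l. (1/2) ^ l)" by (rule sum_le_suminf) (auto intro: summable_geometric)
        then show "(\<Sum>l<j. (1/2 :: real) ^ l) \<le> 2" by (simp add: suminf_geometric)
      qed simp
      finally show ?thesis by simp
    qed
    finally show ?thesis by simp
  qed
  define A where "A l = pos ` R l" for l
  have R1: "1 \<le> j" if "j \<in> R l" for j l using that by (auto simp: R_def ruler_def)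
  show ?thesis
  proof (intro exI[of _ A] conjI allI ballI impI)
    fix l
    define d :: nat where "d = 12 * 2 ^ e l"
    have d: "(d :: nat) > 0" by (simp add: d_def)
    have card_ge: "m div d \<le> card (A l \<inter> {..m})" for m
    proof -
      let ?f = "\<lambda>i. pos (2 ^ e l * (2 * i + 1))"
      have inR: "2 ^ e l * (2 * i + 1) \<in> R l" for i
      proof -
        have "\<not> (2 :: nat) ^ e l * 2 dvd 2 ^ e l * (2 * i + 1)"
          by (subst nat_mult_dvd_cancel_disj) simp
        then show ?thesis by (simp add: R_def ruler_def Suc_le_eq mult.commute[of 2])
      qed
      have "inj_on ?f {..<m div d}"
      proof (rule inj_onI)
        fix i i' assume "?f i = ?f i'"
        then have "2 ^ e l * (2 * i + 1) = 2 ^ e l * (2 * i' + 1)"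
          using pos_inj[OF R1[OF inR] R1[OF inR]] by blast
        then show "i = i'" by simp
      qed
      then have "m div d = card (?f ` {..<m div d})" by (simp add: card_image)
      also have "\<dots> \<le> card (A l \<inter> {..m})"
      proof (rule card_mono)
        show "?f ` {..<m div d} \<subseteq> A l \<inter> {..m}"
        proof clarify
          fix i assume i: "i < m div d"
          define j where "j = 2 ^ e l * (2 * i + 1)"
          have "pos j \<le> 2 * (V j + u j)" by (simp add: pos_def)
          also have "V j + u j \<le> V (Suc j)" using VS[of j "Suc j"] R1[OF inR[of i]] by (simp add: j_def)
          also have "V (Suc j) \<le> 3 * j" by (rule V_le)
          finally have "pos j \<le> 6 * j" by simp
          also have "6 * j \<le> d * (i + 1)" by (simp add: j_def d_def algebra_simps)
          also have "\<dots> \<le> d * (m div d)" using i by (intro mult_le_mono2) simp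
          also have "\<dots> \<le> m" by simp
          finally show "pos (2 ^ e l * (2 * i + 1)) \<in> A l \<inter> {..m}"
            using inR[of i] by (auto simp: A_def j_def)
        qed
      qed simp
      finally show ?thesis .
    qed
    show "\<exists>c>0. \<exists>m0. \<forall>m\<ge>m0. c * real m \<le> real (card (A l \<inter> {..m}))"
    proof (intro exI conjI allI impI)
      show "1 / (2 * real d) > 0" using d by simp
      fix m assume m: "2 * d \<le> m"
      have "m < d * (m div d) + d" using d by (metis add.commute add_less_cancel_left mod_less_divisor mult_div_mod_eq)
      then have "m \<le> 2 * (d * (m div d))" using m by linarith
      then have "m \<le> 2 * d * (m div d)" by (simp only: mult.assoc)
      then have "real m \<le> 2 * real d * real (m div d)" by (metis of_nat_le_iff of_nat_mult of_nat_numeral)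
      also have "\<dots> \<le> 2 * real d * real (card (A l \<inter> {..m}))" using card_ge by (intro mult_left_mono) auto
      finally show "1 / (2 * real d) * real m \<le> real (card (A l \<inter> {..m}))" using d by (simp add: field_simps)
    qed
  next
    fix l l' n n' assume n: "n \<in> A l" "n' \<in> A l'" "n < n'"
    then obtain j j' where j: "j \<in> R l" "n = pos j" "j' \<in> R l'" "n' = pos j'" by (auto simp: A_def)
    have "j < j'"
    proof (rule ccontr)
      assume "\<not> j < j'"
      then have "j' < j \<or> j' = j" by auto
      then have "pos j' \<le> pos j" using pos_gap[of j' j] R1[OF j(3)] by auto
      then show False using n j by simp
    qed
    then show "n + s l \<le> n'" "n + s l' \<le> n'"
      using pos_gap[of j j'] R1[OF j(1)] uS[OF j(1)] uS[OF j(3)] j by simp_all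
  next
    fix l n assume "n \<in> A l" then show "s l \<le> n" using uS by (auto simp: A_def pos_def intro: le_trans trans_le_add2)
  next
    fix l l' n assume "n \<in> A l" "n \<in> A l'"
    then obtain j j' where j: "j \<in> R l" "n = pos j" "j' \<in> R l'" "n = pos j'" by (auto simp: A_def)
    then have "j = j'" using pos_inj R1 by metis
    then show "l = l'" using ruler_disjoint[OF e_mono] j by (auto simp: R_def)
  qed
qed

section \<open>Series of harmonic polynomials\<close>

lemma continuous_series:
  fixes G :: "nat \<Rightarrow> real ^ 'n \<Rightarrow> real"
  assumes G: "\<And>n. continuous_on UNIV (G n)"
    and b: "\<And>\<rho>. \<exists>M. summable M \<and> (\<forall>n x. norm x \<le> \<rho> \<longrightarrow> \<bar>G n x\<bar> \<le> M n)"
  shows "continuous_on UNIV (\<lambda>x. \<Sum>n. G n x)"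
proof -
  have "isCont (\<lambda>x. \<Sum>n. G n x) x" for x
  proof -
    obtain M where M: "summable M" "\<And>n y. norm y \<le> norm x + 1 \<Longrightarrow> \<bar>G n y\<bar> \<le> M n" using b by metis
    have u: "uniform_limit (ball 0 (norm x + 1)) (\<lambda>n y. \<Sum>i<n. G i y) (\<lambda>y. \<Sum>i. G i y) sequentially"
      by (rule Weierstrass_m_test[OF _ M(1)]) (use M(2) in auto)
    have "continuous_on (ball 0 (norm x + 1)) (\<lambda>y. \<Sum>i. G i y)"
      by (rule uniform_limit_theorem[OF _ u])
         (auto intro!: always_eventually continuous_on_sum continuous_on_subset[OF G])
    then show ?thesis by (rule continuous_on_interior) simp
  qed
  then show ?thesis by (simp add: continuous_at_imp_continuous_on)
qed

lemma series_C1: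
  fixes F :: "nat \<Rightarrow> real ^ 'n \<Rightarrow> real"
  assumes C1: "\<And>n. C1 (F n)"
    and b: "\<And>\<rho>. \<exists>M. summable M \<and> (\<forall>n. c1_bound \<rho> (F n) (M n))"
  shows "C1 (\<lambda>x. \<Sum>n. F n x)" "partial i (\<lambda>x. \<Sum>n. F n x) = (\<lambda>x. \<Sum>n. partial i (F n) x)"
proof -
  have d: "((\<lambda>t. \<Sum>n. F n (x + t *\<^sub>R axis i 1)) has_real_derivative (\<Sum>n. partial i (F n) x)) (at 0)" for x i
  proof -
    obtain M where M: "summable M" "\<And>n. c1_bound (norm x + 1) (F n) (M n)" using b by metis
    have nb: "norm (x + t *\<^sub>R axis i 1) \<le> norm x + 1" if "t \<in> {-1..1}" for t :: real
      using norm_triangle_ineq[of x "t *\<^sub>R axis i 1"] that by (auto simp: abs_le_iff)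
    have "((\<lambda>t. \<Sum>n. F n (x + t *\<^sub>R axis i 1)) has_real_derivative (\<Sum>n. partial i (F n) (x + 0 *\<^sub>R axis i 1))) (at 0)"
    proof (rule has_field_derivative_series'(2)[of "{-1..1}" "\<lambda>n t. F n (x + t *\<^sub>R axis i 1)"
        "\<lambda>n t. partial i (F n) (x + t *\<^sub>R axis i 1)" 0 0])
      show "((\<lambda>t. F n (x + t *\<^sub>R axis i 1)) has_real_derivative partial i (F n) (x + t *\<^sub>R axis i 1)) (at t within {-1..1})" for n t
        by (rule has_field_derivative_at_within[OF C1_deriv[OF C1]])
      show "uniformly_convergent_on {-1..1} (\<lambda>n t. \<Sum>m<n. partial i (F m) (x + t *\<^sub>R axis i 1))"
        by (rule Weierstrass_m_test'[OF _ M(1)]) (use M(2) nb in \<open>auto simp: c1_bound_def\<close>)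
      have "norm (F n x) \<le> M n" for n using M(2)[of n] by (simp add: c1_bound_def)
      then show "summable (\<lambda>n. F n (x + 0 *\<^sub>R axis i 1))"
        using summable_comparison_test'[OF M(1), of 0 "\<lambda>n. F n x"] by simp
    qed auto
    then show ?thesis by simp
  qed
  show p: "partial i (\<lambda>x. \<Sum>n. F n x) = (\<lambda>x. \<Sum>n. partial i (F n) x)" for i
    by (rule ext) (rule partial_eqI[OF d])
  show "C1 (\<lambda>x. \<Sum>n. F n x)"
    unfolding C1_def p
  proof (intro allI conjI)
    show "(\<lambda>t. \<Sum>n. F n (x + t *\<^sub>R axis i 1)) differentiable at 0" for i x
      using d[where x = x and i = i] real_differentiable_def by blast
    show "continuous_on UNIV (\<lambda>x. \<Sum>n. partial i (F n) x)" for i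
    proof (rule continuous_series)
      show "continuous_on UNIV (partial i (F n))" for n using C1[of n] unfolding C1_def by blast
      fix \<rho>
      obtain M where "summable M" "\<And>n. c1_bound \<rho> (F n) (M n)" using b by metis
      then show "\<exists>M. summable M \<and> (\<forall>n x. norm x \<le> \<rho> \<longrightarrow> \<bar>partial i (F n) x\<bar> \<le> M n)"
        unfolding c1_bound_def by blast
    qed
  qed
qed

text \<open>Uniform absolute convergence on balls of the series and of its termwise derivatives up to order two.\<close>

definition normally_convergent :: "(nat \<Rightarrow> real ^ 'n \<Rightarrow> real) \<Rightarrow> bool" where
  "normally_convergent F \<longleftrightarrow> (\<forall>\<rho>. \<exists>M. summable M \<and> (\<forall>n. c2_bound \<rho> (F n) (M n)))"

lemma normally_convergentD:
  assumes "normally_convergent F"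
  obtains M where "summable M" "\<And>n. c2_bound \<rho> (F n) (M n)"
  using assms unfolding normally_convergent_def by blast

lemma normally_convergent_summable:
  assumes "normally_convergent F" shows "summable (\<lambda>n. F n x)"
proof -
  obtain M where M: "summable M" "\<And>n. c2_bound (norm x) (F n) (M n)" using normally_convergentD[OF assms] by metis
  have "norm (F n x) \<le> M n" for n using c2_boundD(1)[OF M(2)] by simp
  then show ?thesis using summable_comparison_test'[OF M(1), of 0 "\<lambda>n. F n x"] by simp
qed

lemma harmonic_series:
  fixes F :: "nat \<Rightarrow> real ^ 'n \<Rightarrow> real"
  assumes F: "\<And>n. poly_fun (F n)" "\<And>n. laplacian (F n) = (\<lambda>x. 0)" and b: "normally_convergent F"
  shows "(\<lambda>x. \<Sum>n. F n x) \<in> harmonic_functions"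
    "partial i (\<lambda>x. \<Sum>n. F n x) = (\<lambda>x. \<Sum>n. partial i (F n) x)"
proof -
  have b0: "\<exists>M. summable M \<and> (\<forall>n. c1_bound \<rho> (F n) (M n))" for \<rho>
    using normally_convergentD[OF b] unfolding c2_bound_def by metis
  have b1: "\<exists>M. summable M \<and> (\<forall>n. c1_bound \<rho> (partial i (F n)) (M n))" for \<rho> i
    using normally_convergentD[OF b] unfolding c2_bound_def by metis
  note s0 = series_C1[OF poly_fun_C1[OF F(1)] b0]
  note s1 = series_C1[OF poly_fun_C1[OF poly_fun_partial[OF F(1)]] b1]
  show p: "partial i (\<lambda>x. \<Sum>n. F n x) = (\<lambda>x. \<Sum>n. partial i (F n) x)" for i by (rule s0(2))
  have "laplacian (\<lambda>x. \<Sum>n. F n x) x = 0" for x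
  proof -
    have sm: "summable (\<lambda>n. partial i (partial i (F n)) x)" for i
    proof -
      obtain M where M: "summable M" "\<And>n. c2_bound (norm x) (F n) (M n)" using normally_convergentD[OF b] by metis
      have "norm (partial i (partial i (F n)) x) \<le> M n" for n using c2_boundD(3)[OF M(2)] by simp
      then show ?thesis using summable_comparison_test'[OF M(1), of 0 "\<lambda>n. partial i (partial i (F n)) x"] by simp
    qed
    have "laplacian (\<lambda>x. \<Sum>n. F n x) x = (\<Sum>i\<in>UNIV. \<Sum>n. partial i (partial i (F n)) x)"
      unfolding laplacian_def p s1(2) ..
    also have "\<dots> = (\<Sum>n. \<Sum>i\<in>UNIV. partial i (partial i (F n)) x)"
      using sm by (intro suminf_sum[symmetric])
    also have "\<dots> = 0" using fun_cong[OF F(2), of _ x] by (simp add: laplacian_def)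
    finally show ?thesis .
  qed
  moreover have "C2 (\<lambda>x. \<Sum>n. F n x)"
    unfolding C2_def p using s0(1) s1(1) by (intro conjI allI)
  ultimately show "(\<lambda>x. \<Sum>n. F n x) \<in> harmonic_functions"
    by (simp add: harmonic_functions_def)
qed

text \<open>Finitely many terms cause no problem, since polynomials are bounded on balls.\<close>

lemma normally_convergentI:
  assumes F: "\<And>n. poly_fun (F n)" and ev: "\<And>\<rho>. \<exists>N c. \<forall>n\<ge>N. c2_bound \<rho> (F n) (c * (1 / 2) ^ n)"
  shows "normally_convergent F"
  unfolding normally_convergent_def
proof
  fix \<rho>
  obtain N c where N: "\<And>n. n \<ge> N \<Longrightarrow> c2_bound \<rho> (F n) (c * (1 / 2) ^ n)" using ev by blast
  have "\<forall>n. \<exists>M. c2_bound \<rho> (F n) M" using c2_bound_ex F by blast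
  then obtain B where B: "\<And>n. c2_bound \<rho> (F n) (B n)" by metis
  define M where "M n = (if n < N then B n else c * (1 / 2) ^ n)" for n
  have "summable (\<lambda>n. c * (1 / 2 :: real) ^ (n + N))"
    by (intro summable_mult summable_ignore_initial_segment summable_geometric) simp
  then have "summable (\<lambda>n. M (n + N))" by (simp add: M_def)
  then have "summable M" by (simp only: summable_iff_shift)
  moreover have "c2_bound \<rho> (F n) (M n)" for n using N B by (simp add: M_def)
  ultimately show "\<exists>M. summable M \<and> (\<forall>n. c2_bound \<rho> (F n) (M n))" by blast
qed

section \<open>Construction of the frequently hypercyclic function\<close>

lemma factorial_decay_eventually:
  assumes "factorial_decay Q"
  shows "\<exists>s. \<forall>n\<ge>s. c2_bound \<rho> (Q n) ((1 / 2) ^ n)"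
proof -
  obtain M B where MB: "M \<ge> 0" "B \<ge> 1" "\<And>n. c2_bound \<rho> (Q n) (M * B ^ n / fact n)"
    using assms unfolding factorial_decay_def by blast
  have "(\<lambda>n. inverse (fact n) * (2 * B) ^ n) \<longlonglongrightarrow> 0"
    by (rule summable_LIMSEQ_zero) (rule summable_exp)
  then have "(\<lambda>n. M * (inverse (fact n) * (2 * B) ^ n)) \<longlonglongrightarrow> M * 0" by (rule tendsto_mult_left)
  then have "\<forall>\<^sub>F n in sequentially. M * (inverse (fact n) * (2 * B) ^ n) < 1"
    by (rule order_tendstoD) simp
  then obtain s where s: "\<And>n. n \<ge> s \<Longrightarrow> M * (inverse (fact n) * (2 * B) ^ n) < 1"
    unfolding eventually_sequentially by blast
  have "c2_bound \<rho> (Q n) ((1 / 2) ^ n)" if "n \<ge> s" for n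
  proof (rule c2_bound_mono[OF MB(3) order_refl])
    have e: "(2 * B) ^ n * (1 / 2) ^ n = B ^ n" by (simp only: power_mult_distrib[symmetric]) simp
    have "M * B ^ n / fact n = M * (inverse (fact n) * (2 * B) ^ n) * (1 / 2) ^ n"
      unfolding e[symmetric] by (simp only: divide_inverse mult_ac)
    also have "\<dots> \<le> 1 * (1 / 2) ^ n" using s[OF that] by (intro mult_right_mono) auto
    finally show "M * B ^ n / fact n \<le> (1 / 2) ^ n" by simp
  qed
  then show ?thesis by blast
qed

lemma admissible_comb:
  fixes k :: "'n::finite"
  assumes N: "CARD('n) \<ge> 2"
  shows "\<exists>Q. admissible k Q \<and> Q 0 = comb L"
proof (induction L)
  case Nil
  obtain Q where Q: "admissible k Q" using admissible_exists[OF N solid_harmonic_word] by blast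
  show ?case using admissible_cmult[OF Q, of 0] by (intro exI[of _ "\<lambda>n x. 0 * Q n x"]) (auto simp: comb_Nil)
next
  case (Cons p L)
  obtain c w where p: "p = (c, w)" by force
  obtain Q where Q: "admissible k Q" "Q 0 = word_harmonic w"
    using admissible_exists[OF N solid_harmonic_word] by metis
  obtain R where R: "admissible k R" "R 0 = comb L" using Cons by blast
  show ?case
    using admissible_add[OF admissible_cmult[OF Q(1), of c] R(1)]
    by (intro exI[of _ "\<lambda>n x. c * Q n x + R n x"]) (auto simp: p comb_Cons Q(2) R(2))
qed

lemma admissible_pow:
  assumes "admissible k Q"
  shows "(partial k ^^ n) (Q (n + i)) = Q i"
proof (induction n)
  case (Suc n)
  have "(partial k ^^ Suc n) (Q (Suc n + i)) = (partial k ^^ n) (partial k (Q (Suc (n + i))))"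
    by (simp only: funpow_Suc_right o_apply add_Suc)
  then show ?case using Suc admissibleD(3)[OF assms] by simp
qed simp

lemma laplacian_partial_pow:
  assumes "poly_fun F" "laplacian F = (\<lambda>x. 0)"
  shows "laplacian ((partial k ^^ n) F) = (\<lambda>x. 0)"
  by (induction n) (simp_all add: laplacian_partial poly_fun_partial_pow assms)

text \<open>Cauchy--Schwarz with weights \<open>2^-(l+1)\<close>, whose sum is at most 1; by induction from \<open>(u + v)\<^sup>2 \<le> 2u\<^sup>2 + 2v\<^sup>2\<close>.\<close>

lemma square_sum_weighted:
  fixes g :: "nat \<Rightarrow> real"
  shows "(\<Sum>l<M. g l)\<^sup>2 \<le> (\<Sum>l<M. 2 ^ Suc l * (g l)\<^sup>2)"
proof (induction M arbitrary: g)
  case (Suc M)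
  have "(\<Sum>l<Suc M. g l)\<^sup>2 = (g 0 + (\<Sum>l<M. g (Suc l)))\<^sup>2" by (simp only: sum.lessThan_Suc_shift)
  also have "\<dots> \<le> 2 * (g 0)\<^sup>2 + 2 * (\<Sum>l<M. g (Suc l))\<^sup>2"
    using zero_le_power2[of "g 0 - (\<Sum>l<M. g (Suc l))"] by (simp add: power2_eq_square algebra_simps)
  also have "\<dots> \<le> 2 * (g 0)\<^sup>2 + 2 * (\<Sum>l<M. 2 ^ Suc l * (g (Suc l))\<^sup>2)"
    using Suc[of "\<lambda>l. g (Suc l)"] by simp
  also have "\<dots> = (\<Sum>l<Suc M. 2 ^ Suc l * (g l)\<^sup>2)"
    by (simp only: sum.lessThan_Suc_shift) (simp add: sum_distrib_left mult_ac)
  finally show ?case .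
qed simp

text \<open>The number \<open>s l\<close> serves as radius of the gap around the points of \<open>A l\<close>. That many derivatives annihilate the target
(\<open>nil\<close>); antiderivatives of the targets \<open>l' \<le> l\<close> of order at least \<open>s l\<close> are negligible on the ball of radius \<open>l\<close> (\<open>decay\<close>); and
as gap it makes the contribution of \<open>A l\<close> to the mean square at most \<open>C\<^sup>2 / 4^(l+1)\<close> times the required order (last part of \<open>K\<close>).\<close>

locale fh_construction =
  fixes k :: "'n::finite" and C :: real
    and Q :: "nat \<Rightarrow> nat \<Rightarrow> real ^ 'n \<Rightarrow> real" and K :: "nat \<Rightarrow> real" and s :: "nat \<Rightarrow> nat" and A :: "nat \<Rightarrow> nat set"
  assumes C: "C > 0"
    and Q: "\<And>l. admissible k (Q l)"
    and nil: "\<And>l. (partial k ^^ s l) (Q l 0) = (\<lambda>x. 0)"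
    and K: "\<And>l. K l \<ge> 0" "\<And>l. mean_square_growth (Q l) (K l)" "\<And>l. K l / sqrt (real (s l)) \<le> C\<^sup>2 / 4 ^ Suc l"
    and s_ge: "\<And>l. s l \<ge> l + 2"
    and decay: "\<And>l l' i. l' \<le> l \<Longrightarrow> i \<ge> s l \<Longrightarrow> c2_bound (real l) (Q l' i) ((1 / 2) ^ i)"
    and A_dens: "\<And>l. \<exists>c>0. \<exists>m0. \<forall>m\<ge>m0. c * real m \<le> real (card (A l \<inter> {..m}))"
    and A_gap: "\<And>l l' n n'. n \<in> A l \<Longrightarrow> n' \<in> A l' \<Longrightarrow> n < n' \<Longrightarrow> n + s l \<le> n' \<and> n + s l' \<le> n'"
    and A_ge: "\<And>l n. n \<in> A l \<Longrightarrow> s l \<le> n"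
    and A_disj: "\<And>l l' n. n \<in> A l \<Longrightarrow> n \<in> A l' \<Longrightarrow> l = l'"
begin

lemma A_unbounded: "\<exists>a\<in>A l. n \<le> a"
proof (rule ccontr)
  assume "\<not> ?thesis"
  then have sub: "A l \<inter> {..m} \<subseteq> {..<n}" for m by force
  obtain c m0 where c: "c > 0" "\<And>m. m \<ge> m0 \<Longrightarrow> c * real m \<le> real (card (A l \<inter> {..m}))" using A_dens by blast
  obtain m1 where m1: "real n / c < real m1" using reals_Archimedean2 by blast
  have "c * real (max m0 m1) \<le> real (card (A l \<inter> {..max m0 m1}))" by (rule c) simp
  also have "\<dots> \<le> real (card {..<n})" by (simp only: of_nat_le_iff) (rule card_mono[OF _ sub], simp)
  finally have "real (max m0 m1) \<le> real n / c" using c by (simp add: field_simps)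
  moreover have "real m1 \<le> real (max m0 m1)" by simp
  ultimately show False using m1 by linarith
qed

text \<open>At most one summand is present, because the sets \<open>A l\<close> are disjoint. The sum over \<open>l \<le> n\<close> contains all labels of \<open>n\<close>, as \<open>l < s l \<le> n\<close> for
\<open>n \<in> A l\<close>; this form lets the order of summation over labels and points be exchanged.\<close>

definition "F n = (\<lambda>x. \<Sum>l\<le>n. if n \<in> A l then Q l n x else 0)"

lemma F_in: assumes "n \<in> A l" shows "F n = Q l n"
proof
  fix x
  have "l \<le> n" using A_ge[OF assms] s_ge[of l] by simp
  have "n \<in> A l' \<longleftrightarrow> l' = l" for l' using A_disj assms by blast
  then have "F n x = (\<Sum>l'\<le>n. if l' = l then Q l n x else 0)"
    unfolding F_def by (intro sum.cong) auto
  then show "F n x = Q l n x" using \<open>l \<le> n\<close> by simp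
qed

lemma F_out: "(\<And>l. n \<notin> A l) \<Longrightarrow> F n = (\<lambda>x. 0)"
  by (simp add: F_def)

lemma F_cases:
  obtains (zero) "F n = (\<lambda>x. 0)" "\<And>l. n \<notin> A l" | (label) l where "n \<in> A l" "F n = Q l n"
  using F_in F_out by blast

lemma F_poly: "poly_fun (F n)" "laplacian (F n) = (\<lambda>x. 0)"
proof -
  have "poly_fun (F n) \<and> laplacian (F n) = (\<lambda>x. 0)"
    by (cases n rule: F_cases) (auto simp: poly_fun_const admissibleD(1,2)[OF Q])
  then show "poly_fun (F n)" "laplacian (F n) = (\<lambda>x. 0)" by auto
qed

definition "D n i = (partial k ^^ n) (F i)"

lemma D_poly: "poly_fun (D n i)" "laplacian (D n i) = (\<lambda>x. 0)"
  unfolding D_def by (simp_all add: poly_fun_partial_pow laplacian_partial_pow F_poly)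

lemma D_zero: "(\<And>l. i \<notin> A l) \<Longrightarrow> D n i = (\<lambda>x. 0)"
  by (simp add: D_def F_out partial_pow_zero)

lemma D_later: assumes "i \<in> A l" "n \<le> i" shows "D n i = Q l (i - n)"
  using admissible_pow[OF Q, of n l "i - n"] assms by (simp add: D_def F_in)

lemma D_earlier: assumes "i \<in> A l" "i + s l \<le> n" shows "D n i = (\<lambda>x. 0)"
proof -
  obtain j where j: "n = j + s l + i" using assms(2) by (metis add.commute add.left_commute le_Suc_ex)
  have "(partial k ^^ i) (Q l i) = Q l 0" using admissible_pow[OF Q, of i l 0] by simp
  then show ?thesis
    by (simp add: D_def F_in[OF assms(1)] j funpow_add nil partial_pow_zero)
qed

text \<open>The condition for the larger of the two labels gives the bound.\<close>

lemma decay_either: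
  assumes "s l \<le> i" "s l' \<le> i" shows "c2_bound (real l) (Q l' i) ((1 / 2) ^ i)"
proof (cases "l' \<le> l")
  case True then show ?thesis using decay assms by blast
next
  case False
  then have "c2_bound (real l') (Q l' i) ((1 / 2) ^ i)" using decay[of l' l' i] assms by simp
  then show ?thesis by (rule c2_bound_mono) (use False in auto)
qed

text \<open>The \<open>i\<close>-th term is an antiderivative of order \<open>i - n\<close>, which must exceed \<open>s l\<close> for the label \<open>l\<close> of \<open>i\<close>. Comparing with a fixed
point \<open>a \<ge> n\<close> of \<open>A 0\<close> shows this for all \<open>i > a\<close>: the gap condition reads \<open>a + s l \<le> i\<close>.\<close>

lemma D_normally_convergent: "normally_convergent (D n)"
proof (rule normally_convergentI)
  show "poly_fun (D n i)" for i by (rule D_poly)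
  fix \<rho> :: real
  define l0 where "l0 = nat \<lceil>\<rho>\<rceil>"
  have l0: "\<rho> \<le> real l0" by (simp add: l0_def real_nat_ceiling_ge)
  obtain a where a: "a \<in> A 0" "n \<le> a" using A_unbounded by blast
  have "c2_bound \<rho> (D n i) (2 ^ n * (1 / 2) ^ i)" if i: "i \<ge> a + s l0 + 1" for i
  proof (cases i rule: F_cases)
    case zero
    then have "D n i = (\<lambda>x. 0)" by (intro D_zero)
    then show ?thesis by (simp add: c2_bound_zero)
  next
    case (label l)
    have "a + s l \<le> i" using A_gap[OF a(1) label(1)] i by simp
    then have "s l0 \<le> i - n" "s l \<le> i - n" "n \<le> i" using a i by auto
    then have "c2_bound (real l0) (Q l (i - n)) ((1 / 2) ^ (i - n))" by (intro decay_either)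
    then have "c2_bound \<rho> (Q l (i - n)) (2 ^ n * (1 / 2) ^ i)"
    proof (rule c2_bound_mono[OF _ l0])
      have "(1 / 2 :: real) ^ i = (1 / 2) ^ (i - n) * (1 / 2) ^ n" using \<open>n \<le> i\<close> by (simp flip: power_add)
      then show "(1 / 2 :: real) ^ (i - n) \<le> 2 ^ n * (1 / 2) ^ i" by (simp add: power_one_over)
    qed
    then show ?thesis using D_later[OF label(1) \<open>n \<le> i\<close>] by simp
  qed
  then show "\<exists>N c. \<forall>i\<ge>N. c2_bound \<rho> (D n i) (c * (1 / 2) ^ i)" by blast
qed

definition "h = (\<lambda>x. \<Sum>i. F i x)"

lemma iterate_h: "(partial k ^^ n) h = (\<lambda>x. \<Sum>i. D n i x)"
proof (induction n)
  case 0 then show ?case by (simp add: h_def D_def)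
next
  case (Suc n)
  then show ?case
    using harmonic_series(2)[OF D_poly D_normally_convergent, of k n] by (simp add: D_def)
qed

lemma iterate_harmonic: "(partial k ^^ n) h \<in> harmonic_functions"
  unfolding iterate_h by (rule harmonic_series(1)[OF D_poly D_normally_convergent])

lemma h_harmonic: "h \<in> harmonic_functions"
  using iterate_harmonic[of 0] by simp

text \<open>Terms before \<open>n\<close> are annihilated and the term at \<open>n\<close> has become the target. No points lie between \<open>n\<close> and \<open>n + s l\<close>, and the later
terms are bounded by a geometric series.\<close>

lemma hit:
  assumes n: "n \<in> A l" and x: "norm x \<le> real l"
  shows "\<bar>(partial k ^^ n) h x - Q l 0 x\<bar> \<le> (1 / 2) ^ l"
proof -
  let ?m = "n + s l"
  have sm: "summable (\<lambda>i. D n i x)" by (rule normally_convergent_summable[OF D_normally_convergent])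
  have tail: "\<bar>D n (j + ?m) x\<bar> \<le> (1 / 2) ^ (j + s l)" for j
  proof (cases "j + ?m" rule: F_cases)
    case zero
    then show ?thesis using D_zero by simp
  next
    case (label l')
    have "n < j + ?m" using s_ge[of l] by simp
    then have "n + s l' \<le> j + ?m" using A_gap[OF n label(1)] by blast
    then have "c2_bound (real l) (Q l' (j + s l)) ((1 / 2) ^ (j + s l))" by (intro decay_either) auto
    then show ?thesis using D_later[OF label(1), of n] c2_boundD(1)[OF _ x] by simp
  qed
  have head: "D n i x = (if i = n then Q l 0 x else 0)" if "i < ?m" for i
  proof (cases "i = n")
    case True
    then show ?thesis using D_later[OF n, of n] by simp
  next
    case False
    have "D n i = (\<lambda>x. 0)"
    proof (cases i rule: F_cases)
      case zero then show ?thesis by (intro D_zero)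
    next
      case (label l')
      show ?thesis
      proof (cases "i < n")
        case True
        then show ?thesis using A_gap[OF label(1) n] by (intro D_earlier[OF label(1)]) simp
      next
        case False
        then have "n < i" using \<open>i \<noteq> n\<close> by simp
        then show ?thesis using A_gap[OF n label(1)] that by simp
      qed
    qed
    then show ?thesis using False by simp
  qed
  have "(\<Sum>i<?m. D n i x) = (\<Sum>i<?m. if i = n then Q l 0 x else 0)" using head by (intro sum.cong) auto
  also have "\<dots> = Q l 0 x" using s_ge[of l] by simp
  finally have "(partial k ^^ n) h x - Q l 0 x = (\<Sum>j. D n (j + ?m) x)"
    unfolding iterate_h using suminf_split_initial_segment[OF sm, of ?m] by simp
  also have "\<bar>\<dots>\<bar> \<le> (\<Sum>j. (1 / 2) ^ (j + s l))"
  proof -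
    have g: "summable (\<lambda>j. (1 / 2 :: real) ^ (j + s l))" by (intro summable_ignore_initial_segment summable_geometric) simp
    have "norm (\<Sum>j. D n (j + ?m) x) \<le> (\<Sum>j. (1 / 2) ^ (j + s l))"
      by (rule norm_suminf_le[OF _ g]) (use tail in simp)
    then show ?thesis by simp
  qed
  also have "\<dots> = (1 / 2) ^ s l * 2"
    by (simp add: power_add suminf_mult2[symmetric] suminf_geometric summable_geometric)
  also have "\<dots> \<le> (1 / 2) ^ (l + 1) * 2"
    using s_ge[of l] by (intro mult_right_mono power_decreasing) auto
  also have "\<dots> = (1 / 2) ^ l" by simp
  finally show ?thesis .
qed

text \<open>Split the partial sum by labels, use \<open>square_sum_weighted\<close> and then \<open>mean_square_growth\<close> for each label with gap \<open>s l\<close>.\<close>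

lemma partial_sum_mean_square:
  assumes \<sigma>: "sphere_invariant \<sigma>" "measure \<sigma> UNIV = 1" and r: "r > 0"
  shows "(\<integral>x. (\<Sum>i<M. F i (r *\<^sub>R x))\<^sup>2 \<partial>\<sigma>) \<le> C\<^sup>2 * (exp (2 * r) / r powr (real CARD('n) - 3 / 2))"
proof -
  let ?X = "exp (2 * r) / r powr (real CARD('n) - 3 / 2)"
  let ?S = "\<lambda>l. A l \<inter> {..<M}"
  let ?g = "\<lambda>l x. \<Sum>i\<in>?S l. Q l i (r *\<^sub>R x)"
  have X: "?X \<ge> 0" by simp
  have cg: "continuous_on UNIV (?g l)" for l by (rule continuous_scaled_sum) (rule admissibleD(1)[OF Q])
  have cF: "continuous_on UNIV (\<lambda>x. \<Sum>i<M. F i (r *\<^sub>R x))" by (rule continuous_scaled_sum) (rule F_poly)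
  have eq: "(\<Sum>i<M. F i y) = (\<Sum>l<M. \<Sum>i\<in>?S l. Q l i y)" for y
  proof -
    have "(\<Sum>i<M. F i y) = (\<Sum>i<M. \<Sum>l<M. if i \<in> A l then Q l i y else 0)"
    proof (intro sum.cong refl)
      fix i assume i: "i \<in> {..<M}"
      show "F i y = (\<Sum>l<M. if i \<in> A l then Q l i y else 0)"
        unfolding F_def
      proof (rule sum.mono_neutral_left)
        show "\<forall>l\<in>{..<M} - {..i}. (if i \<in> A l then Q l i y else 0) = 0"
        proof
          fix l assume "l \<in> {..<M} - {..i}"
          then have "i \<notin> A l" using A_ge[of i l] s_ge[of l] by auto
          then show "(if i \<in> A l then Q l i y else 0) = 0" by simp
        qed
      qed (use i in auto)
    qed
    also have "\<dots> = (\<Sum>l<M. \<Sum>i<M. if i \<in> A l then Q l i y else 0)" by (rule sum.swap)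
    also have "\<dots> = (\<Sum>l<M. \<Sum>i\<in>?S l. Q l i y)"
      by (intro sum.cong[OF refl]) (subst Int_commute, simp add: sum.inter_restrict)
    finally show ?thesis .
  qed
  have sep: "separated (s l) (?S l)" for l using A_gap[of _ l _ l] by (auto simp: separated_def)
  have ig: "integrable \<sigma> (\<lambda>x. 2 ^ Suc l * (?g l x)\<^sup>2)" for l
    by (intro integrable_sphere \<sigma> continuous_intros cg)
  have "(\<integral>x. (\<Sum>i<M. F i (r *\<^sub>R x))\<^sup>2 \<partial>\<sigma>) \<le> (\<integral>x. (\<Sum>l<M. 2 ^ Suc l * (?g l x)\<^sup>2) \<partial>\<sigma>)"
  proof (rule integral_mono)
    show "integrable \<sigma> (\<lambda>x. (\<Sum>i<M. F i (r *\<^sub>R x))\<^sup>2)" by (intro integrable_sphere \<sigma> continuous_intros cF)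
    show "integrable \<sigma> (\<lambda>x. \<Sum>l<M. 2 ^ Suc l * (?g l x)\<^sup>2)" using ig by (rule Bochner_Integration.integrable_sum)
    show "(\<Sum>i<M. F i (r *\<^sub>R x))\<^sup>2 \<le> (\<Sum>l<M. 2 ^ Suc l * (?g l x)\<^sup>2)" for x
      unfolding eq by (rule square_sum_weighted)
  qed
  also have "\<dots> = (\<Sum>l<M. 2 ^ Suc l * (\<integral>x. (?g l x)\<^sup>2 \<partial>\<sigma>))"
    using ig by (subst Bochner_Integration.integral_sum) auto
  also have "\<dots> \<le> (\<Sum>l<M. (1 / 2) ^ Suc l * (C\<^sup>2 * ?X))"
  proof (rule sum_mono)
    fix l
    have "(\<integral>x. (?g l x)\<^sup>2 \<partial>\<sigma>) \<le> K l / sqrt (real (s l)) * ?X"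
      using s_ge[of l] sep A_ge by (intro mean_square_growthD[OF K(2) \<sigma> r]) auto
    also have "\<dots> \<le> C\<^sup>2 / 4 ^ Suc l * ?X" by (intro mult_right_mono K X)
    finally have "2 ^ Suc l * (\<integral>x. (?g l x)\<^sup>2 \<partial>\<sigma>) \<le> 2 ^ Suc l * (C\<^sup>2 / 4 ^ Suc l * ?X)" by (intro mult_left_mono) auto
    also have "\<dots> = (1 / 2) ^ Suc l * (C\<^sup>2 * ?X)"
    proof -
      have "(4 :: real) ^ Suc l = 2 ^ Suc l * 2 ^ Suc l" by (simp flip: power_mult_distrib)
      then show ?thesis by (simp add: power_one_over)
    qed
    finally show "2 ^ Suc l * (\<integral>x. (?g l x)\<^sup>2 \<partial>\<sigma>) \<le> (1 / 2) ^ Suc l * (C\<^sup>2 * ?X)" .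
  qed
  also have "\<dots> = (\<Sum>l<M. (1 / 2) ^ Suc l) * (C\<^sup>2 * ?X)" by (rule sum_distrib_right[symmetric])
  also have "\<dots> \<le> 1 * (C\<^sup>2 * ?X)"
  proof (rule mult_right_mono)
    have "(\<Sum>l<M. (1 / 2 :: real) ^ Suc l) = 1 - (1 / 2) ^ M" by (induction M) auto
    then show "(\<Sum>l<M. (1 / 2 :: real) ^ Suc l) \<le> 1" by simp
  qed (use X in simp)
  finally show ?thesis by simp
qed

text \<open>The partial sums converge boundedly on the sphere.\<close>

lemma M2_h:
  assumes r: "r > 0"
  shows "M2 h r \<le> C * (exp r / r powr (real CARD('n) / 2 - 3 / 4))"
proof -
  let ?X = "exp (2 * r) / r powr (real CARD('n) - 3 / 2)"
  obtain \<sigma> :: "(real ^ 'n) measure" where \<sigma>: "sphere_invariant \<sigma>" "measure \<sigma> UNIV = 1"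
    "\<And>h. continuous_on UNIV h \<Longrightarrow> M2 h r = sqrt (\<integral>x. (h (r *\<^sub>R x))\<^sup>2 \<partial>\<sigma>)"
    using ex_sphere_invariant[OF r, where 'n = 'n] by blast
  interpret finite_measure \<sigma> using sphere_invariantD \<sigma>(1) by blast
  have ch: "continuous_on UNIV h" using h_harmonic C1_continuous by (auto simp: harmonic_functions_def C2_def)
  have D0: "D 0 = F" by (simp add: D_def fun_eq_iff)
  have nc: "normally_convergent F" using D_normally_convergent[of 0] by (simp add: D0)
  obtain B where B: "summable B" "\<And>i. c2_bound r (F i) (B i)" using normally_convergentD[OF nc] by metis
  have cF: "continuous_on UNIV (\<lambda>x. \<Sum>i<M. F i (r *\<^sub>R x))" for M by (rule continuous_scaled_sum) (rule F_poly)
  have chr: "continuous_on UNIV (\<lambda>x. h (r *\<^sub>R x))"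
    by (rule continuous_on_compose2[OF ch]) (auto intro!: continuous_intros)
  have "(\<lambda>M. \<integral>x. (\<Sum>i<M. F i (r *\<^sub>R x))\<^sup>2 \<partial>\<sigma>) \<longlonglongrightarrow> (\<integral>x. (h (r *\<^sub>R x))\<^sup>2 \<partial>\<sigma>)"
  proof (rule integral_dominated_convergence[where w = "\<lambda>_. (suminf B)\<^sup>2"])
    show "(\<lambda>x. (h (r *\<^sub>R x))\<^sup>2) \<in> borel_measurable \<sigma>"
      by (intro continuous_measurable_sphere \<sigma> continuous_intros chr)
    show "(\<lambda>x. (\<Sum>i<M. F i (r *\<^sub>R x))\<^sup>2) \<in> borel_measurable \<sigma>" for M
      by (intro continuous_measurable_sphere \<sigma> continuous_intros cF)
    show "integrable \<sigma> (\<lambda>_. (suminf B)\<^sup>2)" by simp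
    have "(\<lambda>M. (\<Sum>i<M. F i (r *\<^sub>R x))\<^sup>2) \<longlonglongrightarrow> (h (r *\<^sub>R x))\<^sup>2" for x
      unfolding h_def by (intro tendsto_power summable_LIMSEQ normally_convergent_summable[OF nc])
    then show "AE x in \<sigma>. (\<lambda>M. (\<Sum>i<M. F i (r *\<^sub>R x))\<^sup>2) \<longlonglongrightarrow> (h (r *\<^sub>R x))\<^sup>2" by simp
    fix M
    show "AE x in \<sigma>. norm ((\<Sum>i<M. F i (r *\<^sub>R x))\<^sup>2) \<le> (suminf B)\<^sup>2"
      using sphere_invariantD(3)[OF \<sigma>(1)]
    proof eventually_elim
      case (elim x)
      then have nx: "norm (r *\<^sub>R x) \<le> r" using r by simp
      have B0: "B i \<ge> 0" for i using c2_bound_nonneg[OF B(2)] r by simp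
      have "\<bar>\<Sum>i<M. F i (r *\<^sub>R x)\<bar> \<le> (\<Sum>i<M. \<bar>F i (r *\<^sub>R x)\<bar>)" by (rule sum_abs)
      also have "\<dots> \<le> (\<Sum>i<M. B i)" by (intro sum_mono c2_boundD(1)[OF B(2) nx])
      also have "\<dots> \<le> suminf B" by (intro sum_le_suminf B B0) auto
      finally have "\<bar>\<Sum>i<M. F i (r *\<^sub>R x)\<bar>\<^sup>2 \<le> (suminf B)\<^sup>2" by (intro power_mono) auto
      then show ?case by simp
    qed
  qed
  then have "(\<integral>x. (h (r *\<^sub>R x))\<^sup>2 \<partial>\<sigma>) \<le> C\<^sup>2 * ?X"
    by (rule LIMSEQ_le_const2) (use partial_sum_mean_square[OF \<sigma>(1,2) r] in blast)
  also have "\<dots> = (C * (exp r / r powr (real CARD('n) / 2 - 3 / 4)))\<^sup>2"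
  proof -
    have "(r powr (real CARD('n) / 2 - 3 / 4))\<^sup>2 = r powr (real CARD('n) - 3 / 2)"
      by (simp add: power2_eq_square powr_add[symmetric])
    moreover have "(exp r)\<^sup>2 = exp (2 * r)" by (simp add: power2_eq_square exp_add[symmetric])
    ultimately show ?thesis by (simp add: power_mult_distrib power_divide)
  qed
  finally show ?thesis
    unfolding \<sigma>(3)[OF ch] using C by (intro real_le_lsqrt) (auto intro!: mult_nonneg_nonneg)
qed

text \<open>If \<open>Q l 0\<close> is close to \<open>f\<close> on the ball of radius \<open>R \<le> l\<close>, then all times in \<open>A l\<close> are visits of the neighbourhood of \<open>f\<close>.\<close>

lemma h_frequently_hypercyclic:
  assumes dense: "\<And>f R \<epsilon>. f \<in> harmonic_functions \<Longrightarrow> \<epsilon> > 0 \<Longrightarrow>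
     \<exists>l. R \<le> real l \<and> (1 / 2) ^ l < \<epsilon> \<and> (\<forall>x. norm x \<le> R \<longrightarrow> \<bar>f x - Q l 0 x\<bar> < \<epsilon>)"
  shows "frequently_hypercyclic harmonic_topology (partial k) h"
  unfolding frequently_hypercyclic_def topspace_harmonic_topology openin_harmonic_topology
proof (intro conjI allI impI h_harmonic)
  fix U :: "(real ^ 'n \<Rightarrow> real) set" assume "locally_uniform_open U \<and> U \<noteq> {}"
  then obtain f where U: "locally_uniform_open U" and f: "f \<in> U" by blast
  then have fh: "f \<in> harmonic_functions" unfolding locally_uniform_open_def by blast
  obtain S \<epsilon> where S: "compact S" "\<epsilon> > 0" "{g \<in> harmonic_functions. \<forall>x\<in>S. \<bar>g x - f x\<bar> < \<epsilon>} \<subseteq> U"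
    using U f unfolding locally_uniform_open_def by meson
  obtain R where R: "\<And>x. x \<in> S \<Longrightarrow> norm x \<le> R" using compact_imp_bounded[OF S(1)] unfolding bounded_iff by blast
  obtain l where l: "R \<le> real l" "(1 / 2) ^ l < \<epsilon> / 2" "\<And>x. norm x \<le> R \<Longrightarrow> \<bar>f x - Q l 0 x\<bar> < \<epsilon> / 2"
    using dense[OF fh, of "\<epsilon> / 2" R] S(2) by (metis half_gt_zero)
  have hitU: "(partial k ^^ n) h \<in> U" if n: "n \<in> A l" for n
  proof -
    have "\<bar>(partial k ^^ n) h x - f x\<bar> < \<epsilon>" if "x \<in> S" for x
      using hit[OF n, of x] R[OF that] l(1,2) l(3)[of x] by linarith
    then show ?thesis using iterate_harmonic S(3) by blast
  qed
  obtain c m0 where c: "c > 0" "\<And>m. m \<ge> m0 \<Longrightarrow> c * real m \<le> real (card (A l \<inter> {..m}))" using A_dens by blast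
  have "\<forall>\<^sub>F m in sequentially. ereal c \<le> ereal (real (card {n. n \<le> m \<and> (partial k ^^ n) h \<in> U}) / real m)"
    using eventually_ge_at_top[of "max m0 1"]
  proof eventually_elim
    case (elim m)
    have "c * real m \<le> real (card (A l \<inter> {..m}))" using elim by (intro c) simp
    also have "\<dots> \<le> real (card {n. n \<le> m \<and> (partial k ^^ n) h \<in> U})"
      by (simp only: of_nat_le_iff) (rule card_mono, auto intro: hitU finite_subset[of _ "{..m}"])
    finally show ?case using elim by (simp add: le_divide_eq)
  qed
  then have "ereal c \<le> liminf (\<lambda>m. ereal (real (card {n. n \<le> m \<and> (partial k ^^ n) h \<in> U}) / real m))"
    by (rule Liminf_bounded)
  moreover have "0 < ereal c" using c by simp
  ultimately show "0 < liminf (\<lambda>m. ereal (real (card {n. n \<le> m \<and> (partial k ^^ n) h \<in> U}) / real m))"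
    by (rule less_le_trans[rotated])
qed

end

theorem theorem2p1:
  fixes k :: "'n::finite" and C :: real
  assumes "CARD('n) \<ge> 2" and "C > 0"
  shows "\<exists>h :: real ^ 'n \<Rightarrow> real. h \<in> harmonic_functions \<and>
           frequently_hypercyclic harmonic_topology (partial k) h \<and>
           (\<forall>r>0. M2 h r \<le> C * (exp r / r powr (real CARD('n) / 2 - 3 / 4)))"
proof -
  \<comment> \<open>the second component of the code makes every rational combination occur at arbitrarily large \<open>l\<close>\<close>
  define P :: "nat \<Rightarrow> real ^ 'n \<Rightarrow> real" where "P l = rat_comb (from_nat (fst (prod_decode l)))" for l
  have "\<forall>l. \<exists>Q. admissible k Q \<and> Q 0 = P l"
    unfolding P_def rat_comb_def using admissible_comb[OF assms(1), of k] by blast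
  then obtain Q where Qs: "\<And>l. admissible k (Q l)" "\<And>l. Q l 0 = P l" by metis
  have "\<forall>l. \<exists>m. (partial k ^^ m) (Q l 0) = (\<lambda>x. 0)" using admissibleD(4)[OF Qs(1)] by blast
  then obtain m where m: "\<And>l. (partial k ^^ m l) (Q l 0) = (\<lambda>x. 0)" by metis
  have "\<forall>l. \<exists>K\<ge>0. mean_square_growth (Q l) K" using admissibleD(6)[OF Qs(1)] by blast
  then obtain K where K: "\<And>l. K l \<ge> 0" "\<And>l. mean_square_growth (Q l) (K l)" by metis
  have "\<forall>l \<rho>. \<exists>t. \<forall>n\<ge>t. c2_bound \<rho> (Q l n) ((1 / 2) ^ n)"
    using factorial_decay_eventually[OF admissibleD(5)[OF Qs(1)]] by blast
  then obtain T where T: "\<And>l \<rho> n. n \<ge> T l \<rho> \<Longrightarrow> c2_bound \<rho> (Q l n) ((1 / 2) ^ n)" by metis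
  \<comment> \<open>the square root of \<open>G l\<close> is at least \<open>K l 4^(l+1) / C\<^sup>2\<close>\<close>
  define G where "G l = nat \<lceil>(K l * 4 ^ Suc l / C\<^sup>2)\<^sup>2\<rceil>" for l
  define s where "s l = l + 2 + m l + (\<Sum>l'\<le>l. T l' (real l)) + G l" for l
  have s1: "s l \<ge> 1" for l by (simp add: s_def)
  obtain A where A: "\<forall>l. \<exists>c>0. \<exists>m0. \<forall>m\<ge>m0. c * real m \<le> real (card (A l \<inter> {..m}))"
    "\<forall>l l'. \<forall>n\<in>A l. \<forall>n'\<in>A l'. n < n' \<longrightarrow> n + s l \<le> n' \<and> n + s l' \<le> n'"
    "\<forall>l. \<forall>n\<in>A l. s l \<le> n" "\<forall>l l' n. n \<in> A l \<longrightarrow> n \<in> A l' \<longrightarrow> l = l'"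
    using separated_sets_exist[of s, OF s1] by (elim exE conjE) (rule that)
  interpret fh_construction k C Q K s A
  proof
    show "C > 0" by fact
    show "admissible k (Q l)" for l by (rule Qs)
    show "(partial k ^^ s l) (Q l 0) = (\<lambda>x. 0)" for l
    proof -
      have "s l = (l + 2 + (\<Sum>l'\<le>l. T l' (real l)) + G l) + m l" by (simp add: s_def)
      then show ?thesis by (simp only: funpow_add o_apply m partial_pow_zero)
    qed
    show "K l \<ge> 0" "mean_square_growth (Q l) (K l)" for l by (rule K)+
    show "K l / sqrt (real (s l)) \<le> C\<^sup>2 / 4 ^ Suc l" for l
    proof -
      let ?v = "K l * 4 ^ Suc l / C\<^sup>2"
      have v: "?v \<ge> 0" using K by simp
      have "?v\<^sup>2 \<le> real (G l)" unfolding G_def by (rule real_nat_ceiling_ge)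
      also have "real (G l) \<le> real (s l)" unfolding of_nat_le_iff by (simp add: s_def)
      finally have "?v \<le> sqrt (real (s l))" using real_le_rsqrt by blast
      then have "K l * 4 ^ Suc l \<le> C\<^sup>2 * sqrt (real (s l))" using assms(2) by (simp add: pos_divide_le_eq mult.commute)
      moreover have "sqrt (real (s l)) > 0" using s1[of l] by simp
      ultimately show ?thesis by (simp add: divide_simps mult_ac)
    qed
    show "s l \<ge> l + 2" for l by (simp add: s_def)
    show "c2_bound (real l) (Q l' i) ((1 / 2) ^ i)" if "l' \<le> l" "i \<ge> s l" for l l' i
    proof (rule T)
      have "T l' (real l) \<le> (\<Sum>l'\<le>l. T l' (real l))" using that by (intro member_le_sum) auto
      then show "T l' (real l) \<le> i" using that by (simp add: s_def)
    qed
    show "\<exists>c>0. \<exists>m0. \<forall>m\<ge>m0. c * real m \<le> real (card (A l \<inter> {..m}))" for l using A(1) by (rule spec)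
    show "n + s l \<le> n' \<and> n + s l' \<le> n'" if "n \<in> A l" "n' \<in> A l'" "n < n'" for l l' n n' using A(2) that by blast
    show "s l \<le> n" if "n \<in> A l" for l n using A(3) that by blast
    show "l = l'" if "n \<in> A l" "n \<in> A l'" for l l' n using A(4) that by blast
  qed
  have "frequently_hypercyclic harmonic_topology (partial k) h"
  proof (rule h_frequently_hypercyclic)
    fix f :: "real ^ 'n \<Rightarrow> real" and R \<epsilon> :: real
    assume f: "f \<in> harmonic_functions" and \<epsilon>: "\<epsilon> > 0"
    obtain L where L: "\<And>x. norm x \<le> R \<Longrightarrow> \<bar>f x - rat_comb L x\<bar> < \<epsilon>" using harmonic_approximation_rat[OF f \<epsilon>] by blast
    obtain q1 where q1: "R < real q1" using reals_Archimedean2 by blast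
    obtain q2 where q2: "(1 / 2 :: real) ^ q2 < \<epsilon>" using real_arch_pow_inv[OF \<epsilon>, of "1 / 2"] by auto
    define l where "l = prod_encode (to_nat L, max q1 q2)"
    have l: "max q1 q2 \<le> l" unfolding l_def by (rule le_prod_encode_2)
    have "(1 / 2 :: real) ^ l \<le> (1 / 2) ^ q2" using l by (intro power_decreasing) auto
    then have "(1 / 2 :: real) ^ l < \<epsilon>" using q2 by (rule le_less_trans)
    moreover have "Q l 0 = rat_comb L" unfolding Qs(2) P_def l_def by simp
    moreover have "real q1 \<le> real l" using l by simp
    ultimately show "\<exists>l. R \<le> real l \<and> (1 / 2) ^ l < \<epsilon> \<and> (\<forall>x. norm x \<le> R \<longrightarrow> \<bar>f x - Q l 0 x\<bar> < \<epsilon>)"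
      using L q1 by (intro exI[of _ l]) auto
  qed
  then show ?thesis using h_harmonic M2_h by blast
qed

end
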